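(* Let $\Delta\ge2$, $q\ge\Delta+1$ be integers, $d=\Delta-1$. Suppose there exists an integer $\ell\ge2$ such that: (1) there exist constants $\alpha=(\alpha_0,\dots,\alpha_\ell)$ and $\beta$ such that for all $f:\Omega(\mu^\star_\ell)\to\mathbb{R}_{\ge0}$, $$\mathrm{Var}_{\mu^\star_\ell}\big[\mu_{\mathbb{T}^\star_\ell\setminus\{r\}}[f]\big]\le\sum_{i=0}^{\ell}\alpha_i\sum_{e\in L_i(\mathbb{T}^\star_\ell)}\mu^\star_\ell[\mathrm{Var}_e[f]]+\beta\sum_{e\in L_1(\mathbb{T}^\star_\ell)}\mu^\star_\ell[\mathrm{Var}_{\{e,r\}}[f]];$$ (2) there exists $\gamma$ such that for every $1\le j\le\ell$, both $\mu_j$ and $\mu^{\star,1}_j$ satisfy approximate tensorization of variance with constant $\gamma$. Then for every $k\ge1$, $\mu_k$ satisfies block factorization of variance with constants $C'(B)$, $B\subseteq E(\mathbb{T}_k)$, where $C'(B)\le\beta\gamma\cdot\big(\max_{0\le j\le\ell}\alpha_j\sum_{i=0}^{\lfloor k/\ell\rfloor}\alpha_\ell^{\,i}+\max\{1,\alpha_0\}\big)$ if $B\in\mathcal{P}(\mathbb{T}_k)$, and $C'(B)=0$ if $B\notin\mathcal{P}(\mathbb{T}_k)$.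
   Context: $\mathbb{T}_k$: complete $\Delta$-regular tree of depth $k$ (root has $\Delta$ children, other non-leaf vertices have $d$ children). $\mathbb{T}^\star_k$: complete $d$-ary tree of depth $k$ with root $u$ plus an extra hanging root edge $r=\{u,v\}$, $v$ a new leaf. Levels: $L_0(\mathbb{T}^\star_k)=\{r\}$; $L_1$ = edges incident to the root other than $r$ (for $\mathbb{T}_k$: all edges at the root); $L_i$ = edges at line-graph distance $i-1$ from $L_1$. $\mu_k$: uniform proper edge colorings of $\mathbb{T}_k$ with lists $[q]$; $\mu^\star_k$: uniform list edge colorings of $\mathbb{T}^\star_k$ with list $[q-d]$ on $r$ and $[q]$ elsewhere; $\mu^{\star,1}_k$: same with list $\{1\}$ on $r$. For a distribution $\mu$ on $\Omega\subseteq[q]^E$, $S\subseteq E$, $\sigma\in\Omega$: $\mu_S[f](\sigma)$ and $\mathrm{Var}_S[f](\sigma)$ are the expectation and variance of $f$ under $\mu$ conditioned on agreeing with $\sigma$ outside $S$; $\mathrm{Var}_e=\mathrm{Var}_{\{e\}}$. Approximate tensorization with constant $\gamma$: $\mathrm{Var}_\mu[f]\le\gamma\sum_e\mu[\mathrm{Var}_e[f]]$ for all $f\ge0$. Block factorization of variance with constants $(C(B))_{B\subseteq E}$: $\mathrm{Var}_\mu[f]\le\sum_{B\subseteq E}C(B)\mu[\mathrm{Var}_B[f]]$ for all $f\ge0$. $\mathcal{P}(\mathbb{T})$ is the collection of all singleton edge sets $\{e\}$ and all pairs $\{e,e'\}$ of adjacent edges of $\mathbb{T}$.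
   Formalization: The formal theorem adds the hypothesis β ≥ 1: with β = 0 condition (1) can still hold for large α (e.g. Δ=2, q=3, ℓ=2) while the stated bound would force all variances to vanish; for β < 1 one gets the bound with β replaced by 1. *)

theory Defs
  imports "HOL-Probability.Probability"
begin

text \<open>A graph is given by its set of edges, an edge being the set of its two end points.\<close>

definition adjacent :: "'v set \<Rightarrow> 'v set \<Rightarrow> bool" where
  "adjacent e e' \<longleftrightarrow> e \<noteq> e' \<and> e \<inter> e' \<noteq> {}"

definition line_graph :: "'v set set \<Rightarrow> ('v set \<times> 'v set) set" where
  "line_graph E = {(e, e'). e \<in> E \<and> e' \<in> E \<and> adjacent e e'}"

definition at_line_distance :: "'v set set \<Rightarrow> 'v set set \<Rightarrow> nat \<Rightarrow> 'v set \<Rightarrow> bool" where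
  "at_line_distance E S n e \<longleftrightarrow>
     (\<exists>s\<in>S. (s, e) \<in> line_graph E ^^ n) \<and> (\<forall>m<n. \<forall>s\<in>S. (s, e) \<notin> line_graph E ^^ m)"

definition edge_blocks :: "'v set set \<Rightarrow> 'v set set set" where
  "edge_blocks E = {{e} |e. e \<in> E} \<union> {{e, e'} |e e'. e \<in> E \<and> e' \<in> E \<and> adjacent e e'}"

text \<open>A vertex of a rooted tree is the list of child indices on the path from the root \<open>[]\<close> to
  it; the root has \<open>a\<close> children and every other non-leaf vertex has \<open>b\<close> children.\<close>

definition rooted_vertices :: "nat \<Rightarrow> nat \<Rightarrow> nat \<Rightarrow> nat list set" where
  "rooted_vertices a b k =
     {x. length x \<le> k \<and> (\<forall>i<length x. x ! i < (if i = 0 then a else b))}"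

definition rooted_edges :: "nat \<Rightarrow> nat \<Rightarrow> nat \<Rightarrow> nat list set set" where
  "rooted_edges a b k = {{x, x @ [c]} |x c. x @ [c] \<in> rooted_vertices a b k}"

definition reg_tree :: "nat \<Rightarrow> nat \<Rightarrow> nat list set set" where
  "reg_tree \<Delta> k = rooted_edges \<Delta> (\<Delta> - 1) k"

text \<open>In the tree with a hanging root edge, \<open>None\<close> is the extra leaf \<open>v\<close> and \<open>Some []\<close> is
  the root \<open>u\<close>.\<close>

definition root_edge :: "nat list option set" where
  "root_edge = {Some [], None}"

definition star_tree :: "nat \<Rightarrow> nat \<Rightarrow> nat list option set set" where
  "star_tree d k = insert root_edge ((`) Some ` rooted_edges d d k)"

definition star_level1 :: "nat \<Rightarrow> nat \<Rightarrow> nat list option set set" where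
  "star_level1 d k = {e \<in> star_tree d k - {root_edge}. Some [] \<in> e}"

text \<open>The root edge is itself at line-graph distance 1 from level 1; it forms level 0 and is
  therefore excluded from level 2.\<close>

definition star_level :: "nat \<Rightarrow> nat \<Rightarrow> nat \<Rightarrow> nat list option set set" where
  "star_level d k i =
     (if i = 0 then {root_edge}
      else {e \<in> star_tree d k - {root_edge}.
              at_line_distance (star_tree d k) (star_level1 d k) (i - 1) e})"

definition list_edge_colorings :: "'v set set \<Rightarrow> ('v set \<Rightarrow> nat set) \<Rightarrow> ('v set \<Rightarrow> nat) set" where
  "list_edge_colorings E L =
     {\<sigma> \<in> PiE E L. \<forall>e\<in>E. \<forall>e'\<in>E. adjacent e e' \<longrightarrow> \<sigma> e \<noteq> \<sigma> e'}"

definition mu :: "nat \<Rightarrow> nat \<Rightarrow> nat \<Rightarrow> (nat list set \<Rightarrow> nat) pmf" where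
  "mu \<Delta> q k = pmf_of_set (list_edge_colorings (reg_tree \<Delta> k) (\<lambda>_. {1..q}))"

definition mu_star :: "nat \<Rightarrow> nat \<Rightarrow> nat \<Rightarrow> (nat list option set \<Rightarrow> nat) pmf" where
  "mu_star d q k = pmf_of_set (list_edge_colorings (star_tree d k)
     (\<lambda>e. if e = root_edge then {1..q - d} else {1..q}))"

definition mu_star1 :: "nat \<Rightarrow> nat \<Rightarrow> nat \<Rightarrow> (nat list option set \<Rightarrow> nat) pmf" where
  "mu_star1 d q k = pmf_of_set (list_edge_colorings (star_tree d k)
     (\<lambda>e. if e = root_edge then {1} else {1..q}))"

text \<open>Below, \<open>\<mu>\<close> is a distribution on configurations indexed by \<open>E\<close>, and its state space
  \<open>\<Omega>\<close> is \<open>set_pmf \<mu>\<close>.\<close>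

definition cond_outside ::
  "'e set \<Rightarrow> ('e \<Rightarrow> nat) pmf \<Rightarrow> 'e set \<Rightarrow> ('e \<Rightarrow> nat) \<Rightarrow> ('e \<Rightarrow> nat) pmf" where
  "cond_outside E \<mu> S \<sigma> = cond_pmf \<mu> {\<tau>. \<forall>e\<in>E - S. \<tau> e = \<sigma> e}"

definition block_exp ::
  "'e set \<Rightarrow> ('e \<Rightarrow> nat) pmf \<Rightarrow> 'e set \<Rightarrow> (('e \<Rightarrow> nat) \<Rightarrow> real) \<Rightarrow> ('e \<Rightarrow> nat) \<Rightarrow> real" where
  "block_exp E \<mu> S f \<sigma> = measure_pmf.expectation (cond_outside E \<mu> S \<sigma>) f"

definition block_var ::
  "'e set \<Rightarrow> ('e \<Rightarrow> nat) pmf \<Rightarrow> 'e set \<Rightarrow> (('e \<Rightarrow> nat) \<Rightarrow> real) \<Rightarrow> ('e \<Rightarrow> nat) \<Rightarrow> real" where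
  "block_var E \<mu> S f \<sigma> = measure_pmf.variance (cond_outside E \<mu> S \<sigma>) f"

definition approx_tensorization :: "'e set \<Rightarrow> ('e \<Rightarrow> nat) pmf \<Rightarrow> real \<Rightarrow> bool" where
  "approx_tensorization E \<mu> \<gamma> \<longleftrightarrow>
     (\<forall>f. (\<forall>\<sigma>\<in>set_pmf \<mu>. 0 \<le> f \<sigma>) \<longrightarrow>
        measure_pmf.variance \<mu> f
          \<le> \<gamma> * (\<Sum>e\<in>E. measure_pmf.expectation \<mu> (block_var E \<mu> {e} f)))"

definition block_factorization :: "'e set \<Rightarrow> ('e \<Rightarrow> nat) pmf \<Rightarrow> ('e set \<Rightarrow> real) \<Rightarrow> bool" where
  "block_factorization E \<mu> C \<longleftrightarrow>
     (\<forall>f. (\<forall>\<sigma>\<in>set_pmf \<mu>. 0 \<le> f \<sigma>) \<longrightarrow>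
        measure_pmf.variance \<mu> f
          \<le> (\<Sum>B\<in>Pow E. C B * measure_pmf.expectation \<mu> (block_var E \<mu> B f)))"

end

theory Submission
  imports Defs "HOL-Combinatorics.Transposition"
begin

text \<open>For a uniform distribution the conditional expectations on blocks are orthogonal
  projections, and they multiply like their blocks when no edge of one block is adjacent to an edge
  of the other. Split a tree of depth \<open>k + l\<close> into its upper \<open>k\<close> levels and the trees hanging below.
  The variance is then the expected variance of the lower part, which tensorizes tree by tree with
  constant \<open>\<gamma>\<close> because conditionally on the upper part each tree is a recoloured \<open>mu_star1\<close>, plus
  the variance of the projection of \<open>f\<close> to the upper part. By induction the latter is bounded by its
  local variances. Averaging over the lower part commutes with resampling an edge strictly above
  level \<open>k\<close>, so nothing is lost there; at an edge of level \<open>k\<close> the tree below it, together with the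
  edge itself, is a recoloured \<open>mu_star\<close>, and the root variance inequality applies. The weight \<open>b\<close>
  of the leaf edges thus evolves as \<open>b \<mapsto> 1 + \<alpha> l * b\<close>, which produces the geometric sum. The
  hypotheses force \<open>\<gamma> \<ge> 0\<close> and \<open>\<alpha> l \<ge> 0\<close>.\<close>

subsection \<open>Conditional averages and block variances\<close>

text \<open>Edges strictly above the leaf level keep the coefficient they have, because averaging
  over further levels commutes with resampling them; only the leaf edges are charged again. These
  sit at level \<open>l\<close> of the trees hung on the previous leaves, so their weight is
  multiplied by \<open>\<alpha> l\<close> itself and not by the maximum \<open>A\<close> of all
  \<open>\<alpha> i\<close>. The maximum enters only in the interior coefficient
  \<open>1 + A * b\<close>: \<open>1\<close> from tensorizing the lower part, \<open>A * b\<close>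
  from the root variance inequality. A pair formed by a leaf edge and an edge just below it receives
  \<open>\<beta> * b\<close>. Since \<open>b \<le> A * b + 1\<close> and
  \<open>\<beta> \<ge> 1\<close>, everything fits under \<open>\<beta> * (A * b + 1)\<close>. The
  factor \<gamma> is paid only once: tensorization handles the new lower part, the induction
  hypothesis already carries \<gamma>, and the root variance inequality does not involve it. Two
  counts make the induction close. Every colouring of the upper levels has the same number of
  extensions, so its law is again uniform. A leaf edge has \<open>d\<close> neighbours outside the
  tree below it, all at one vertex and so of distinct colours, which leaves exactly the
  \<open>q - d\<close> colours of \<open>mu_star\<close>.\<close>

definition cexp :: "'a set \<Rightarrow> ('a \<Rightarrow> 'b) \<Rightarrow> ('a \<Rightarrow> real) \<Rightarrow> 'a \<Rightarrow> real" where
  "cexp \<Omega> \<kappa> f x = (\<Sum>y | y \<in> \<Omega> \<and> \<kappa> y = \<kappa> x. f y) / real (card {y \<in> \<Omega>. \<kappa> y = \<kappa> x})"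

lemma cexp_eq_if_key_eq: "\<kappa> x = \<kappa> y \<Longrightarrow> cexp \<Omega> \<kappa> f x = cexp \<Omega> \<kappa> f y"
  by (simp add: cexp_def)

lemma cexp_diff: "cexp \<Omega> \<kappa> (\<lambda>x. f x - g x) x = cexp \<Omega> \<kappa> f x - cexp \<Omega> \<kappa> g x"
  by (simp add: cexp_def sum_subtractf diff_divide_distrib)

text \<open>After exchanging the two sums, each \<open>y\<close> collects one term
  \<open>f y * g y / card\<close> per member of its class, which adds up to
  \<open>f y * g y\<close>. This is the defining property of a conditional expectation.\<close>

lemma sum_cexp_mult:
  assumes fin: "finite \<Omega>"
    and meas: "\<And>x y. x \<in> \<Omega> \<Longrightarrow> y \<in> \<Omega> \<Longrightarrow> \<kappa> x = \<kappa> y \<Longrightarrow> g x = g y"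
  shows "(\<Sum>x\<in>\<Omega>. cexp \<Omega> \<kappa> f x * g x) = (\<Sum>x\<in>\<Omega>. f x * g x)"
proof -
  let ?C = "\<lambda>x. {y \<in> \<Omega>. \<kappa> y = \<kappa> x}"
  have "(\<Sum>x\<in>\<Omega>. cexp \<Omega> \<kappa> f x * g x)
      = (\<Sum>x\<in>\<Omega>. \<Sum>y\<in>\<Omega>. if \<kappa> y = \<kappa> x then f y * g x / card (?C x) else 0)"
    by (simp add: cexp_def sum.If_cases[OF fin] sum_distrib_right sum_divide_distrib Int_def
        conj_commute cong: conj_cong)
  also have "\<dots> = (\<Sum>y\<in>\<Omega>. \<Sum>x\<in>\<Omega>. if \<kappa> y = \<kappa> x then f y * g x / card (?C x) else 0)"
    by (rule sum.swap)
  also have "\<dots> = (\<Sum>y\<in>\<Omega>. f y * g y)"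
  proof (rule sum.cong[OF refl])
    fix y assume y: "y \<in> \<Omega>"
    have "(\<Sum>x\<in>\<Omega>. if \<kappa> y = \<kappa> x then f y * g x / card (?C x) else 0)
        = (\<Sum>x\<in>?C y. f y * g x / card (?C x))"
      by (rule sum.mono_neutral_cong_right) (use fin in auto)
    also have "\<dots> = (\<Sum>x\<in>?C y. f y * g y / card (?C y))"
    proof (rule sum.cong[OF refl])
      fix x assume x: "x \<in> ?C y"
      then have "g x = g y" using y by (intro meas) auto
      then show "f y * g x / card (?C x) = f y * g y / card (?C y)" using x by simp
    qed
    also have "\<dots> = f y * g y"
      using fin y by auto
    finally show "(\<Sum>x\<in>\<Omega>. if \<kappa> y = \<kappa> x then f y * g x / card (?C x) else 0) = f y * g y" .
  qed
  finally show ?thesis .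
qed

lemma sum_cexp: "finite \<Omega> \<Longrightarrow> (\<Sum>x\<in>\<Omega>. cexp \<Omega> \<kappa> f x) = (\<Sum>x\<in>\<Omega>. f x)"
  using sum_cexp_mult[of \<Omega> \<kappa> "\<lambda>_. 1" f] by simp

text \<open>The residual of \<open>f\<close> is orthogonal to every function of the key, in
  particular to the difference of the projection and \<open>h\<close>; the cross term therefore
  vanishes.\<close>

lemma cexp_pythagoras:
  assumes fin: "finite \<Omega>"
    and meas: "\<And>x y. x \<in> \<Omega> \<Longrightarrow> y \<in> \<Omega> \<Longrightarrow> \<kappa> x = \<kappa> y \<Longrightarrow> h x = h y"
  shows "(\<Sum>x\<in>\<Omega>. (f x - h x)\<^sup>2)
    = (\<Sum>x\<in>\<Omega>. (f x - cexp \<Omega> \<kappa> f x)\<^sup>2) + (\<Sum>x\<in>\<Omega>. (cexp \<Omega> \<kappa> f x - h x)\<^sup>2)"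
proof -
  let ?p = "cexp \<Omega> \<kappa> f"
  have "(\<Sum>x\<in>\<Omega>. ?p x * (?p x - h x)) = (\<Sum>x\<in>\<Omega>. f x * (?p x - h x))"
    using meas by (intro sum_cexp_mult[OF fin]) (metis cexp_eq_if_key_eq)
  then have cross: "(\<Sum>x\<in>\<Omega>. 2 * (f x * (?p x - h x) - ?p x * (?p x - h x))) = 0"
    by (simp add: sum_subtractf flip: sum_distrib_left)
  have "(\<Sum>x\<in>\<Omega>. (f x - h x)\<^sup>2) = (\<Sum>x\<in>\<Omega>. (f x - ?p x)\<^sup>2 + (?p x - h x)\<^sup>2
      + 2 * (f x * (?p x - h x) - ?p x * (?p x - h x)))"
    by (intro sum.cong refl) (simp add: power2_eq_square algebra_simps)
  also have "\<dots> = (\<Sum>x\<in>\<Omega>. (f x - ?p x)\<^sup>2) + (\<Sum>x\<in>\<Omega>. (?p x - h x)\<^sup>2)"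
    unfolding sum.distrib cross by simp
  finally show ?thesis .
qed

lemma cexp_contraction:
  assumes "finite \<Omega>"
  shows "(\<Sum>x\<in>\<Omega>. (cexp \<Omega> \<kappa> f x)\<^sup>2) \<le> (\<Sum>x\<in>\<Omega>. (f x)\<^sup>2)"
  using cexp_pythagoras[OF assms, of \<kappa> "\<lambda>_. 0" f] by (simp add: sum_nonneg)

text \<open>Averaging over classes preserves the total sum. It allows an inequality known for
  conditional distributions to be applied class by class and then summed up.\<close>

lemma sum_mono_classes:
  fixes G H :: "'a \<Rightarrow> real"
  assumes fin: "finite \<Omega>"
    and le: "\<And>x. x \<in> \<Omega> \<Longrightarrow> (\<Sum>y | y \<in> \<Omega> \<and> \<kappa> y = \<kappa> x. G y) \<le> (\<Sum>y | y \<in> \<Omega> \<and> \<kappa> y = \<kappa> x. H y)"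
  shows "(\<Sum>x\<in>\<Omega>. G x) \<le> (\<Sum>x\<in>\<Omega>. H x)"
proof -
  have "(\<Sum>x\<in>\<Omega>. cexp \<Omega> \<kappa> G x) \<le> (\<Sum>x\<in>\<Omega>. cexp \<Omega> \<kappa> H x)"
    by (rule sum_mono) (simp add: cexp_def le divide_right_mono)
  then show ?thesis by (simp add: sum_cexp[OF fin])
qed

text \<open>A conditional average depends on one class only, so it suffices that \<phi> carries the
  class of \<open>x\<close> onto the class of \<open>\<phi> x\<close>. \<open>K\<close> may be much
  smaller than \<Omega>.\<close>

lemma cexp_transfer:
  assumes bij: "bij_betw \<phi> K \<Omega>'" and K: "K \<subseteq> \<Omega>" and x: "x \<in> K"
    and closed: "\<And>y. y \<in> \<Omega> \<Longrightarrow> \<kappa> y = \<kappa> x \<Longrightarrow> y \<in> K"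
    and keys: "\<And>y. y \<in> K \<Longrightarrow> \<kappa> y = \<kappa> x \<longleftrightarrow> \<kappa>' (\<phi> y) = \<kappa>' (\<phi> x)"
    and g: "\<And>y. y \<in> K \<Longrightarrow> g (\<phi> y) = f y"
  shows "cexp \<Omega>' \<kappa>' g (\<phi> x) = cexp \<Omega> \<kappa> f x"
proof -
  let ?C = "{y \<in> \<Omega>. \<kappa> y = \<kappa> x}" and ?C' = "{y \<in> \<Omega>'. \<kappa>' y = \<kappa>' (\<phi> x)}"
  have inj: "inj_on \<phi> ?C"
    using bij closed unfolding bij_betw_def inj_on_def by auto
  have img: "\<phi> ` ?C = ?C'"
  proof
    show "\<phi> ` ?C \<subseteq> ?C'"
      using bij closed keys unfolding bij_betw_def by auto
    show "?C' \<subseteq> \<phi> ` ?C"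
      using bij keys K unfolding bij_betw_def by auto
  qed
  have "sum g ?C' = sum (g \<circ> \<phi>) ?C"
    unfolding img[symmetric] by (rule sum.reindex[OF inj])
  also have "\<dots> = sum f ?C"
    using closed g by (intro sum.cong) auto
  finally have "sum g ?C' = sum f ?C" .
  moreover have "card ?C' = card ?C"
    unfolding img[symmetric] by (rule card_image[OF inj])
  ultimately show ?thesis by (simp add: cexp_def)
qed

text \<open>Agreement outside \<open>S\<close> is encoded as equality of a single key, which brings
  the block averages under the general facts on \<open>cexp\<close>.\<close>

definition bexp ::
  "'e set \<Rightarrow> ('e \<Rightarrow> nat) set \<Rightarrow> 'e set \<Rightarrow> (('e \<Rightarrow> nat) \<Rightarrow> real) \<Rightarrow> ('e \<Rightarrow> nat) \<Rightarrow> real" where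
  "bexp E \<Omega> S f = cexp \<Omega> (\<lambda>\<sigma>. restrict \<sigma> (E - S)) f"

text \<open>\<open>bvar\<close> is not normalised: it is \<open>card \<Omega>\<close> times the expected block variance.\<close>

definition bvar :: "'e set \<Rightarrow> ('e \<Rightarrow> nat) set \<Rightarrow> 'e set \<Rightarrow> (('e \<Rightarrow> nat) \<Rightarrow> real) \<Rightarrow> real" where
  "bvar E \<Omega> S f = (\<Sum>\<sigma>\<in>\<Omega>. (f \<sigma> - bexp E \<Omega> S f \<sigma>)\<^sup>2)"

lemma restrict_eq_iff: "restrict \<tau> A = restrict \<sigma> A \<longleftrightarrow> (\<forall>e\<in>A. \<tau> e = \<sigma> e)"
  by (auto simp: restrict_def fun_eq_iff)

lemma bvar_nonneg: "0 \<le> bvar E \<Omega> S f"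
  by (simp add: bvar_def sum_nonneg)

lemma bexp_eq_if_agree: "(\<And>e. e \<in> E - S \<Longrightarrow> \<tau> e = \<sigma> e) \<Longrightarrow> bexp E \<Omega> S f \<tau> = bexp E \<Omega> S f \<sigma>"
  unfolding bexp_def by (rule cexp_eq_if_key_eq) (simp only: restrict_eq_iff, blast)

text \<open>Configurations that agree outside \<open>S\<close> also agree outside the larger
  \<open>T\<close>, so the average over \<open>T\<close> is a function of the key of
  \<open>S\<close> and can play the role of \<open>h\<close>.\<close>

lemma bexp_pythagoras:
  assumes "finite \<Omega>" and "S \<subseteq> T"
  shows "bvar E \<Omega> T f = bvar E \<Omega> S f + (\<Sum>\<sigma>\<in>\<Omega>. (bexp E \<Omega> S f \<sigma> - bexp E \<Omega> T f \<sigma>)\<^sup>2)"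
  unfolding bvar_def bexp_def
  by (rule cexp_pythagoras[OF assms(1)], rule cexp_eq_if_key_eq)
    (use assms(2) in \<open>auto simp only: restrict_eq_iff\<close>)

lemma bexp_contraction:
  assumes "finite \<Omega>"
  shows "(\<Sum>\<sigma>\<in>\<Omega>. (bexp E \<Omega> S f \<sigma> - bexp E \<Omega> S g \<sigma>)\<^sup>2) \<le> (\<Sum>\<sigma>\<in>\<Omega>. (f \<sigma> - g \<sigma>)\<^sup>2)"
  unfolding bexp_def cexp_diff[symmetric] by (rule cexp_contraction[OF assms])

section \<open>Uniform distributions: probabilistic statements as finite sums\<close>

context
  fixes E :: "'e set" and \<Omega> :: "('e \<Rightarrow> nat) set"
  assumes fin: "finite \<Omega>" and ne: "\<Omega> \<noteq> {}"
begin

lemma expectation_uniform: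
  "measure_pmf.expectation (pmf_of_set \<Omega>) (g :: _ \<Rightarrow> real) = (\<Sum>\<sigma>\<in>\<Omega>. g \<sigma>) / card \<Omega>"
  by (rule integral_pmf_of_set[OF ne fin])

lemma cond_outside_uniform:
  assumes "\<sigma> \<in> \<Omega>"
  shows "cond_outside E (pmf_of_set \<Omega>) S \<sigma>
    = pmf_of_set {\<tau> \<in> \<Omega>. restrict \<tau> (E - S) = restrict \<sigma> (E - S)}"
proof -
  have "\<Omega> \<inter> {\<tau>. \<forall>e\<in>E - S. \<tau> e = \<sigma> e} \<noteq> {}"
    using assms by auto
  then have "cond_pmf (pmf_of_set \<Omega>) {\<tau>. \<forall>e\<in>E - S. \<tau> e = \<sigma> e}
      = pmf_of_set (\<Omega> \<inter> {\<tau>. \<forall>e\<in>E - S. \<tau> e = \<sigma> e})"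
    using fin ne assms
    by (intro pmf_eqI, subst pmf_cond) (auto simp: measure_pmf_of_set indicator_def)
  then show ?thesis
    by (simp add: cond_outside_def Int_def restrict_eq_iff)
qed

lemma block_exp_uniform:
  assumes "\<sigma> \<in> \<Omega>"
  shows "block_exp E (pmf_of_set \<Omega>) S f \<sigma> = bexp E \<Omega> S f \<sigma>"
  unfolding block_exp_def cond_outside_uniform[OF assms] bexp_def cexp_def
  using fin assms by (subst integral_pmf_of_set) auto

text \<open>The block variance is itself a conditional average, that of the squared residual, and
  averaging a conditional average gives the plain average.\<close>

lemma expectation_block_var_uniform:
  "measure_pmf.expectation (pmf_of_set \<Omega>) (block_var E (pmf_of_set \<Omega>) S f)
    = bvar E \<Omega> S f / card \<Omega>"
proof -
  let ?k = "\<lambda>\<sigma>. restrict \<sigma> (E - S)"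
  have "block_var E (pmf_of_set \<Omega>) S f \<sigma>
      = cexp \<Omega> ?k (\<lambda>\<tau>. (f \<tau> - bexp E \<Omega> S f \<tau>)\<^sup>2) \<sigma>" if \<sigma>: "\<sigma> \<in> \<Omega>" for \<sigma>
  proof -
    let ?C = "{\<tau> \<in> \<Omega>. ?k \<tau> = ?k \<sigma>}"
    have C: "finite ?C" "?C \<noteq> {}" using fin \<sigma> by auto
    have e: "measure_pmf.expectation (pmf_of_set ?C) f = bexp E \<Omega> S f \<sigma>"
      using block_exp_uniform[OF \<sigma>, of S f] by (simp add: block_exp_def cond_outside_uniform[OF \<sigma>])
    have "block_var E (pmf_of_set \<Omega>) S f \<sigma> = (\<Sum>\<tau>\<in>?C. (f \<tau> - bexp E \<Omega> S f \<sigma>)\<^sup>2) / card ?C"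
      unfolding block_var_def cond_outside_uniform[OF \<sigma>] e
      by (rule integral_pmf_of_set[OF C(2,1)])
    also have "(\<Sum>\<tau>\<in>?C. (f \<tau> - bexp E \<Omega> S f \<sigma>)\<^sup>2) = (\<Sum>\<tau>\<in>?C. (f \<tau> - bexp E \<Omega> S f \<tau>)\<^sup>2)"
      unfolding bexp_def by (intro sum.cong refl) (simp add: cexp_def)
    finally show ?thesis unfolding cexp_def .
  qed
  then show ?thesis
    by (simp add: expectation_uniform sum_cexp[OF fin] bvar_def)
qed

lemma bexp_all: "bexp E \<Omega> E f \<sigma> = (\<Sum>\<sigma>\<in>\<Omega>. f \<sigma>) / card \<Omega>"
  by (simp add: bexp_def cexp_def restrict_def)

lemma variance_uniform:
  "measure_pmf.variance (pmf_of_set \<Omega>) f = bvar E \<Omega> E f / card \<Omega>"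
  by (simp add: expectation_uniform bvar_def bexp_all)

lemma variance_block_exp_uniform:
  "measure_pmf.variance (pmf_of_set \<Omega>) (block_exp E (pmf_of_set \<Omega>) S f)
    = (\<Sum>\<sigma>\<in>\<Omega>. (bexp E \<Omega> S f \<sigma> - bexp E \<Omega> E f \<sigma>)\<^sup>2) / card \<Omega>"
proof -
  have "(\<Sum>\<sigma>\<in>\<Omega>. bexp E \<Omega> S f \<sigma>) = (\<Sum>\<sigma>\<in>\<Omega>. f \<sigma>)"
    unfolding bexp_def by (rule sum_cexp[OF fin])
  then show ?thesis
    by (simp add: expectation_uniform bexp_all block_exp_uniform)
qed

lemma approx_tensorization_uniform:
  "approx_tensorization E (pmf_of_set \<Omega>) \<gamma> \<longleftrightarrow>
    (\<forall>f. (\<forall>\<sigma>\<in>\<Omega>. 0 \<le> f \<sigma>) \<longrightarrow> bvar E \<Omega> E f \<le> \<gamma> * (\<Sum>e\<in>E. bvar E \<Omega> {e} f))"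
proof -
  have "0 < real (card \<Omega>)" using fin ne by (simp add: card_gt_0_iff)
  then show ?thesis
    unfolding approx_tensorization_def variance_uniform expectation_block_var_uniform
      sum_divide_distrib[symmetric] times_divide_eq_right set_pmf_of_set[OF ne fin]
    by (simp add: divide_le_cancel)
qed

lemma block_factorization_uniform:
  "block_factorization E (pmf_of_set \<Omega>) C \<longleftrightarrow>
    (\<forall>f. (\<forall>\<sigma>\<in>\<Omega>. 0 \<le> f \<sigma>) \<longrightarrow> bvar E \<Omega> E f \<le> (\<Sum>B\<in>Pow E. C B * bvar E \<Omega> B f))"
proof -
  have "0 < real (card \<Omega>)" using fin ne by (simp add: card_gt_0_iff)
  then show ?thesis
    unfolding block_factorization_def variance_uniform expectation_block_var_uniform
      times_divide_eq_right sum_divide_distrib[symmetric] set_pmf_of_set[OF ne fin]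
    by (simp add: divide_le_cancel)
qed

end

subsection \<open>List edge colourings\<close>

lemma finite_list_edge_colorings:
  "finite E \<Longrightarrow> (\<And>e. e \<in> E \<Longrightarrow> finite (L e)) \<Longrightarrow> finite (list_edge_colorings E L)"
  by (rule finite_subset[OF _ finite_PiE[of E L]]) (auto simp: list_edge_colorings_def)

lemma adjacent_commute: "adjacent e e' \<longleftrightarrow> adjacent e' e"
  by (auto simp: adjacent_def)

text \<open>Only two adjacent edges on different sides of \<open>T\<close> could conflict. Outside
  \<open>T\<close> the colour of such an edge is the same in both colourings, so properness of
  \<beta> settles it.\<close>

lemma list_edge_colorings_merge:
  assumes \<alpha>: "\<alpha> \<in> list_edge_colorings E L" and \<beta>: "\<beta> \<in> list_edge_colorings E L"
    and agree: "\<And>e e'. e \<in> E \<Longrightarrow> e \<in> T \<Longrightarrow> e' \<in> E \<Longrightarrow> e' \<notin> T \<Longrightarrow> adjacent e e' \<Longrightarrow> \<alpha> e' = \<beta> e'"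
  shows "(\<lambda>e. if e \<in> T then \<beta> e else \<alpha> e) \<in> list_edge_colorings E L"
proof -
  have "(\<lambda>e. if e \<in> T then \<beta> e else \<alpha> e) \<in> PiE E L"
    using \<alpha> \<beta> unfolding list_edge_colorings_def PiE_def extensional_def by auto
  moreover have "(if e \<in> T then \<beta> e else \<alpha> e) \<noteq> (if e' \<in> T then \<beta> e' else \<alpha> e')"
    if e: "e \<in> E" "e' \<in> E" "adjacent e e'" for e e'
  proof -
    have prp: "\<alpha> e \<noteq> \<alpha> e'" "\<beta> e \<noteq> \<beta> e'"
      using \<alpha> \<beta> e unfolding list_edge_colorings_def by auto
    show ?thesis
    proof (cases "e \<in> T"; cases "e' \<in> T")
      assume t: "e \<in> T" "e' \<notin> T"
      show ?thesis using agree[OF e(1) t(1) e(2) t(2) e(3)] prp t by simp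
    next
      assume t: "e \<notin> T" "e' \<in> T"
      have "adjacent e' e" using e(3) by (simp add: adjacent_commute)
      from agree[OF e(2) t(2) e(1) t(1) this] show ?thesis using prp t by simp
    qed (use prp in auto)
  qed
  ultimately show ?thesis by (auto simp: list_edge_colorings_def)
qed

text \<open>Without adjacency between \<open>S\<close> and \<open>T\<close>, their recolourings can
  be chosen independently: the class for the union is the product of the classes for
  \<open>S\<close> and for \<open>T\<close>, and a uniform average over a product is an iterated
  average.\<close>

lemma bexp_Un_nonadjacent:
  assumes \<Omega>: "\<Omega> = list_edge_colorings E L" and disj: "S \<inter> T = {}"
    and nonadj: "\<And>s t. s \<in> S \<Longrightarrow> t \<in> T \<Longrightarrow> \<not> adjacent s t"
    and \<sigma>: "\<sigma> \<in> \<Omega>"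
  shows "bexp E \<Omega> (S \<union> T) f \<sigma> = bexp E \<Omega> S (bexp E \<Omega> T f) \<sigma>"
proof -
  define C where "C U \<tau> = {\<rho> \<in> \<Omega>. restrict \<rho> (E - U) = restrict \<tau> (E - U)}" for U \<tau>
  define m where "m \<tau> \<rho> = (\<lambda>e. if e \<in> T then \<rho> e else \<tau> e)" for \<tau> \<rho> :: "'a set \<Rightarrow> nat"
  have C_iff: "\<rho> \<in> C U \<tau> \<longleftrightarrow> \<rho> \<in> \<Omega> \<and> (\<forall>e\<in>E - U. \<rho> e = \<tau> e)" for \<rho> U \<tau>
    by (simp add: C_def restrict_eq_iff)
  have ext: "\<tau> e = \<rho> e" if "\<tau> \<in> \<Omega>" "\<rho> \<in> \<Omega>" "e \<notin> E" for \<tau> \<rho> e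
    using that unfolding \<Omega> list_edge_colorings_def PiE_def extensional_def by auto
  have merge: "m \<alpha> \<beta> \<in> \<Omega>" if "\<alpha> \<in> \<Omega>" "\<beta> \<in> \<Omega>" "\<And>e. e \<in> E \<Longrightarrow> e \<notin> S \<union> T \<Longrightarrow> \<alpha> e = \<beta> e" for \<alpha> \<beta>
    unfolding m_def \<Omega>
  proof (rule list_edge_colorings_merge)
    fix e e' assume "e \<in> T" "e' \<in> E" "e' \<notin> T" "adjacent e e'"
    then have "e' \<notin> S" using nonadj adjacent_commute by blast
    then show "\<alpha> e' = \<beta> e'" using that(3) \<open>e' \<in> E\<close> \<open>e' \<notin> T\<close> by blast
  qed (use that in \<open>simp_all add: \<Omega>\<close>)
  \<comment> \<open>Recolouring \<open>S\<close> does not affect which recolourings of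
    \<open>T\<close> are possible, so every inner average can be taken over the fixed class of
    \<sigma>.\<close>
  have key: "bij_betw (m \<tau>) (C T \<sigma>) (C T \<tau>)" if \<tau>: "\<tau> \<in> C S \<sigma>" for \<tau>
  proof (rule bij_betw_byWitness[where f' = "m \<sigma>"])
    show "\<forall>\<rho>\<in>C T \<sigma>. m \<sigma> (m \<tau> \<rho>) = \<rho>"
    proof
      fix \<rho> assume \<rho>: "\<rho> \<in> C T \<sigma>"
      have "m \<sigma> (m \<tau> \<rho>) e = \<rho> e" for e
        using ext[of \<rho> \<sigma> e] \<rho> \<sigma> by (cases "e \<in> E") (auto simp: m_def C_iff)
      then show "m \<sigma> (m \<tau> \<rho>) = \<rho>" ..
    qed
    show "\<forall>\<rho>\<in>C T \<tau>. m \<tau> (m \<sigma> \<rho>) = \<rho>"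
    proof
      fix \<rho> assume \<rho>: "\<rho> \<in> C T \<tau>"
      have "m \<tau> (m \<sigma> \<rho>) e = \<rho> e" for e
        using ext[of \<rho> \<tau> e] \<rho> \<tau> by (cases "e \<in> E") (auto simp: m_def C_iff)
      then show "m \<tau> (m \<sigma> \<rho>) = \<rho>" ..
    qed
    have "m \<tau> \<rho> \<in> \<Omega>" if "\<rho> \<in> C T \<sigma>" for \<rho>
      by (rule merge) (use \<tau> that in \<open>auto simp: C_iff\<close>)
    then show "m \<tau> ` C T \<sigma> \<subseteq> C T \<tau>"
      by (auto simp: C_iff m_def)
    have "m \<sigma> \<rho> \<in> \<Omega>" if "\<rho> \<in> C T \<tau>" for \<rho>
      by (rule merge) (use \<tau> that \<sigma> in \<open>auto simp: C_iff\<close>)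
    then show "m \<sigma> ` C T \<tau> \<subseteq> C T \<sigma>"
      by (auto simp: C_iff m_def)
  qed
  \<comment> \<open>The inverse splits a configuration by resetting either \<open>T\<close> or
    everything but \<open>T\<close> to \<sigma>.\<close>
  have pairs: "bij_betw (\<lambda>(\<tau>, \<rho>). m \<tau> \<rho>) (C S \<sigma> \<times> C T \<sigma>) (C (S \<union> T) \<sigma>)"
  proof (rule bij_betw_byWitness[where f' = "\<lambda>\<omega>. (m \<omega> \<sigma>, m \<sigma> \<omega>)"])
    show "\<forall>x\<in>C S \<sigma> \<times> C T \<sigma>. (\<lambda>\<omega>. (m \<omega> \<sigma>, m \<sigma> \<omega>)) (case x of (\<tau>, \<rho>) \<Rightarrow> m \<tau> \<rho>) = x"
    proof
      fix x assume "x \<in> C S \<sigma> \<times> C T \<sigma>"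
      then obtain \<tau> \<rho> where x: "x = (\<tau>, \<rho>)" and t: "\<tau> \<in> C S \<sigma>" "\<rho> \<in> C T \<sigma>" by blast
      have "m (m \<tau> \<rho>) \<sigma> e = \<tau> e" for e
        using t disj \<sigma> ext[of \<tau> \<sigma> e] by (cases "e \<in> E"; cases "e \<in> S") (auto simp: m_def C_iff)
      moreover have "m \<sigma> (m \<tau> \<rho>) e = \<rho> e" for e
        using t disj \<sigma> ext[of \<rho> \<sigma> e] by (cases "e \<in> E"; cases "e \<in> S") (auto simp: m_def C_iff)
      ultimately show "(\<lambda>\<omega>. (m \<omega> \<sigma>, m \<sigma> \<omega>)) (case x of (\<tau>, \<rho>) \<Rightarrow> m \<tau> \<rho>) = x"
        by (auto simp: x)
    qed
    show "\<forall>\<omega>\<in>C (S \<union> T) \<sigma>. (case (m \<omega> \<sigma>, m \<sigma> \<omega>) of (\<tau>, \<rho>) \<Rightarrow> m \<tau> \<rho>) = \<omega>"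
      by (auto simp: m_def)
    have "m \<tau> \<rho> \<in> \<Omega>" if "\<tau> \<in> C S \<sigma>" "\<rho> \<in> C T \<sigma>" for \<tau> \<rho>
      by (rule merge) (use that in \<open>auto simp: C_iff\<close>)
    then show "(\<lambda>(\<tau>, \<rho>). m \<tau> \<rho>) ` (C S \<sigma> \<times> C T \<sigma>) \<subseteq> C (S \<union> T) \<sigma>"
      by (auto simp: C_iff m_def)
    have "m \<omega> \<sigma> \<in> \<Omega>" "m \<sigma> \<omega> \<in> \<Omega>" if "\<omega> \<in> C (S \<union> T) \<sigma>" for \<omega>
      by (rule merge; use \<sigma> that in \<open>auto simp: C_iff\<close>)+
    then show "(\<lambda>\<omega>. (m \<omega> \<sigma>, m \<sigma> \<omega>)) ` C (S \<union> T) \<sigma> \<subseteq> C S \<sigma> \<times> C T \<sigma>"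
      by (auto simp: C_iff m_def)
  qed
  have "bexp E \<Omega> S (bexp E \<Omega> T f) \<sigma>
      = (\<Sum>\<tau>\<in>C S \<sigma>. (\<Sum>\<rho>\<in>C T \<tau>. f \<rho>) / card (C T \<tau>)) / card (C S \<sigma>)"
    by (simp add: bexp_def cexp_def C_def)
  also have "(\<Sum>\<tau>\<in>C S \<sigma>. (\<Sum>\<rho>\<in>C T \<tau>. f \<rho>) / card (C T \<tau>))
      = (\<Sum>\<tau>\<in>C S \<sigma>. (\<Sum>\<rho>\<in>C T \<sigma>. f (m \<tau> \<rho>)) / card (C T \<sigma>))"
    by (intro sum.cong refl) (simp add: sum.reindex_bij_betw[OF key] bij_betw_same_card[OF key])
  also have "\<dots> = (\<Sum>(\<tau>, \<rho>)\<in>C S \<sigma> \<times> C T \<sigma>. f (m \<tau> \<rho>)) / card (C T \<sigma>)"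
    by (simp add: sum.cartesian_product flip: sum_divide_distrib)
  also have "(\<Sum>(\<tau>, \<rho>)\<in>C S \<sigma> \<times> C T \<sigma>. f (m \<tau> \<rho>)) = (\<Sum>\<omega>\<in>C (S \<union> T) \<sigma>. f \<omega>)"
    unfolding sum.reindex_bij_betw[OF pairs, symmetric] by (simp add: case_prod_unfold)
  finally have "bexp E \<Omega> S (bexp E \<Omega> T f) \<sigma>
      = (\<Sum>\<omega>\<in>C (S \<union> T) \<sigma>. f \<omega>) / (card (C S \<sigma>) * card (C T \<sigma>))"
    by (simp add: mult.commute)
  also have "card (C S \<sigma>) * card (C T \<sigma>) = card (C (S \<union> T) \<sigma>)"
    using bij_betw_same_card[OF pairs] by (simp add: card_cartesian_product)
  finally show ?thesis by (simp add: bexp_def cexp_def C_def)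
qed

text \<open>The left side is the squared norm of the \<open>S\<close>-average of the
  \<open>T\<close>-residual of \<open>f\<close>, and averaging contracts.\<close>

lemma bexp_Un_diff_le_bvar:
  assumes \<Omega>: "\<Omega> = list_edge_colorings E L" and fin: "finite \<Omega>" and disj: "S \<inter> T = {}"
    and nonadj: "\<And>s t. s \<in> S \<Longrightarrow> t \<in> T \<Longrightarrow> \<not> adjacent s t"
  shows "(\<Sum>\<sigma>\<in>\<Omega>. (bexp E \<Omega> S f \<sigma> - bexp E \<Omega> (S \<union> T) f \<sigma>)\<^sup>2) \<le> bvar E \<Omega> T f"
proof -
  have "(\<Sum>\<sigma>\<in>\<Omega>. (bexp E \<Omega> S f \<sigma> - bexp E \<Omega> (S \<union> T) f \<sigma>)\<^sup>2)
      = (\<Sum>\<sigma>\<in>\<Omega>. (bexp E \<Omega> S f \<sigma> - bexp E \<Omega> S (bexp E \<Omega> T f) \<sigma>)\<^sup>2)"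
    using bexp_Un_nonadjacent[OF \<Omega> disj nonadj] by simp
  also have "\<dots> \<le> bvar E \<Omega> T f"
    unfolding bvar_def by (rule bexp_contraction[OF fin])
  finally show ?thesis .
qed

text \<open>Subadditivity of variance over conditionally independent blocks. Splitting off one block
  by Pythagoras leaves a term that the remaining blocks bound, since averaging over the first one
  only contracts it.\<close>

lemma bvar_UN_le:
  assumes \<Omega>: "\<Omega> = list_edge_colorings E L" and fin: "finite \<Omega>" and X: "finite X"
    and disj: "\<And>x y. x \<in> X \<Longrightarrow> y \<in> X \<Longrightarrow> x \<noteq> y \<Longrightarrow> S x \<inter> S y = {}"
    and nonadj: "\<And>x y s t. x \<in> X \<Longrightarrow> y \<in> X \<Longrightarrow> x \<noteq> y \<Longrightarrow> s \<in> S x \<Longrightarrow> t \<in> S y \<Longrightarrow> \<not> adjacent s t"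
  shows "bvar E \<Omega> (\<Union>x\<in>X. S x) f \<le> (\<Sum>x\<in>X. bvar E \<Omega> (S x) f)"
  using X disj nonadj
proof (induction X)
  case empty
  have "bexp E \<Omega> {} f \<sigma> = f \<sigma>" if "\<sigma> \<in> \<Omega>" for \<sigma>
  proof -
    have "\<tau> = \<sigma>" if "\<tau> \<in> \<Omega>" "restrict \<tau> E = restrict \<sigma> E" for \<tau>
      using that \<open>\<sigma> \<in> \<Omega>\<close> unfolding \<Omega> list_edge_colorings_def
      by (auto simp: PiE_def extensional_restrict)
    then have "{\<tau> \<in> \<Omega>. restrict \<tau> E = restrict \<sigma> E} = {\<sigma>}" using \<open>\<sigma> \<in> \<Omega>\<close> by auto
    then show ?thesis by (simp add: bexp_def cexp_def)
  qed
  then show ?case by (simp add: bvar_def)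
next
  case (insert x X)
  have "bvar E \<Omega> (\<Union>y\<in>insert x X. S y) f = bvar E \<Omega> (S x) f
      + (\<Sum>\<sigma>\<in>\<Omega>. (bexp E \<Omega> (S x) f \<sigma> - bexp E \<Omega> (S x \<union> (\<Union>y\<in>X. S y)) f \<sigma>)\<^sup>2)"
    using bexp_pythagoras[OF fin, of "S x" "S x \<union> (\<Union>y\<in>X. S y)" E f] by simp
  also have "\<dots> \<le> bvar E \<Omega> (S x) f + bvar E \<Omega> (\<Union>y\<in>X. S y) f"
  proof (intro add_left_mono bexp_Un_diff_le_bvar[OF \<Omega> fin])
    show "S x \<inter> (\<Union>y\<in>X. S y) = {}" using insert.prems(1) insert.hyps by blast
    show "\<not> adjacent s t" if "s \<in> S x" "t \<in> (\<Union>y\<in>X. S y)" for s t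
      using insert.prems(2) insert.hyps that by blast
  qed
  also have "bvar E \<Omega> (\<Union>y\<in>X. S y) f \<le> (\<Sum>y\<in>X. bvar E \<Omega> (S y) f)"
    by (rule insert.IH) (use insert.prems in blast)+
  finally show ?case using insert.hyps by simp
qed

lemma adjacent_image_iff: "inj h \<Longrightarrow> adjacent (h ` e) (h ` e') \<longleftrightarrow> adjacent e e'"
  unfolding adjacent_def by (simp only: inj_image_eq_iff image_Int[symmetric] image_is_empty)

text \<open>A set of edges \<open>h ` E'\<close> that touches the rest of \<open>E\<close> only through the edge \<open>h ` r\<close> sees
  its surroundings only through the list \<open>A\<close> of colours left for \<open>h ` r\<close>.\<close>

locale coloring_embedding =
  fixes h :: "'w \<Rightarrow> 'v" and E' :: "'w set set" and r :: "'w set" and E :: "'v set set"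
    and q :: nat and \<sigma> :: "'v set \<Rightarrow> nat" and W :: "'v set set" and A :: "nat set"
    and \<pi> :: "nat \<Rightarrow> nat"
  assumes inj_h: "inj h" and r: "r \<in> E'" and sub: "(`) h ` E' \<subseteq> E"
    and \<sigma>: "\<sigma> \<in> list_edge_colorings E (\<lambda>_. {1..q})"
    and W: "W \<subseteq> (`) h ` E'" "(`) h ` E' - W \<subseteq> {h ` r}"
    and \<pi>: "bij_betw \<pi> {1..q} {1..q}" and A: "A \<subseteq> {1..q}"
    and A_root: "\<And>\<tau>. \<tau> \<in> list_edge_colorings E (\<lambda>_. {1..q}) \<Longrightarrow> (\<And>e. e \<in> E - W \<Longrightarrow> \<tau> e = \<sigma> e)
      \<Longrightarrow> \<tau> (h ` r) \<in> A"
    and A_free: "\<And>c e. c \<in> A \<Longrightarrow> e \<in> E - (`) h ` E' \<Longrightarrow> adjacent (h ` r) e \<Longrightarrow> \<sigma> e \<noteq> c"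
    and boundary: "\<And>s e. s \<in> E' \<Longrightarrow> s \<noteq> r \<Longrightarrow> e \<in> E - (`) h ` E' \<Longrightarrow> \<not> adjacent (h ` s) e"
    and pinned: "h ` r \<notin> W \<Longrightarrow> A = {\<sigma> (h ` r)}"
begin

abbreviation "\<Omega> \<equiv> list_edge_colorings E (\<lambda>_. {1..q})"
abbreviation "\<Omega>' \<equiv> list_edge_colorings E' (\<lambda>s. if s = r then \<pi> ` A else {1..q})"
text \<open>The class of \<sigma> for the block \<open>W\<close>. There are two uses:
  \<open>W\<close> is the whole embedded tree with \<open>A\<close> the free colours of its root
  edge, or \<open>W\<close> omits the root edge and \<open>A\<close> contains just its current
  colour.\<close>

definition "K = {\<tau> \<in> \<Omega>. restrict \<tau> (E - W) = restrict \<sigma> (E - W)}"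
text \<open>Reads off the colouring of the embedded tree. The permutation \<pi> of the colours
  serves to turn \<open>A\<close> into a standard list on the root edge.\<close>

definition "\<phi> \<tau> = restrict (\<lambda>s. \<pi> (\<tau> (h ` s))) E'"

lemma K_iff: "\<tau> \<in> K \<longleftrightarrow> \<tau> \<in> \<Omega> \<and> (\<forall>e\<in>E - W. \<tau> e = \<sigma> e)"
  by (simp add: K_def restrict_eq_iff)

lemma image_eq_iff: "h ` s = h ` t \<longleftrightarrow> s = t"
  by (rule inj_image_eq_iff[OF inj_h])

lemma \<pi>_inj: "a \<in> {1..q} \<Longrightarrow> b \<in> {1..q} \<Longrightarrow> \<pi> a = \<pi> b \<Longrightarrow> a = b"
  using \<pi> unfolding bij_betw_def inj_on_def by blast

lemma \<pi>_in: "a \<in> {1..q} \<Longrightarrow> \<pi> a \<in> {1..q}"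
  using \<pi> unfolding bij_betw_def by blast

lemma \<Omega>_range: "\<tau> \<in> \<Omega> \<Longrightarrow> e \<in> E \<Longrightarrow> \<tau> e \<in> {1..q}"
  unfolding list_edge_colorings_def by (simp add: PiE_iff)

lemma \<Omega>_proper: "\<tau> \<in> \<Omega> \<Longrightarrow> e \<in> E \<Longrightarrow> e' \<in> E \<Longrightarrow> adjacent e e' \<Longrightarrow> \<tau> e \<noteq> \<tau> e'"
  unfolding list_edge_colorings_def by simp

lemma h_in: "s \<in> E' \<Longrightarrow> h ` s \<in> E"
  using sub by auto

lemma \<phi>_agree_iff:
  assumes "\<tau> \<in> K" "\<rho> \<in> K" "s \<in> E'"
  shows "\<phi> \<tau> s = \<phi> \<rho> s \<longleftrightarrow> \<tau> (h ` s) = \<rho> (h ` s)"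
proof -
  have "\<tau> (h ` s) \<in> {1..q}" "\<rho> (h ` s) \<in> {1..q}"
    using assms by (auto intro!: \<Omega>_range h_in simp only: K_iff)
  then show ?thesis using \<pi>_inj assms(3) by (auto simp only: \<phi>_def restrict_apply if_True)
qed

text \<open>Within \<open>K\<close> nothing but the colours of the embedded tree can vary, and the
  surroundings restrict them only through the list \<open>A\<close>.\<close>

lemma \<phi>_bij: "bij_betw \<phi> K \<Omega>'"
  unfolding bij_betw_def
proof
  show "inj_on \<phi> K"
  proof (rule inj_onI)
    fix \<tau> \<rho> assume t: "\<tau> \<in> K" "\<rho> \<in> K" and eq: "\<phi> \<tau> = \<phi> \<rho>"
    show "\<tau> = \<rho>"
    proof
      fix e
      consider s where "s \<in> E'" "e = h ` s" | "e \<in> E - W" | "e \<notin> E"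
        using W by blast
      then show "\<tau> e = \<rho> e"
      proof cases
        case 1 then show ?thesis using \<phi>_agree_iff[OF t] eq by simp
      next
        case 2 then show ?thesis using t by (simp add: K_iff)
      next
        case 3 then show ?thesis
          using t by (auto simp: K_iff list_edge_colorings_def PiE_def extensional_def)
      qed
    qed
  qed
  show "\<phi> ` K = \<Omega>'"
  proof
    show "\<phi> ` K \<subseteq> \<Omega>'"
    proof
      fix \<rho> assume "\<rho> \<in> \<phi> ` K"
      then obtain \<tau> where \<tau>: "\<tau> \<in> K" and \<rho>: "\<rho> = \<phi> \<tau>" by auto
      have "\<tau> (h ` r) \<in> A" using \<tau> by (intro A_root) (auto simp: K_iff)
      moreover have "\<pi> (\<tau> (h ` s)) \<in> {1..q}" if "s \<in> E'" for s
        using \<tau> that by (intro \<pi>_in \<Omega>_range h_in) (auto simp: K_iff)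
      ultimately have "\<rho> \<in> PiE E' (\<lambda>s. if s = r then \<pi> ` A else {1..q})"
        unfolding \<rho> \<phi>_def by auto
      moreover have "\<rho> s \<noteq> \<rho> t" if st: "s \<in> E'" "t \<in> E'" "adjacent s t" for s t
      proof -
        have T: "\<tau> \<in> \<Omega>" using \<tau> by (simp add: K_iff)
        have "\<tau> (h ` s) \<noteq> \<tau> (h ` t)"
          using st by (intro \<Omega>_proper[OF T] h_in) (simp_all add: adjacent_image_iff[OF inj_h])
        then show ?thesis
          using \<pi>_inj[OF \<Omega>_range[OF T h_in] \<Omega>_range[OF T h_in]] st by (auto simp: \<rho> \<phi>_def)
      qed
      ultimately show "\<rho> \<in> \<Omega>'" by (simp add: list_edge_colorings_def)
    qed
    show "\<Omega>' \<subseteq> \<phi> ` K"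
    proof
      fix \<rho> assume \<rho>: "\<rho> \<in> \<Omega>'"
      define p where "p = inv_into {1..q} \<pi>"
      have p\<pi>: "p (\<pi> c) = c" if "c \<in> {1..q}" for c
        using \<pi> that unfolding p_def bij_betw_def by (intro inv_into_f_f) auto
      have \<pi>p: "\<pi> (p c) = c" "p c \<in> {1..q}" if "c \<in> {1..q}" for c
        using \<pi> that unfolding p_def bij_betw_def by (metis f_inv_into_f, metis inv_into_into)
      have "\<rho> r \<in> \<pi> ` A" using \<rho> r by (auto simp: list_edge_colorings_def PiE_iff)
      then obtain a where \<rho>_r: "a \<in> A" "\<rho> r = \<pi> a" "a \<in> {1..q}" using A by blast
      have \<rho>_in: "\<rho> s \<in> {1..q}" if "s \<in> E'" for s
      proof (cases "s = r")
        case True then show ?thesis using \<rho>_r(2) \<pi>_in[OF \<rho>_r(3)] by simp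
      next
        case False
        have "\<rho> \<in> PiE E' (\<lambda>s. if s = r then \<pi> ` A else {1..q})"
          using \<rho> by (simp add: list_edge_colorings_def)
        from PiE_mem[OF this that] False show ?thesis by simp
      qed
      have p_r: "p (\<rho> r) \<in> A" using \<rho>_r p\<pi> by simp
      \<comment> \<open>The preimage undoes \<pi> on the embedded tree and follows \<sigma>
        elsewhere. Only the embedded root edge can meet an outside edge, and its colour lies in
        \<open>A\<close>, hence avoids those neighbours.\<close>
      define \<tau> where "\<tau> e = (if e \<in> (`) h ` E' then p (\<rho> (inv_into UNIV ((`) h) e)) else \<sigma> e)" for e
      have inv: "inv_into UNIV ((`) h) (h ` s) = s" for s
        by (rule inv_f_f) (simp add: inj_def image_eq_iff)
      have \<tau>_h: "\<tau> (h ` s) = p (\<rho> s)" if "s \<in> E'" for s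
        using that by (simp add: \<tau>_def inv)
      have \<tau>_out: "\<tau> e = \<sigma> e" if "e \<notin> (`) h ` E'" for e
        using that by (simp add: \<tau>_def)
      have cross: "\<tau> (h ` s) \<noteq> \<tau> e"
        if "s \<in> E'" "e \<in> E - (`) h ` E'" "adjacent (h ` s) e" for s e
      proof -
        have "s = r" using boundary that by blast
        then show ?thesis using A_free[OF p_r that(2)] that by (auto simp: \<tau>_h \<tau>_out)
      qed
      have "\<tau> \<in> PiE E (\<lambda>_. {1..q})"
      proof (rule PiE_I)
        fix e assume e: "e \<in> E"
        show "\<tau> e \<in> {1..q}"
        proof (cases "e \<in> (`) h ` E'")
          case True
          then obtain s where "s \<in> E'" "e = h ` s" by blast
          then show ?thesis using \<pi>p(2)[OF \<rho>_in] by (simp only: \<tau>_h)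
        next
          case False
          then show ?thesis using \<Omega>_range[OF \<sigma> e] \<tau>_out[OF False] by metis
        qed
      next
        fix e assume "e \<notin> E"
        then show "\<tau> e = undefined"
          using \<sigma> sub by (subst \<tau>_out) (blast, simp add: list_edge_colorings_def PiE_def extensional_def)
      qed
      moreover have "\<tau> e \<noteq> \<tau> e'" if e: "e \<in> E" "e' \<in> E" "adjacent e e'" for e e'
      proof (cases "e \<in> (`) h ` E'"; cases "e' \<in> (`) h ` E'")
        assume "e \<in> (`) h ` E'" "e' \<in> (`) h ` E'"
        then obtain s t where st: "s \<in> E'" "t \<in> E'" "e = h ` s" "e' = h ` t" by auto
        then have "adjacent s t" using e adjacent_image_iff[OF inj_h] by blast
        then have "\<rho> s \<noteq> \<rho> t" using \<rho> st by (simp add: list_edge_colorings_def)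
        then show ?thesis
          using \<pi>p(1)[OF \<rho>_in[OF st(1)]] \<pi>p(1)[OF \<rho>_in[OF st(2)]] st by (metis \<tau>_h)
      next
        assume "e \<in> (`) h ` E'" "e' \<notin> (`) h ` E'"
        then show ?thesis using e cross by blast
      next
        assume "e \<notin> (`) h ` E'" "e' \<in> (`) h ` E'"
        moreover have "adjacent e' e" using e(3) by (simp only: adjacent_commute[of e' e])
        ultimately have "\<tau> e' \<noteq> \<tau> e" using e cross by blast
        then show ?thesis by simp
      next
        assume "e \<notin> (`) h ` E'" "e' \<notin> (`) h ` E'"
        then show ?thesis using e \<Omega>_proper[OF \<sigma>] by (simp add: \<tau>_out)
      qed
      ultimately have "\<tau> \<in> \<Omega>" by (simp add: list_edge_colorings_def)
      \<comment> \<open>The only embedded edge that can lie outside \<open>W\<close> is the root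
        edge; in that case \<open>A\<close> contains nothing but its colour under \<sigma>.\<close>
      moreover have "\<tau> e = \<sigma> e" if "e \<in> E - W" for e
      proof (cases "e \<in> (`) h ` E'")
        case True
        with that have "e \<in> (`) h ` E' - W" by simp
        then have "e = h ` r" using W(2) by blast
        with that have "e = h ` r" "h ` r \<notin> W" by simp_all
        then show ?thesis using pinned p_r r by (simp add: \<tau>_h)
      qed (simp add: \<tau>_out)
      ultimately have "\<tau> \<in> K" by (simp add: K_iff)
      moreover have "\<phi> \<tau> = \<rho>"
      proof
        fix s show "\<phi> \<tau> s = \<rho> s"
        proof (cases "s \<in> E'")
          case True then show ?thesis using \<pi>p(1)[OF \<rho>_in] by (simp add: \<phi>_def \<tau>_h)
        next
          case False then show ?thesis
            using \<rho> by (simp add: \<phi>_def list_edge_colorings_def PiE_def extensional_def)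
        qed
      qed
      ultimately show "\<rho> \<in> \<phi> ` K" by blast
    qed
  qed
qed

definition "pull f = f \<circ> inv_into K \<phi>"

lemma pull_\<phi>: "\<tau> \<in> K \<Longrightarrow> pull f (\<phi> \<tau>) = f \<tau>"
  unfolding pull_def comp_apply by (simp only: bij_betw_inv_into_left[OF \<phi>_bij])

lemma pull_nonneg:
  assumes "\<And>\<tau>. \<tau> \<in> \<Omega> \<Longrightarrow> (0 :: real) \<le> f \<tau>" and "\<rho> \<in> \<Omega>'"
  shows "0 \<le> pull f \<rho>"
proof -
  have "inv_into K \<phi> \<rho> \<in> K"
    using bij_betw_apply[OF bij_betw_inv_into[OF \<phi>_bij] assms(2)] .
  then show ?thesis using assms(1) by (simp only: pull_def comp_apply K_iff)
qed

text \<open>A block inside \<open>W\<close> fixes at least everything outside \<open>W\<close>, so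
  its classes stay within \<open>K\<close>, where \<phi> translates agreement edge by edge.\<close>

lemma bexp_pull:
  assumes S: "S \<subseteq> E'" "(`) h ` S \<subseteq> W" and \<tau>: "\<tau> \<in> K"
  shows "bexp E' \<Omega>' S (pull f) (\<phi> \<tau>) = bexp E \<Omega> ((`) h ` S) f \<tau>"
  unfolding bexp_def
proof (rule cexp_transfer[OF \<phi>_bij _ \<tau>])
  show "K \<subseteq> \<Omega>" by (auto simp: K_def)
  show "\<rho> \<in> K" if "\<rho> \<in> \<Omega>" "restrict \<rho> (E - (`) h ` S) = restrict \<tau> (E - (`) h ` S)" for \<rho>
    using that \<tau> S(2) unfolding K_iff restrict_eq_iff by (metis Diff_iff subsetD)
  show "restrict \<rho> (E - (`) h ` S) = restrict \<tau> (E - (`) h ` S)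
      \<longleftrightarrow> restrict (\<phi> \<rho>) (E' - S) = restrict (\<phi> \<tau>) (E' - S)" if \<rho>: "\<rho> \<in> K" for \<rho>
    unfolding restrict_eq_iff
  proof
    assume *: "\<forall>e\<in>E - (`) h ` S. \<rho> e = \<tau> e"
    show "\<forall>s\<in>E' - S. \<phi> \<rho> s = \<phi> \<tau> s"
    proof
      fix s assume s: "s \<in> E' - S"
      then have "h ` s \<in> E - (`) h ` S" using h_in by (auto simp: image_eq_iff)
      then show "\<phi> \<rho> s = \<phi> \<tau> s" using * s \<phi>_agree_iff[OF \<rho> \<tau>] by auto
    qed
  next
    assume *: "\<forall>s\<in>E' - S. \<phi> \<rho> s = \<phi> \<tau> s"
    show "\<forall>e\<in>E - (`) h ` S. \<rho> e = \<tau> e"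
    proof
      fix e assume e: "e \<in> E - (`) h ` S"
      show "\<rho> e = \<tau> e"
      proof (cases "e \<in> W")
        case True
        then obtain s where "s \<in> E'" "e = h ` s" using W by auto
        then show ?thesis using * e \<phi>_agree_iff[OF \<rho> \<tau>] by auto
      qed (use e \<rho> \<tau> in \<open>simp add: K_iff\<close>)
    qed
  qed
qed (rule pull_\<phi>)

lemma sum_pull: "(\<Sum>\<rho>\<in>\<Omega>'. G \<rho>) = (\<Sum>\<tau>\<in>K. G (\<phi> \<tau>))"
  by (rule sum.reindex_bij_betw[OF \<phi>_bij, symmetric])

lemma bvar_pull:
  assumes S: "S \<subseteq> E'" "(`) h ` S \<subseteq> W"
  shows "bvar E' \<Omega>' S (pull f) = (\<Sum>\<tau>\<in>K. (f \<tau> - bexp E \<Omega> ((`) h ` S) f \<tau>)\<^sup>2)"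
  unfolding bvar_def sum_pull by (rule sum.cong[OF refl]) (simp only: bexp_pull[OF S] pull_\<phi>)

end

subsection \<open>Rooted trees and grafted subtrees\<close>

text \<open>An edge is indexed by its lower end point. At the root the formula degenerates to
  \<open>{[]}\<close>, which is why \<open>nodes\<close> omits \<open>[]\<close>.\<close>

definition edge :: "nat list \<Rightarrow> nat list set" where
  "edge y = {butlast y, y}"

definition nodes :: "nat \<Rightarrow> nat \<Rightarrow> nat \<Rightarrow> nat list set" where
  "nodes a b k = rooted_vertices a b k - {[]}"

lemma rooted_edges_eq: "rooted_edges a b k = edge ` nodes a b k"
proof -
  have "edge (x @ [c]) = {x, x @ [c]}" for x c by (simp add: edge_def)
  moreover have "\<exists>x c. y = x @ [c]" if "y \<noteq> []" for y :: "nat list"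
    using that by (metis append_butlast_last_id)
  ultimately show ?thesis
    unfolding rooted_edges_def nodes_def image_def by (auto, metis)
qed

lemma edge_eq_iff:
  assumes "y \<noteq> []" "z \<noteq> []"
  shows "edge y = edge z \<longleftrightarrow> y = z"
proof
  assume eq: "edge y = edge z"
  show "y = z"
  proof (rule ccontr)
    assume "y \<noteq> z"
    then have "y = butlast z" "z = butlast y" using eq unfolding edge_def by (auto simp: doubleton_eq_iff)
    then have "length y = length z - 1" "length z = length y - 1" by (metis length_butlast)+
    then show False using assms by (cases y; cases z; simp)
  qed
qed simp

lemma adjacent_edge_iff:
  assumes "y \<noteq> []" "z \<noteq> []"
  shows "adjacent (edge y) (edge z)
    \<longleftrightarrow> y \<noteq> z \<and> (butlast y = butlast z \<or> butlast y = z \<or> y = butlast z)"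
  unfolding adjacent_def edge_eq_iff[OF assms] by (auto simp: edge_def)

lemma inj_on_edge: "inj_on edge (nodes a b k)"
  by (rule inj_onI) (simp add: nodes_def edge_eq_iff)

lemma in_rooted_vertices_same: "y \<in> rooted_vertices b b k \<longleftrightarrow> length y \<le> k \<and> set y \<subseteq> {..<b}"
  unfolding rooted_vertices_def by (auto simp: in_set_conv_nth subset_iff)

text \<open>As \<open>x\<close> is not the root, the exceptional branching \<open>a\<close> concerns
  only the first entry of \<open>x\<close>; all entries of \<open>y\<close> are bounded by
  \<open>b\<close>.\<close>

lemma in_rooted_vertices_append:
  assumes "x \<noteq> []"
  shows "x @ y \<in> rooted_vertices a b k
    \<longleftrightarrow> x \<in> rooted_vertices a b k \<and> length x + length y \<le> k \<and> set y \<subseteq> {..<b}" (is "?l \<longleftrightarrow> ?r")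
proof
  assume l: ?l
  have "(x @ y) ! i < (if i = 0 then a else b)" if "i < length x + length y" for i
    using l that by (simp add: rooted_vertices_def)
  note * = this
  have "x ! i < (if i = 0 then a else b)" if "i < length x" for i
    using *[of i] that by (simp add: nth_append)
  moreover have "y ! i < b" if "i < length y" for i
    using *[of "length x + i"] that assms by (simp add: nth_append)
  ultimately show ?r using l by (auto simp: rooted_vertices_def in_set_conv_nth)
next
  assume r: ?r
  have "(x @ y) ! i < (if i = 0 then a else b)" if "i < length x + length y" for i
  proof (cases "i < length x")
    case True then show ?thesis using r by (simp add: rooted_vertices_def nth_append)
  next
    case False
    then have "y ! (i - length x) \<in> set y" using that by simp
    then have "y ! (i - length x) < b" using r by blast
    moreover have "i \<noteq> 0" using False assms by (cases i) auto
    ultimately show ?thesis using False by (simp add: nth_append)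
  qed
  then show ?l using r by (simp add: rooted_vertices_def)
qed

lemma finite_rooted_vertices: "finite (rooted_vertices a b k)"
proof (rule finite_subset)
  show "rooted_vertices a b k \<subseteq> {xs. set xs \<subseteq> {..<max a b} \<and> length xs \<le> k}"
    unfolding rooted_vertices_def by (fastforce simp: in_set_conv_nth split: if_splits)
  show "finite {xs. set xs \<subseteq> {..<max a b} \<and> length xs \<le> k}"
    by (rule finite_lists_length_le) simp
qed

lemma finite_nodes: "finite (nodes a b k)"
  by (simp add: nodes_def finite_rooted_vertices)

lemma nodes_nonempty: "y \<in> nodes a b k \<Longrightarrow> y \<noteq> []"
  by (simp add: nodes_def)

lemma nodes_append_iff:
  assumes "x \<noteq> []"
  shows "x @ y \<in> nodes a b k
    \<longleftrightarrow> x \<in> rooted_vertices a b k \<and> length x + length y \<le> k \<and> set y \<subseteq> {..<b}"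
  using in_rooted_vertices_append[OF assms] assms by (simp add: nodes_def)

lemma in_nodes_same: "y \<in> nodes b b k \<longleftrightarrow> y \<noteq> [] \<and> length y \<le> k \<and> set y \<subseteq> {..<b}"
  by (auto simp: nodes_def in_rooted_vertices_same)

lemma rooted_vertices_mono: "k \<le> k' \<Longrightarrow> rooted_vertices a b k \<subseteq> rooted_vertices a b k'"
  by (auto simp: rooted_vertices_def)

lemma reg_tree_eq: "reg_tree \<Delta> k = edge ` nodes \<Delta> (\<Delta> - 1) k"
  by (simp add: reg_tree_def rooted_edges_eq)

lemma finite_reg_tree: "finite (reg_tree \<Delta> k)"
  by (simp add: reg_tree_eq finite_nodes)

lemma star_tree_eq: "star_tree d k = insert root_edge ((\<lambda>y. Some ` edge y) ` nodes d d k)"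
  by (simp add: star_tree_def rooted_edges_eq image_image)

lemma finite_star_tree: "finite (star_tree d k)"
  by (simp add: star_tree_eq finite_nodes)

lemma Some_edge_neq_root: "Some ` edge y \<noteq> root_edge"
  unfolding root_edge_def by (metis imageE insertI1 insertI2 option.distinct(1))

lemma inj_on_Some_edge: "inj_on (\<lambda>y. Some ` edge y) (nodes a b k)"
  using inj_on_edge unfolding inj_on_def by (simp add: inj_image_eq_iff)

text \<open>The embedding of the tree with a hanging root edge below the vertex \<open>x\<close>; the root edge
  becomes the edge above \<open>x\<close>.\<close>

definition graft :: "nat list \<Rightarrow> nat list option \<Rightarrow> nat list" where
  "graft x v = (case v of None \<Rightarrow> butlast x | Some y \<Rightarrow> x @ y)"

lemma graft_root: "graft x ` root_edge = edge x"
  by (auto simp: graft_def root_edge_def edge_def)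

lemma graft_Some_edge: "y \<noteq> [] \<Longrightarrow> graft x ` Some ` edge y = edge (x @ y)"
  by (simp add: graft_def edge_def butlast_append)

lemma inj_graft:
  assumes "x \<noteq> []"
  shows "inj (graft x)"
proof -
  have "butlast x \<noteq> x @ y" for y
  proof
    assume "butlast x = x @ y"
    then have "length x - 1 = length x + length y" by (metis length_butlast length_append)
    then show False using assms by (cases x) auto
  qed
  then show ?thesis
    unfolding inj_def graft_def by (auto split: option.splits) metis
qed

lemma star_tree_Diff_root: "star_tree d k - {root_edge} = (\<lambda>y. Some ` edge y) ` nodes d d k"
  unfolding star_tree_eq
  by (rule Diff_insert_absorb, rule notI, erule imageE) (erule Some_edge_neq_root[THEN notE, OF sym])

lemma graft_star_tree_Diff_root:
  "(`) (graft x) ` (star_tree d l - {root_edge}) = edge ` (@) x ` nodes d d l"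
  unfolding star_tree_Diff_root image_image[of "(`) (graft x)"] image_image[of edge]
  by (rule image_cong[OF refl]) (rule graft_Some_edge[OF nodes_nonempty])

lemma graft_star_tree:
  "(`) (graft x) ` star_tree d l = insert (edge x) (edge ` (@) x ` nodes d d l)"
proof -
  have "star_tree d l = insert root_edge (star_tree d l - {root_edge})"
    by (simp add: star_tree_def insert_absorb)
  then have "(`) (graft x) ` star_tree d l
      = insert (graft x ` root_edge) ((`) (graft x) ` (star_tree d l - {root_edge}))"
    by (metis image_insert)
  then show ?thesis unfolding graft_star_tree_Diff_root graft_root .
qed

section \<open>Recolouring the tree below a vertex\<close>

lemma exists_bij_betw_image:
  assumes "finite S" "A \<subseteq> S" "B \<subseteq> S" "card A = card B"
  shows "\<exists>\<pi>. bij_betw \<pi> S S \<and> \<pi> ` A = B"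
proof -
  have fin: "finite A" "finite B" using assms finite_subset by auto
  obtain f where f: "bij_betw f A B"
    using finite_same_card_bij[OF fin assms(4)] by auto
  have "card (S - A) = card (S - B)"
    using assms fin by (simp add: card_Diff_subset)
  then obtain g where g: "bij_betw g (S - A) (S - B)"
    using finite_same_card_bij assms(1) by (metis finite_Diff)
  define p where "p x = (if x \<in> A then f x else g x)" for x
  have pA: "bij_betw p A B" using f by (rule bij_betw_cong[THEN iffD1, rotated]) (simp add: p_def)
  moreover have "bij_betw p (S - A) (S - B)"
    using g by (rule bij_betw_cong[THEN iffD1, rotated]) (simp add: p_def)
  ultimately have "bij_betw p (A \<union> (S - A)) (B \<union> (S - B))" by (rule bij_betw_combine) auto
  then have "bij_betw p S S" using assms by (simp add: Un_absorb1)
  then show ?thesis using pA by (auto simp: bij_betw_def)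
qed

text \<open>Here \<open>x\<close> is a leaf of the tree of depth \<open>k\<close>, viewed inside the
  tree of depth \<open>k + l\<close>. The two blocks of interest are the hanging tree without
  (\<open>B\<close>) and with (\<open>U\<close>) the edge above \<open>x\<close>.\<close>

locale grafted_tree =
  fixes \<Delta> q d l k :: nat and x :: "nat list"
  assumes \<Delta>: "\<Delta> \<ge> 2" and q: "q \<ge> \<Delta> + 1" and d: "d = \<Delta> - 1"
    and x: "x \<in> rooted_vertices \<Delta> d k" "length x = k" "x \<noteq> []"
begin

abbreviation "E \<equiv> reg_tree \<Delta> (k + l)"
abbreviation "\<Omega> \<equiv> list_edge_colorings E (\<lambda>_. {1..q})"
abbreviation "B \<equiv> edge ` (@) x ` nodes d d l"
abbreviation "U \<equiv> insert (edge x) B"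

lemma E_eq: "E = edge ` nodes \<Delta> d (k + l)"
  by (simp add: reg_tree_eq d)

lemma finite_\<Omega>: "finite \<Omega>"
  by (intro finite_list_edge_colorings finite_reg_tree) simp

lemma x_in: "x \<in> rooted_vertices \<Delta> d (k + l)"
  using x rooted_vertices_mono[of k "k + l"] by auto

lemma append_in_nodes_iff: "x @ y \<in> nodes \<Delta> d (k + l) \<longleftrightarrow> y = [] \<or> y \<in> nodes d d l"
  using x x_in by (auto simp: nodes_append_iff in_nodes_same)

lemma in_U_iff:
  assumes "z \<in> nodes \<Delta> d (k + l)"
  shows "edge z \<in> U \<longleftrightarrow> (\<exists>y. z = x @ y)"
proof
  assume "edge z \<in> U"
  then show "\<exists>y. z = x @ y"
    using edge_eq_iff[OF nodes_nonempty[OF assms]] x(3) by auto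
next
  assume "\<exists>y. z = x @ y"
  then obtain y where y: "z = x @ y" by auto
  then show "edge z \<in> U" using assms append_in_nodes_iff[of y] by auto
qed

lemma U_subset: "U \<subseteq> E"
  using append_in_nodes_iff append_in_nodes_iff[of "[]"] by (auto simp: E_eq)

lemma edge_x_notin_B: "edge x \<notin> B"
  using x(3) by (auto simp: edge_eq_iff nodes_nonempty)

text \<open>Both ends of an edge strictly below \<open>x\<close> extend \<open>x\<close>. An edge
  sharing one of them therefore has a lower end that extends \<open>x\<close> too, and so belongs to
  \<open>U\<close>.\<close>

lemma boundary:
  assumes "y \<in> nodes d d l" "e \<in> E - U"
  shows "\<not> adjacent (edge (x @ y)) e"
proof
  assume adj: "adjacent (edge (x @ y)) e"
  obtain z where z: "z \<in> nodes \<Delta> d (k + l)" "e = edge z" using assms E_eq by auto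
  have y: "y \<noteq> []" using assms nodes_nonempty by auto
  have "z \<noteq> []" using z nodes_nonempty by auto
  then have zz: "z = butlast z @ [last z]" by simp
  consider "x @ butlast y = butlast z" | "x @ butlast y = z" | "x @ y = butlast z"
    using adj y x(3) \<open>z \<noteq> []\<close> unfolding z by (subst (asm) adjacent_edge_iff) (auto simp: butlast_append)
  then have "\<exists>w. z = x @ w"
    by cases (metis zz append.assoc)+
  then have "e \<in> U" using in_U_iff[OF z(1)] z(2) by simp
  then show False using assms by simp
qed

definition "nbrs = {e \<in> E - U. adjacent (edge x) e}"

text \<open>Outside the hanging tree the edge above \<open>x\<close> meets others only at its upper
  end: the sibling edges and, unless that end is the root, the edge above it.\<close>

lemma nbrs_eq:
  "nbrs = edge ` ((\<lambda>c. butlast x @ [c]) ` ({..<if butlast x = [] then \<Delta> else d} - {last x})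
    \<union> ({butlast x} - {[]}))"
proof -
  let ?p = "butlast x"
  have xp: "x = ?p @ [last x]" using x(3) by simp
  have p_in: "?p @ w \<in> nodes \<Delta> d (k + l) \<longleftrightarrow> length ?p + length w \<le> k + l \<and> set w \<subseteq> {..<d}" if "?p \<noteq> []" for w
  proof -
    have "?p \<in> rooted_vertices \<Delta> d (k + l)"
      using x_in xp in_rooted_vertices_append[OF that] by metis
    then show ?thesis using nodes_append_iff[OF that] by simp
  qed
  have len: "length ?p + 1 = k" using x by (cases x) auto
  have sib: "?p @ [c] \<in> nodes \<Delta> d (k + l) \<longleftrightarrow> c < (if ?p = [] then \<Delta> else d)" for c
  proof (cases "?p = []")
    case True
    then show ?thesis using len by (auto simp: nodes_def rooted_vertices_def)
  next
    case False then show ?thesis using p_in[OF False, of "[c]"] len by simp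
  qed
  have par: "?p \<in> nodes \<Delta> d (k + l)" if "?p \<noteq> []"
    using p_in[OF that, of "[]"] len by simp
  have not_pre: "?p \<noteq> x @ w" for w using len x by (metis add_leD1 length_append le_add1 not_add_less1 Suc_eq_plus1 Suc_n_not_le_n)
  have key: "z \<in> nodes \<Delta> d (k + l) \<and> edge z \<notin> U \<and> adjacent (edge x) (edge z)
    \<longleftrightarrow> z \<in> (\<lambda>c. ?p @ [c]) ` ({..<if ?p = [] then \<Delta> else d} - {last x}) \<union> ({?p} - {[]})" for z
  proof
    assume *: "z \<in> nodes \<Delta> d (k + l) \<and> edge z \<notin> U \<and> adjacent (edge x) (edge z)"
    then have z: "z \<noteq> []" using nodes_nonempty by auto
    have npre: "z \<noteq> x @ w" for w using * in_U_iff by blast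
    have "x \<noteq> z" "?p = butlast z \<or> ?p = z \<or> x = butlast z"
      using * adjacent_edge_iff[OF x(3) z] by auto
    moreover have "x \<noteq> butlast z" using npre[of "[last z]"] z by (metis append_butlast_last_id)
    moreover have "z = ?p @ [last z]" if "?p = butlast z" using z that by simp
    ultimately show "z \<in> (\<lambda>c. ?p @ [c]) ` ({..<if ?p = [] then \<Delta> else d} - {last x}) \<union> ({?p} - {[]})"
      using * sib[of "last z"] xp z by (metis (no_types, lifting) Diff_iff Un_iff imageI lessThan_iff singletonD singletonI)
  next
    assume "z \<in> (\<lambda>c. ?p @ [c]) ` ({..<if ?p = [] then \<Delta> else d} - {last x}) \<union> ({?p} - {[]})"
    then show "z \<in> nodes \<Delta> d (k + l) \<and> edge z \<notin> U \<and> adjacent (edge x) (edge z)"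
    proof
      assume "z \<in> (\<lambda>c. ?p @ [c]) ` ({..<if ?p = [] then \<Delta> else d} - {last x})"
      then obtain c where c: "z = ?p @ [c]" "c < (if ?p = [] then \<Delta> else d)" "c \<noteq> last x" by auto
      then have zn: "z \<in> nodes \<Delta> d (k + l)" using sib by simp
      have "x \<noteq> z" using c by (metis last_snoc)
      moreover have "z \<noteq> x @ w" for w
      proof
        assume zw: "z = x @ w"
        have "length z = length x" using c(1) len x by simp
        with zw \<open>x \<noteq> z\<close> show False by simp
      qed
      ultimately show ?thesis
        using zn in_U_iff[OF zn] c(1) x(3) by (subst adjacent_edge_iff) auto
    next
      assume z: "z \<in> {?p} - {[]}"
      then have zn: "z \<in> nodes \<Delta> d (k + l)" using par by blast
      then show ?thesis using z in_U_iff[OF zn] not_pre not_pre[of "[]"] x(3)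
        by (subst adjacent_edge_iff) auto
    qed
  qed
  have "nbrs = edge ` {z. z \<in> nodes \<Delta> d (k + l) \<and> edge z \<notin> U \<and> adjacent (edge x) (edge z)}"
    unfolding nbrs_def E_eq by (rule set_eqI, unfold image_iff mem_Collect_eq Diff_iff Bex_def) metis
  then show ?thesis unfolding key Collect_mem_eq .
qed

text \<open>Below the root there are \<open>\<Delta> - 1\<close> siblings; elsewhere there are
  \<open>d - 1\<close> siblings and one parent edge. Both counts equal \<open>d\<close>, so the
  number of neighbours does not depend on the depth of \<open>x\<close>.\<close>

lemma card_nbrs: "card nbrs = d"
proof -
  let ?p = "butlast x" and ?b = "if butlast x = [] then \<Delta> else d"
  let ?N = "(\<lambda>c. ?p @ [c]) ` ({..<?b} - {last x})" and ?P = "{?p} - {[]}"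
  have xp: "x = ?p @ [last x]" using x(3) by simp
  have last: "last x < ?b"
  proof (cases "?p = []")
    case True
    then have "x = [last x]" using xp by simp
    then have "[last x] \<in> rooted_vertices \<Delta> d k" using x by simp
    then show ?thesis using True by (simp add: rooted_vertices_def)
  next
    case False
    have "?p @ [last x] \<in> rooted_vertices \<Delta> d k" using x xp by simp
    then show ?thesis using in_rooted_vertices_append[OF False] False by simp
  qed
  have "inj_on edge (?N \<union> ?P)"
    by (rule inj_onI) (auto simp: edge_eq_iff)
  then have "card nbrs = card (?N \<union> ?P)" unfolding nbrs_eq by (rule card_image)
  also have "\<dots> = card ?N + card ?P" by (rule card_Un_disjoint) auto
  also have "card ?N = ?b - 1"
    using last by (subst card_image) (auto simp: inj_on_def)
  also have "?b - 1 + card ?P = d" using d \<Delta> by (cases "?p = []") auto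
  finally show ?thesis .
qed

text \<open>All these neighbours contain \<open>butlast x\<close>, hence are pairwise adjacent and
  carry \<open>d\<close> distinct colours.\<close>

lemma card_free_colors:
  assumes \<sigma>: "\<sigma> \<in> \<Omega>"
  shows "card ({1..q} - \<sigma> ` nbrs) = q - d"
proof -
  have sub: "\<sigma> ` nbrs \<subseteq> {1..q}"
    using \<sigma> unfolding nbrs_def list_edge_colorings_def by (auto simp: PiE_iff)
  have "inj_on \<sigma> nbrs"
  proof (rule inj_onI, rule ccontr)
    fix e e' assume e: "e \<in> nbrs" "e' \<in> nbrs" and eq: "\<sigma> e = \<sigma> e'" and neq: "e \<noteq> e'"
    have "butlast x \<in> e" "butlast x \<in> e'" using e by (auto simp: nbrs_eq edge_def)
    then have "adjacent e e'" using neq by (auto simp: adjacent_def)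
    then show False using \<sigma> e eq by (auto simp: list_edge_colorings_def nbrs_def)
  qed
  then have "card (\<sigma> ` nbrs) = d" using card_nbrs card_image by metis
  then show ?thesis using sub by (simp add: card_Diff_subset finite_subset)
qed

lemma embedding_free:
  assumes \<sigma>: "\<sigma> \<in> \<Omega>"
  obtains \<pi> where
    "coloring_embedding (graft x) (star_tree d l) root_edge E q \<sigma> U ({1..q} - \<sigma> ` nbrs) \<pi>"
    "\<pi> ` ({1..q} - \<sigma> ` nbrs) = {1..q - d}"
proof -
  obtain \<pi> where \<pi>: "bij_betw \<pi> {1..q} {1..q}" "\<pi> ` ({1..q} - \<sigma> ` nbrs) = {1..q - d}"
    using exists_bij_betw_image[of "{1..q}" "{1..q} - \<sigma> ` nbrs" "{1..q - d}"] card_free_colors[OF \<sigma>]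
    by auto
  have "coloring_embedding (graft x) (star_tree d l) root_edge E q \<sigma> U ({1..q} - \<sigma> ` nbrs) \<pi>"
  proof (unfold_locales, unfold graft_star_tree graft_root)
    show "inj (graft x)" by (rule inj_graft[OF x(3)])
    show "root_edge \<in> star_tree d l" by (simp add: star_tree_eq)
    show "\<tau> (edge x) \<in> {1..q} - \<sigma> ` nbrs"
      if \<tau>: "\<tau> \<in> \<Omega>" and agree: "\<And>e. e \<in> E - U \<Longrightarrow> \<tau> e = \<sigma> e" for \<tau>
    proof -
      have "edge x \<in> E" using U_subset by simp
      then have "\<tau> (edge x) \<in> {1..q}" and "\<tau> (edge x) \<noteq> \<tau> e" if "e \<in> nbrs" for e
        using \<tau> that unfolding list_edge_colorings_def nbrs_def by (auto simp: PiE_iff)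
      moreover have "\<tau> e = \<sigma> e" if "e \<in> nbrs" for e
        using agree that by (simp add: nbrs_def)
      moreover have "\<tau> (edge x) \<in> {1..q}"
        using \<tau> \<open>edge x \<in> E\<close> unfolding list_edge_colorings_def by (simp add: PiE_iff)
      ultimately show ?thesis by fastforce
    qed
    show "\<sigma> e \<noteq> c" if "c \<in> {1..q} - \<sigma> ` nbrs" "e \<in> E - U" "adjacent (edge x) e" for c e
      using that unfolding nbrs_def by blast
    show "\<not> adjacent (graft x ` s) e"
      if s: "s \<in> star_tree d l" "s \<noteq> root_edge" and e: "e \<in> E - U" for s e
    proof -
      obtain y where y: "y \<in> nodes d d l" "s = Some ` edge y"
        using s unfolding star_tree_eq by blast
      then show ?thesis using boundary[OF y(1) e] by (simp add: graft_Some_edge nodes_nonempty)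
    qed
  qed (use \<sigma> \<pi> U_subset in simp_all)
  then show thesis using \<pi>(2) that by blast
qed

lemma embedding_pinned:
  assumes \<sigma>: "\<sigma> \<in> \<Omega>"
  obtains \<pi> where
    "coloring_embedding (graft x) (star_tree d l) root_edge E q \<sigma> B {\<sigma> (edge x)} \<pi>"
    "\<pi> ` {\<sigma> (edge x)} = {1}"
proof -
  have ex: "edge x \<in> E" using U_subset by simp
  then have \<sigma>x: "\<sigma> (edge x) \<in> {1..q}"
    using \<sigma> unfolding list_edge_colorings_def by (simp add: PiE_iff)
  obtain \<pi> where \<pi>: "bij_betw \<pi> {1..q} {1..q}" "\<pi> ` {\<sigma> (edge x)} = {1}"
    using exists_bij_betw_image[of "{1..q}" "{\<sigma> (edge x)}" "{1}"] \<sigma>x by auto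
  have "coloring_embedding (graft x) (star_tree d l) root_edge E q \<sigma> B {\<sigma> (edge x)} \<pi>"
  proof (unfold_locales, unfold graft_star_tree graft_root)
    show "inj (graft x)" by (rule inj_graft[OF x(3)])
    show "root_edge \<in> star_tree d l" by (simp add: star_tree_eq)
    show "\<tau> (edge x) \<in> {\<sigma> (edge x)}"
      if \<tau>: "\<tau> \<in> \<Omega>" and agree: "\<And>e. e \<in> E - B \<Longrightarrow> \<tau> e = \<sigma> e" for \<tau>
      using agree[of "edge x"] ex edge_x_notin_B by simp
    show "\<sigma> e \<noteq> c" if "c \<in> {\<sigma> (edge x)}" "e \<in> E - U" "adjacent (edge x) e" for c e
      using that \<sigma> ex unfolding list_edge_colorings_def by (simp, metis)
    show "\<not> adjacent (graft x ` s) e"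
      if s: "s \<in> star_tree d l" "s \<noteq> root_edge" and e: "e \<in> E - U" for s e
    proof -
      obtain y where y: "y \<in> nodes d d l" "s = Some ` edge y"
        using s unfolding star_tree_eq by blast
      then show ?thesis using boundary[OF y(1) e] by (simp add: graft_Some_edge nodes_nonempty)
    qed
  qed (use \<sigma> \<pi> \<sigma>x U_subset in auto)
  then show thesis using \<pi>(2) that by blast
qed

text \<open>Once the outside of \<open>B\<close> is fixed, so is the colour of the edge above
  \<open>x\<close>, and the hanging tree is a recoloured copy of \<open>mu_star1\<close>.
  Tensorization is applied to each such class.\<close>

lemma bvar_below_le:
  fixes \<gamma> :: real
  defines "\<Omega>1 \<equiv> list_edge_colorings (star_tree d l) (\<lambda>e. if e = root_edge then {1} else {1..q})"
  assumes AT: "\<And>g. (\<And>\<rho>. \<rho> \<in> \<Omega>1 \<Longrightarrow> 0 \<le> g \<rho>) \<Longrightarrow> bvar (star_tree d l) \<Omega>1 (star_tree d l) g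
      \<le> \<gamma> * (\<Sum>e\<in>star_tree d l. bvar (star_tree d l) \<Omega>1 {e} g)"
    and f: "\<And>\<tau>. \<tau> \<in> \<Omega> \<Longrightarrow> 0 \<le> f \<tau>"
  shows "bvar E \<Omega> B f \<le> \<gamma> * (\<Sum>y\<in>nodes d d l. bvar E \<Omega> {edge (x @ y)} f)"
proof -
  let ?E = "star_tree d l"
  let ?G = "\<lambda>\<tau>. \<gamma> * (\<Sum>y\<in>nodes d d l. (f \<tau> - bexp E \<Omega> {edge (x @ y)} f \<tau>)\<^sup>2)"
  have "(\<Sum>\<tau>\<in>\<Omega>. (f \<tau> - bexp E \<Omega> B f \<tau>)\<^sup>2) \<le> (\<Sum>\<tau>\<in>\<Omega>. ?G \<tau>)"
  proof (rule sum_mono_classes[OF finite_\<Omega>, where \<kappa> = "\<lambda>\<sigma>. restrict \<sigma> (E - B)"])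
    fix \<sigma> assume "\<sigma> \<in> \<Omega>"
    then obtain \<pi> where emb: "coloring_embedding (graft x) ?E root_edge E q \<sigma> B {\<sigma> (edge x)} \<pi>"
      and \<pi>: "\<pi> ` {\<sigma> (edge x)} = {1}"
      by (rule embedding_pinned)
    interpret C: coloring_embedding "graft x" ?E root_edge E q \<sigma> B "{\<sigma> (edge x)}" \<pi>
      by (rule emb)
    have \<Omega>': "C.\<Omega>' = \<Omega>1" unfolding \<Omega>1_def \<pi> ..
    define g where "g = C.pull f"
    have root1: "\<rho> root_edge = 1" if "\<rho> \<in> \<Omega>1" for \<rho>
    proof -
      have "\<rho> \<in> PiE ?E (\<lambda>e. if e = root_edge then {1} else {1..q})"
        using that unfolding \<Omega>1_def list_edge_colorings_def by blast
      from PiE_mem[OF this C.r] show ?thesis by simp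
    qed
    \<comment> \<open>The root edge has only one possible colour, so conditioning on it is no
      condition at all; for the same reason its own variance vanishes below.\<close>
    have "bexp ?E \<Omega>1 (?E - {root_edge}) g \<rho> = bexp ?E \<Omega>1 ?E g \<rho>" if "\<rho> \<in> \<Omega>1" for \<rho>
    proof -
      have "?E - (?E - {root_edge}) = {root_edge}" by (auto simp: star_tree_eq)
      then have "{\<rho>' \<in> \<Omega>1. restrict \<rho>' (?E - (?E - {root_edge})) = restrict \<rho> (?E - (?E - {root_edge}))} = \<Omega>1"
        using root1 root1[OF that] unfolding restrict_eq_iff by auto
      moreover have "{\<rho>' \<in> \<Omega>1. restrict \<rho>' (?E - ?E) = restrict \<rho> (?E - ?E)} = \<Omega>1"
        unfolding restrict_eq_iff by simp
      ultimately show ?thesis unfolding bexp_def cexp_def by (simp only:)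
    qed
    then have all: "bvar ?E \<Omega>1 ?E g = bvar ?E \<Omega>1 (?E - {root_edge}) g"
      unfolding bvar_def by simp
    have "bexp ?E \<Omega>1 {root_edge} g \<rho> = g \<rho>" if "\<rho> \<in> \<Omega>1" for \<rho>
    proof -
      have "\<rho>' = \<rho>" if \<rho>': "\<rho>' \<in> \<Omega>1" "\<forall>e\<in>?E - {root_edge}. \<rho>' e = \<rho> e" for \<rho>'
      proof
        fix e show "\<rho>' e = \<rho> e"
        proof (cases "e \<in> ?E")
          case True
          show ?thesis
            using True \<rho>' root1[OF \<rho>'(1)] root1[OF \<open>\<rho> \<in> \<Omega>1\<close>] by (cases "e = root_edge") auto
        next
          case False
          then show ?thesis
            using \<open>\<rho> \<in> \<Omega>1\<close> \<rho>'(1) unfolding \<Omega>1_def list_edge_colorings_def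
            by (simp add: PiE_def extensional_def)
        qed
      qed
      then have "{\<rho>' \<in> \<Omega>1. restrict \<rho>' (?E - {root_edge}) = restrict \<rho> (?E - {root_edge})} = {\<rho>}"
        using that unfolding restrict_eq_iff by blast
      then show ?thesis by (simp add: bexp_def cexp_def)
    qed
    then have root0: "bvar ?E \<Omega>1 {root_edge} g = 0"
      unfolding bvar_def by simp
    have img: "(`) (graft x) ` (?E - {root_edge}) = B" by (rule graft_star_tree_Diff_root)
    have "(\<Sum>\<tau>\<in>C.K. (f \<tau> - bexp E \<Omega> B f \<tau>)\<^sup>2) = bvar ?E \<Omega>1 (?E - {root_edge}) g"
      using C.bvar_pull[of "?E - {root_edge}" f] unfolding img \<Omega>' g_def by simp
    also have "\<dots> \<le> \<gamma> * (\<Sum>e\<in>?E. bvar ?E \<Omega>1 {e} g)"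
      unfolding all[symmetric]
      by (rule AT) (use C.pull_nonneg[of f] f \<Omega>' in \<open>simp add: g_def\<close>)
    also have "(\<Sum>e\<in>?E. bvar ?E \<Omega>1 {e} g) = (\<Sum>y\<in>nodes d d l. bvar ?E \<Omega>1 {Some ` edge y} g)"
    proof -
      have "(\<Sum>e\<in>?E. bvar ?E \<Omega>1 {e} g) = (\<Sum>e\<in>(\<lambda>y. Some ` edge y) ` nodes d d l. bvar ?E \<Omega>1 {e} g)"
        unfolding star_tree_eq using Some_edge_neq_root root0[unfolded star_tree_eq]
        by (subst sum.insert) (auto simp: finite_nodes)
      then show ?thesis by (simp add: sum.reindex[OF inj_on_Some_edge])
    qed
    also have "\<dots> = (\<Sum>y\<in>nodes d d l. \<Sum>\<tau>\<in>C.K. (f \<tau> - bexp E \<Omega> {edge (x @ y)} f \<tau>)\<^sup>2)"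
    proof (rule sum.cong[OF refl])
      fix y assume y: "y \<in> nodes d d l"
      have "(`) (graft x) ` {Some ` edge y} = {edge (x @ y)}"
        using y by (simp add: graft_Some_edge nodes_nonempty)
      then show "bvar ?E \<Omega>1 {Some ` edge y} g = (\<Sum>\<tau>\<in>C.K. (f \<tau> - bexp E \<Omega> {edge (x @ y)} f \<tau>)\<^sup>2)"
        using C.bvar_pull[of "{Some ` edge y}" f] y unfolding \<Omega>' g_def by (simp add: star_tree_eq)
    qed
    also have "\<gamma> * \<dots> = (\<Sum>\<tau>\<in>C.K. ?G \<tau>)"
      by (subst sum.swap) (simp add: sum_distrib_left)
    finally show "(\<Sum>\<tau> | \<tau> \<in> \<Omega> \<and> restrict \<tau> (E - B) = restrict \<sigma> (E - B). (f \<tau> - bexp E \<Omega> B f \<tau>)\<^sup>2)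
        \<le> (\<Sum>\<tau> | \<tau> \<in> \<Omega> \<and> restrict \<tau> (E - B) = restrict \<sigma> (E - B). ?G \<tau>)"
      unfolding C.K_def .
  qed
  also have "\<dots> = \<gamma> * (\<Sum>y\<in>nodes d d l. bvar E \<Omega> {edge (x @ y)} f)"
    unfolding bvar_def by (subst sum.swap) (simp add: sum_distrib_left)
  finally show ?thesis unfolding bvar_def[of E \<Omega> B] .
qed

text \<open>Here the class is taken outside \<open>U\<close>, so the edge above \<open>x\<close> is
  free as well and \<open>mu_star\<close> appears. Under the embedding \<open>B\<close> is the star
  tree without its root edge and \<open>U\<close> is all of it.\<close>

lemma root_variance_below_le:
  fixes \<alpha> :: "nat \<Rightarrow> real" and \<beta> :: real
  defines "\<Omega>s \<equiv> list_edge_colorings (star_tree d l) (\<lambda>e. if e = root_edge then {1..q - d} else {1..q})"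
  assumes RV: "\<And>g. (\<And>\<rho>. \<rho> \<in> \<Omega>s \<Longrightarrow> 0 \<le> g \<rho>) \<Longrightarrow>
      (\<Sum>\<rho>\<in>\<Omega>s. (bexp (star_tree d l) \<Omega>s (star_tree d l - {root_edge}) g \<rho>
        - bexp (star_tree d l) \<Omega>s (star_tree d l) g \<rho>)\<^sup>2)
      \<le> (\<Sum>i=0..l. \<alpha> i * (\<Sum>e\<in>star_level d l i. bvar (star_tree d l) \<Omega>s {e} g))
        + \<beta> * (\<Sum>e\<in>star_level d l 1. bvar (star_tree d l) \<Omega>s {e, root_edge} g)"
    and f: "\<And>\<tau>. \<tau> \<in> \<Omega> \<Longrightarrow> 0 \<le> f \<tau>"
  shows "(\<Sum>\<tau>\<in>\<Omega>. (bexp E \<Omega> B f \<tau> - bexp E \<Omega> U f \<tau>)\<^sup>2)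
    \<le> (\<Sum>i=0..l. \<alpha> i * (\<Sum>e\<in>star_level d l i. bvar E \<Omega> {graft x ` e} f))
      + \<beta> * (\<Sum>e\<in>star_level d l 1. bvar E \<Omega> {graft x ` e, edge x} f)"
proof -
  let ?E = "star_tree d l"
  let ?v = "\<lambda>S \<tau>. (f \<tau> - bexp E \<Omega> S f \<tau>)\<^sup>2"
  let ?G = "\<lambda>\<tau>. (\<Sum>i=0..l. \<alpha> i * (\<Sum>e\<in>star_level d l i. ?v {graft x ` e} \<tau>))
    + \<beta> * (\<Sum>e\<in>star_level d l 1. ?v {graft x ` e, edge x} \<tau>)"
  have level_sub: "star_level d l i \<subseteq> ?E" for i
    by (auto simp: star_level_def star_tree_eq)
  have expand: "(\<Sum>\<tau>\<in>X. ?G \<tau>)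
      = (\<Sum>i=0..l. \<alpha> i * (\<Sum>e\<in>star_level d l i. \<Sum>\<tau>\<in>X. ?v {graft x ` e} \<tau>))
      + \<beta> * (\<Sum>e\<in>star_level d l 1. \<Sum>\<tau>\<in>X. ?v {graft x ` e, edge x} \<tau>)" for X
  proof -
    have "(\<Sum>\<tau>\<in>X. \<Sum>i=0..l. \<alpha> i * (\<Sum>e\<in>star_level d l i. ?v {graft x ` e} \<tau>))
        = (\<Sum>i=0..l. \<alpha> i * (\<Sum>\<tau>\<in>X. \<Sum>e\<in>star_level d l i. ?v {graft x ` e} \<tau>))"
      unfolding sum_distrib_left[of _ _ X] by (rule sum.swap)
    moreover have "(\<Sum>\<tau>\<in>X. \<Sum>e\<in>star_level d l i. ?v {graft x ` e} \<tau>)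
        = (\<Sum>e\<in>star_level d l i. \<Sum>\<tau>\<in>X. ?v {graft x ` e} \<tau>)" for i
      by (rule sum.swap)
    moreover have "(\<Sum>\<tau>\<in>X. \<Sum>e\<in>star_level d l 1. ?v {graft x ` e, edge x} \<tau>)
        = (\<Sum>e\<in>star_level d l 1. \<Sum>\<tau>\<in>X. ?v {graft x ` e, edge x} \<tau>)"
      by (rule sum.swap)
    ultimately show ?thesis by (simp only: sum.distrib sum_distrib_left[symmetric])
  qed
  have "(\<Sum>\<tau>\<in>\<Omega>. (bexp E \<Omega> B f \<tau> - bexp E \<Omega> U f \<tau>)\<^sup>2) \<le> (\<Sum>\<tau>\<in>\<Omega>. ?G \<tau>)"
  proof (rule sum_mono_classes[OF finite_\<Omega>, where \<kappa> = "\<lambda>\<sigma>. restrict \<sigma> (E - U)"])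
    fix \<sigma> assume "\<sigma> \<in> \<Omega>"
    then obtain \<pi> where emb: "coloring_embedding (graft x) ?E root_edge E q \<sigma> U ({1..q} - \<sigma> ` nbrs) \<pi>"
      and \<pi>: "\<pi> ` ({1..q} - \<sigma> ` nbrs) = {1..q - d}"
      by (rule embedding_free)
    interpret C: coloring_embedding "graft x" ?E root_edge E q \<sigma> U "{1..q} - \<sigma> ` nbrs" \<pi>
      by (rule emb)
    have \<Omega>': "C.\<Omega>' = \<Omega>s" unfolding \<Omega>s_def \<pi> ..
    define g where "g = C.pull f"
    have img: "(`) (graft x) ` (?E - {root_edge}) = B" by (rule graft_star_tree_Diff_root)
    have sub: "(`) (graft x) ` S \<subseteq> U" if "S \<subseteq> ?E" for S
      using image_mono[OF that, of "(`) (graft x)"] by (simp only: graft_star_tree)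
    have bv: "bvar ?E \<Omega>s S g = (\<Sum>\<tau>\<in>C.K. ?v ((`) (graft x) ` S) \<tau>)" if "S \<subseteq> ?E" for S
      using C.bvar_pull[OF that sub[OF that]] unfolding \<Omega>' g_def .
    have be: "bexp ?E \<Omega>s S g (C.\<phi> \<tau>) = bexp E \<Omega> ((`) (graft x) ` S) f \<tau>"
      if "S \<subseteq> ?E" "\<tau> \<in> C.K" for S \<tau>
      using C.bexp_pull[OF that(1) sub[OF that(1)] that(2)] unfolding \<Omega>' g_def .
    have "(\<Sum>\<tau>\<in>C.K. (bexp E \<Omega> B f \<tau> - bexp E \<Omega> U f \<tau>)\<^sup>2)
        = (\<Sum>\<tau>\<in>C.K. (bexp ?E \<Omega>s (?E - {root_edge}) g (C.\<phi> \<tau>) - bexp ?E \<Omega>s ?E g (C.\<phi> \<tau>))\<^sup>2)"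
      using be[of "?E - {root_edge}"] be[of ?E] unfolding img graft_star_tree
      by (intro sum.cong refl) simp
    also have "\<dots> = (\<Sum>\<rho>\<in>\<Omega>s. (bexp ?E \<Omega>s (?E - {root_edge}) g \<rho> - bexp ?E \<Omega>s ?E g \<rho>)\<^sup>2)"
      using C.sum_pull[unfolded \<Omega>'] by (rule sym)
    also have "\<dots> \<le> (\<Sum>i=0..l. \<alpha> i * (\<Sum>e\<in>star_level d l i. bvar ?E \<Omega>s {e} g))
        + \<beta> * (\<Sum>e\<in>star_level d l 1. bvar ?E \<Omega>s {e, root_edge} g)"
      by (rule RV) (use C.pull_nonneg[of f] f \<Omega>' in \<open>simp add: g_def\<close>)
    also have "(\<Sum>e\<in>star_level d l 1. bvar ?E \<Omega>s {e, root_edge} g)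
        = (\<Sum>e\<in>star_level d l 1. \<Sum>\<tau>\<in>C.K. ?v {graft x ` e, edge x} \<tau>)"
    proof (rule sum.cong[OF refl])
      fix e assume "e \<in> star_level d l 1"
      then have "{e, root_edge} \<subseteq> ?E" using level_sub by (auto simp: star_tree_eq)
      from bv[OF this] show "bvar ?E \<Omega>s {e, root_edge} g = (\<Sum>\<tau>\<in>C.K. ?v {graft x ` e, edge x} \<tau>)"
        by (simp add: graft_root)
    qed
    also have "(\<Sum>i=0..l. \<alpha> i * (\<Sum>e\<in>star_level d l i. bvar ?E \<Omega>s {e} g))
        = (\<Sum>i=0..l. \<alpha> i * (\<Sum>e\<in>star_level d l i. \<Sum>\<tau>\<in>C.K. ?v {graft x ` e} \<tau>))"
    proof (intro sum.cong refl arg_cong2[where f = "(*)"])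
      fix i e assume "e \<in> star_level d l i"
      then have "{e} \<subseteq> ?E" using level_sub by auto
      from bv[OF this] show "bvar ?E \<Omega>s {e} g = (\<Sum>\<tau>\<in>C.K. ?v {graft x ` e} \<tau>)" by simp
    qed
    finally show "(\<Sum>\<tau> | \<tau> \<in> \<Omega> \<and> restrict \<tau> (E - U) = restrict \<sigma> (E - U).
          (bexp E \<Omega> B f \<tau> - bexp E \<Omega> U f \<tau>)\<^sup>2)
        \<le> (\<Sum>\<tau> | \<tau> \<in> \<Omega> \<and> restrict \<tau> (E - U) = restrict \<sigma> (E - U). ?G \<tau>)"
      unfolding C.K_def[symmetric] expand .
  qed
  also have "\<dots> = (\<Sum>i=0..l. \<alpha> i * (\<Sum>e\<in>star_level d l i. bvar E \<Omega> {graft x ` e} f))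
      + \<beta> * (\<Sum>e\<in>star_level d l 1. bvar E \<Omega> {graft x ` e, edge x} f)"
    unfolding bvar_def by (rule expand)
  finally show ?thesis .
qed

end

subsection \<open>Levels and explicit colourings\<close>

text \<open>A map with fibres of constant size sends the uniform distribution to the uniform
  distribution.\<close>

lemma sum_comp_fibers:
  fixes G :: "'b \<Rightarrow> real"
  assumes "finite \<Omega>" "finite \<Omega>0" "p ` \<Omega> \<subseteq> \<Omega>0"
    and N: "\<And>\<rho>. \<rho> \<in> \<Omega>0 \<Longrightarrow> card {\<tau> \<in> \<Omega>. p \<tau> = \<rho>} = N"
  shows "(\<Sum>\<tau>\<in>\<Omega>. G (p \<tau>)) = real N * (\<Sum>\<rho>\<in>\<Omega>0. G \<rho>)"
proof -
  have "(\<Sum>\<tau>\<in>\<Omega>. G (p \<tau>)) = (\<Sum>\<rho>\<in>\<Omega>0. \<Sum>\<tau>\<in>{\<tau> \<in> \<Omega>. p \<tau> = \<rho>}. G (p \<tau>))"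
    by (rule sum.group[symmetric]) (use assms in auto)
  also have "\<dots> = (\<Sum>\<rho>\<in>\<Omega>0. real N * G \<rho>)"
  proof (rule sum.cong[OF refl])
    fix \<rho> assume "\<rho> \<in> \<Omega>0"
    have "(\<Sum>\<tau>\<in>{\<tau> \<in> \<Omega>. p \<tau> = \<rho>}. G (p \<tau>)) = (\<Sum>\<tau>\<in>{\<tau> \<in> \<Omega>. p \<tau> = \<rho>}. G \<rho>)"
      by (rule sum.cong) auto
    then show "(\<Sum>\<tau>\<in>{\<tau> \<in> \<Omega>. p \<tau> = \<rho>}. G (p \<tau>)) = real N * G \<rho>"
      using N[OF \<open>\<rho> \<in> \<Omega>0\<close>] by simp
  qed
  finally show ?thesis by (simp add: sum_distrib_left)
qed

text \<open>Tower property: a condition on the image under \<open>p\<close> can be imposed after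
  averaging over the fibres of \<open>p\<close>. Equal fibre sizes make the outer average
  uniform.\<close>

lemma cexp_comp_fibers:
  fixes f :: "'a \<Rightarrow> real"
  assumes fin: "finite \<Omega>" "finite \<Omega>0" and p: "p ` \<Omega> \<subseteq> \<Omega>0"
    and N: "\<And>\<rho>. \<rho> \<in> \<Omega>0 \<Longrightarrow> card {\<tau> \<in> \<Omega>. p \<tau> = \<rho>} = N" and "N > 0"
    and g: "\<And>\<rho>. g \<rho> = (\<Sum>\<tau> | \<tau> \<in> \<Omega> \<and> p \<tau> = \<rho>. f \<tau>) / real N"
  shows "cexp \<Omega> (\<lambda>\<tau>. \<kappa> (p \<tau>)) f \<tau> = cexp \<Omega>0 \<kappa> g (p \<tau>)"
proof -
  let ?C = "{\<upsilon> \<in> \<Omega>. \<kappa> (p \<upsilon>) = \<kappa> (p \<tau>)}" and ?D = "{\<rho> \<in> \<Omega>0. \<kappa> \<rho> = \<kappa> (p \<tau>)}"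
  have sub: "p ` ?C \<subseteq> ?D" using p by auto
  have fib: "{\<upsilon> \<in> ?C. p \<upsilon> = \<rho>} = {\<upsilon> \<in> \<Omega>. p \<upsilon> = \<rho>}" if "\<rho> \<in> ?D" for \<rho>
    using that by auto
  have "(\<Sum>\<upsilon>\<in>?C. f \<upsilon>) = (\<Sum>\<rho>\<in>?D. \<Sum>\<upsilon>\<in>{\<upsilon> \<in> ?C. p \<upsilon> = \<rho>}. f \<upsilon>)"
    by (rule sum.group[symmetric]) (use fin sub in auto)
  also have "\<dots> = (\<Sum>\<rho>\<in>?D. real N * g \<rho>)"
    using \<open>N > 0\<close> by (intro sum.cong refl) (simp only: fib, simp add: g)
  finally have s: "(\<Sum>\<upsilon>\<in>?C. f \<upsilon>) = real N * (\<Sum>\<rho>\<in>?D. g \<rho>)"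
    by (simp add: sum_distrib_left)
  have "(\<Sum>\<upsilon>\<in>?C. (1::real)) = real N * (\<Sum>\<rho>\<in>?D. 1)"
    by (rule sum_comp_fibers) (use fin sub fib N in auto)
  then have "real (card ?C) = real N * real (card ?D)" by simp
  then show ?thesis using s \<open>N > 0\<close> by (simp add: cexp_def)
qed

section \<open>Line-graph levels as depths\<close>

lemma Collect_image: "{e \<in> F ` A. P e} = F ` {y \<in> A. P (F y)}"
  by auto

lemma star_level1_eq: "star_level1 d l = (\<lambda>y. Some ` edge y) ` {y \<in> nodes d d l. length y = 1}"
proof -
  have "Some [] \<in> Some ` edge y \<longleftrightarrow> length y = 1" if "y \<noteq> []" for y
    using that by (cases y) (auto simp: edge_def)
  then have "{y \<in> nodes d d l. Some [] \<in> Some ` edge y} = {y \<in> nodes d d l. length y = 1}"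
    using nodes_nonempty by (intro Collect_cong conj_cong refl) simp
  moreover have "star_level1 d l = (\<lambda>y. Some ` edge y) ` {y \<in> nodes d d l. Some [] \<in> Some ` edge y}"
    unfolding star_level1_def star_tree_Diff_root by (rule Collect_image)
  ultimately show ?thesis by simp
qed

definition vertex_depth :: "nat list option \<Rightarrow> nat" where
  "vertex_depth v = (case v of None \<Rightarrow> 0 | Some y \<Rightarrow> length y)"

text \<open>A potential that makes sense for every edge without naming its lower end. It is 0 on the
  root edge and grows by at most 1 along a step in the line graph, which bounds distances from
  below.\<close>

definition edge_depth :: "nat list option set \<Rightarrow> nat" where
  "edge_depth s = Max (vertex_depth ` s)"

lemma edge_depth_root: "edge_depth root_edge = 0"
  by (simp add: edge_depth_def root_edge_def vertex_depth_def)

lemma edge_depth_Some: "edge_depth (Some ` edge y) = length y"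
  by (simp add: edge_depth_def edge_def vertex_depth_def max_def)

lemma line_graph_edge_depth:
  assumes "(s, t) \<in> line_graph (star_tree d l)"
  shows "edge_depth t \<le> edge_depth s + 1"
proof -
  have st: "s \<in> star_tree d l" "t \<in> star_tree d l" "s \<inter> t \<noteq> {}"
    using assms by (auto simp: line_graph_def adjacent_def)
  then obtain v where v: "v \<in> s" "v \<in> t" by auto
  have "finite s"
    using st(1) by (auto simp: star_tree_eq root_edge_def edge_def)
  then have "vertex_depth v \<le> edge_depth s"
    using v by (simp add: edge_depth_def)
  moreover have "edge_depth t \<le> vertex_depth v + 1"
    using st(2) unfolding star_tree_eq
  proof
    assume "t = root_edge" then show ?thesis by (simp add: edge_depth_root)
  next
    assume "t \<in> (\<lambda>y. Some ` edge y) ` nodes d d l"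
    then obtain y where y: "t = Some ` edge y" by auto
    then have "v = Some y \<or> v = Some (butlast y)" using v by (auto simp: edge_def)
    then show ?thesis using y by (auto simp: edge_depth_Some vertex_depth_def)
  qed
  ultimately show ?thesis by simp
qed

lemma relpow_line_graph_edge_depth:
  "(s, t) \<in> line_graph (star_tree d l) ^^ m \<Longrightarrow> edge_depth t \<le> edge_depth s + m"
proof (induction m arbitrary: t)
  case (Suc m)
  then obtain u where "(s, u) \<in> line_graph (star_tree d l) ^^ m" "(u, t) \<in> line_graph (star_tree d l)"
    by auto
  then show ?case using Suc.IH line_graph_edge_depth by fastforce
qed simp

lemma star_level1_reaches:
  assumes "y \<in> nodes d d l"
  shows "\<exists>s\<in>star_level1 d l. (s, Some ` edge y) \<in> line_graph (star_tree d l) ^^ (length y - 1)"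
  using assms
proof (induction y rule: rev_induct)
  case (snoc c z)
  show ?case
  proof (cases "z = []")
    case True
    have "Some ` edge (z @ [c]) \<in> star_level1 d l"
      unfolding star_level1_eq using snoc.prems True by (intro imageI) simp
    then show ?thesis using True by (intro bexI) auto
  next
    case False
    then have z: "z \<in> nodes d d l" using snoc.prems by (auto simp: in_nodes_same)
    then obtain s where s: "s \<in> star_level1 d l"
      "(s, Some ` edge z) \<in> line_graph (star_tree d l) ^^ (length z - 1)"
      using snoc.IH by auto
    have "adjacent (edge z) (edge (z @ [c]))"
      using False by (simp add: adjacent_edge_iff)
    then have "(Some ` edge z, Some ` edge (z @ [c])) \<in> line_graph (star_tree d l)"
      using z snoc.prems by (simp add: line_graph_def star_tree_eq adjacent_image_iff)
    with s(2) have "(s, Some ` edge (z @ [c])) \<in> line_graph (star_tree d l) ^^ Suc (length z - 1)"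
      by (rule relpow_Suc_I)
    then show ?thesis using s(1) False by (intro bexI[of _ s]) (auto simp: Suc_diff_1)
  qed
qed (simp add: nodes_def)

text \<open>The descending path gives distance at most \<open>length y - 1\<close> from level 1. The
  depth potential, which is 1 on level 1, excludes anything shorter.\<close>

lemma star_level_eq:
  assumes "i \<ge> 1"
  shows "star_level d l i = (\<lambda>y. Some ` edge y) ` {y \<in> nodes d d l. length y = i}"
proof -
  have "at_line_distance (star_tree d l) (star_level1 d l) (i - 1) (Some ` edge y) \<longleftrightarrow> length y = i"
    if y: "y \<in> nodes d d l" for y
  proof -
    have le: "length y \<le> 1 + m"
      if "s \<in> star_level1 d l" "(s, Some ` edge y) \<in> line_graph (star_tree d l) ^^ m" for s m
    proof -
      have "edge_depth s = 1" using that(1) by (auto simp: star_level1_eq edge_depth_Some)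
      then show ?thesis using relpow_line_graph_edge_depth[OF that(2)] by (simp add: edge_depth_Some)
    qed
    note reach = star_level1_reaches[OF y]
    have "length y \<ge> 1" using nodes_nonempty[OF y] by (cases y) auto
    show ?thesis
    proof
      assume *: "at_line_distance (star_tree d l) (star_level1 d l) (i - 1) (Some ` edge y)"
      then have "length y \<le> 1 + (i - 1)" using le unfolding at_line_distance_def by blast
      moreover have "\<not> length y - 1 < i - 1" using * reach unfolding at_line_distance_def by blast
      ultimately show "length y = i" using assms \<open>length y \<ge> 1\<close> by linarith
    next
      assume "length y = i"
      then show "at_line_distance (star_tree d l) (star_level1 d l) (i - 1) (Some ` edge y)"
        using reach le assms unfolding at_line_distance_def by fastforce
    qed
  qed
  then have "{y \<in> nodes d d l. at_line_distance (star_tree d l) (star_level1 d l) (i - 1) (Some ` edge y)}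
      = {y \<in> nodes d d l. length y = i}"
    by (intro Collect_cong conj_cong refl)
  then show ?thesis
    using assms unfolding star_level_def star_tree_Diff_root Collect_image by simp
qed

lemma star_level_0: "star_level d l 0 = {root_edge}"
  by (simp add: star_level_def)

text \<open>Colouring the edge above \<open>y\<close> by \<open>weight y\<close> modulo the maximal degree is proper, since it
  gives the children of a vertex of colour \<open>c\<close> the distinct colours \<open>c + 1, c + 2, \<dots>\<close>. It leaves
  one of the \<open>q\<close> colours unused, with which any single edge can be recoloured.\<close>

definition weight :: "nat list \<Rightarrow> nat" where
  "weight y = sum_list y + length y"

lemma add_mod_neq:
  assumes "a < m" "b < m" "a \<noteq> b"
  shows "(n + a) mod m \<noteq> (n + b) mod (m :: nat)"
proof -
  have "(n + a) mod m \<noteq> (n + b) mod m" if "a < b" "b < m" for a b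
  proof
    assume "(n + a) mod m = (n + b) mod m"
    then have "m dvd n + b - (n + a)" using that by (metis mod_eq_dvd_iff_nat add_le_mono le_refl less_imp_le)
    then show False using that by (auto dest: dvd_imp_le)
  qed
  then show ?thesis using assms by (metis linorder_neqE_nat)
qed

lemma weight_mod_neq:
  assumes y: "y \<in> nodes a b k" and z: "z \<in> nodes a b k" and ab: "a \<le> m" "b < m"
    and adj: "adjacent (edge y) (edge z)"
  shows "weight y mod m \<noteq> weight z mod m"
proof -
  have child: "weight (p @ [c]) = (weight p + 1) + c" for p c by (simp add: weight_def)
  have last: "c < m" if "p @ [c] \<in> nodes a b k" for p c
  proof (cases "p = []")
    case True then show ?thesis using that ab by (simp add: nodes_def rooted_vertices_def)
  next
    case False then show ?thesis using that ab by (simp add: nodes_append_iff)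
  qed
  \<comment> \<open>The strict bound \<open>b < m\<close> is what keeps the offset
    \<open>c + 1\<close> from wrapping around to the colour of the parent.\<close>
  have parent: "weight (p @ [c]) mod m \<noteq> weight p mod m" if "p @ [c] \<in> nodes a b k" "p \<noteq> []" for p c
  proof -
    have "c + 1 < m" using that ab by (simp add: nodes_append_iff)
    then have "(weight p + (c + 1)) mod m \<noteq> (weight p + 0) mod m" by (intro add_mod_neq) auto
    then show ?thesis by (simp add: child)
  qed
  have ne: "y \<noteq> []" "z \<noteq> []" using y z nodes_nonempty by auto
  have eq: "y = butlast y @ [last y]" "z = butlast z @ [last z]" using ne by simp_all
  have "y \<noteq> z" and "butlast y = butlast z \<or> butlast y = z \<or> y = butlast z"
    using adj adjacent_edge_iff[OF ne] by auto
  then consider "butlast y = butlast z" "last y \<noteq> last z" | "butlast y = z" | "y = butlast z"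
    using eq by metis
  then show ?thesis
  proof cases
    case 1
    have "((weight (butlast y) + 1) + last y) mod m \<noteq> ((weight (butlast y) + 1) + last z) mod m"
      using 1 last eq y z by (intro add_mod_neq) metis+
    then show ?thesis using child eq 1(1) by metis
  next
    case 2 then show ?thesis using parent eq y ne by metis
  next
    case 3 then show ?thesis using parent eq z ne by metis
  qed
qed

text \<open>Weights increase strictly along a descending path, so \<open>Max\<close> selects the
  lower end of an edge given only as a set.\<close>

definition greedy_reg :: "nat \<Rightarrow> nat \<Rightarrow> nat list set \<Rightarrow> nat" where
  "greedy_reg \<Delta> k = restrict (\<lambda>e. 1 + Max (weight ` e) mod \<Delta>) (reg_tree \<Delta> k)"

definition greedy_star :: "nat \<Rightarrow> nat \<Rightarrow> nat list option set \<Rightarrow> nat" where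
  "greedy_star d k = restrict (\<lambda>s. 1 + Max (case_option 0 weight ` s) mod (d + 1)) (star_tree d k)"

lemma Max_weight_edge: "y \<noteq> [] \<Longrightarrow> Max (weight ` edge y) = weight y"
  by (cases y rule: rev_cases) (auto simp: edge_def weight_def max_def)

lemma greedy_reg_edge:
  "y \<in> nodes \<Delta> (\<Delta> - 1) k \<Longrightarrow> greedy_reg \<Delta> k (edge y) = 1 + weight y mod \<Delta>"
  by (simp add: greedy_reg_def reg_tree_eq Max_weight_edge nodes_nonempty)

lemma greedy_star_edge:
  assumes "y \<in> nodes d d k"
  shows "greedy_star d k (Some ` edge y) = 1 + weight y mod (d + 1)"
proof -
  have "case_option 0 weight ` Some ` edge y = weight ` edge y" by (simp add: image_image)
  then show ?thesis using assms by (simp add: greedy_star_def star_tree_eq Max_weight_edge nodes_nonempty)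
qed

lemma greedy_star_root: "greedy_star d k root_edge = 1"
  by (simp add: greedy_star_def star_tree_eq) (simp add: root_edge_def weight_def)

lemma greedy_reg_in:
  assumes "\<Delta> \<ge> 2" "q \<ge> \<Delta>"
  shows "greedy_reg \<Delta> k \<in> list_edge_colorings (reg_tree \<Delta> k) (\<lambda>_. {1..q})"
proof -
  have "greedy_reg \<Delta> k e \<in> {1..q}" if "e \<in> reg_tree \<Delta> k" for e
  proof -
    have "Max (weight ` e) mod \<Delta> < \<Delta>" using assms by simp
    then have "1 + Max (weight ` e) mod \<Delta> \<le> q" using assms by linarith
    then show ?thesis using that by (simp add: greedy_reg_def)
  qed
  then have "greedy_reg \<Delta> k \<in> PiE (reg_tree \<Delta> k) (\<lambda>_. {1..q})"
    by (auto simp: PiE_def greedy_reg_def)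
  moreover have "greedy_reg \<Delta> k e \<noteq> greedy_reg \<Delta> k e'"
    if e: "e \<in> reg_tree \<Delta> k" "e' \<in> reg_tree \<Delta> k" "adjacent e e'" for e e'
  proof -
    obtain y z where y: "y \<in> nodes \<Delta> (\<Delta> - 1) k" "e = edge y" and z: "z \<in> nodes \<Delta> (\<Delta> - 1) k" "e' = edge z"
      using e by (auto simp: reg_tree_eq)
    then have "weight y mod \<Delta> \<noteq> weight z mod \<Delta>"
      using e assms by (intro weight_mod_neq[OF y(1) z(1)]) auto
    then show ?thesis using y z by (simp add: greedy_reg_edge)
  qed
  ultimately show ?thesis by (simp add: list_edge_colorings_def)
qed

text \<open>Both ends of the root edge have weight 0, so it gets colour 1, which lies in the root
  lists of both \<open>mu_star\<close> and \<open>mu_star1\<close>. The edges next to it have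
  colours from 2 to \<open>d + 1\<close>.\<close>

lemma greedy_star_in:
  assumes "1 \<in> R" "q \<ge> d + 1"
  shows "greedy_star d k \<in> list_edge_colorings (star_tree d k) (\<lambda>e. if e = root_edge then R else {1..q})"
proof -
  have "greedy_star d k e \<in> {1..q}" if "e \<in> star_tree d k" for e
  proof -
    have "Max (case_option 0 weight ` e) mod (d + 1) < d + 1" by simp
    then have "1 + Max (case_option 0 weight ` e) mod (d + 1) \<le> q" using assms by linarith
    then show ?thesis using that by (simp add: greedy_star_def)
  qed
  then have "greedy_star d k \<in> PiE (star_tree d k) (\<lambda>e. if e = root_edge then R else {1..q})"
    using assms by (auto simp: PiE_iff greedy_star_root) (simp add: greedy_star_def)
  moreover have "greedy_star d k e \<noteq> greedy_star d k e'"
    if e: "e \<in> star_tree d k" "e' \<in> star_tree d k" "adjacent e e'" for e e'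
  proof -
    have root: "greedy_star d k (Some ` edge y) \<noteq> greedy_star d k root_edge"
      if "y \<in> nodes d d k" "adjacent (Some ` edge y) root_edge" for y
    proof -
      have ne: "y \<noteq> []" using that nodes_nonempty by auto
      then have "butlast y = []" using that(2) by (auto simp: adjacent_def edge_def root_edge_def)
      then obtain c where c: "y = [c]" using ne by (metis append_butlast_last_id append_Nil)
      then have "c < d" using that(1) by (simp add: in_nodes_same)
      then show ?thesis using that(1) c by (simp add: greedy_star_edge greedy_star_root weight_def)
    qed
    have "e \<noteq> e'" using e(3) by (simp add: adjacent_def)
    consider y z where "y \<in> nodes d d k" "e = Some ` edge y" "z \<in> nodes d d k" "e' = Some ` edge z"
      | y where "y \<in> nodes d d k" "e = Some ` edge y" "e' = root_edge"
      | z where "z \<in> nodes d d k" "e = root_edge" "e' = Some ` edge z"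
      using e(1,2) \<open>e \<noteq> e'\<close> unfolding star_tree_eq by blast
    then show ?thesis
    proof cases
      case 1
      then have "weight y mod (d + 1) \<noteq> weight z mod (d + 1)"
        using e by (intro weight_mod_neq[of y d d k z]) (auto simp: adjacent_image_iff)
      then show ?thesis using 1 by (simp add: greedy_star_edge)
    next
      case 2 then show ?thesis using root e by blast
    next
      case 3
      then have "adjacent (Some ` edge z) root_edge" using e adjacent_commute by blast
      then show ?thesis using root[of z] 3 by metis
    qed
  qed
  ultimately show ?thesis by (simp add: list_edge_colorings_def)
qed

lemma list_edge_colorings_recolor:
  assumes \<sigma>: "\<sigma> \<in> list_edge_colorings E L" and e: "e \<in> E" "c \<in> L e"
    and free: "\<And>e'. e' \<in> E \<Longrightarrow> \<sigma> e' \<noteq> c"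
  shows "\<sigma>(e := c) \<in> list_edge_colorings E L"
proof -
  have "\<sigma>(e := c) \<in> PiE E L"
    using \<sigma> e by (auto simp: list_edge_colorings_def PiE_def extensional_def)
  moreover have "(\<sigma>(e := c)) a \<noteq> (\<sigma>(e := c)) b" if "a \<in> E" "b \<in> E" "adjacent a b" for a b
    using that \<sigma> free[of a] free[of b] by (auto simp: list_edge_colorings_def adjacent_def)
  ultimately show ?thesis by (simp add: list_edge_colorings_def)
qed

text \<open>A zero variance would make \<open>f\<close> equal to its block average, which takes one
  value on \<sigma> and \<tau>.\<close>

lemma bvar_pos:
  assumes "finite \<Omega>" "\<sigma> \<in> \<Omega>" "\<tau> \<in> \<Omega>" "\<And>e. e \<in> E - S \<Longrightarrow> \<tau> e = \<sigma> e" "f \<sigma> \<noteq> f \<tau>"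
  shows "bvar E \<Omega> S f > 0"
proof (rule ccontr)
  assume "\<not> ?thesis"
  then have "bvar E \<Omega> S f = 0" using bvar_nonneg[of E \<Omega> S f] by linarith
  then have "\<forall>\<sigma>\<in>\<Omega>. (f \<sigma> - bexp E \<Omega> S f \<sigma>)\<^sup>2 = 0"
    unfolding bvar_def using assms(1) by (subst (asm) sum_nonneg_eq_0_iff) auto
  then have "f \<sigma> = bexp E \<Omega> S f \<sigma>" "f \<tau> = bexp E \<Omega> S f \<tau>" using assms by auto
  moreover have "bexp E \<Omega> S f \<tau> = bexp E \<Omega> S f \<sigma>" by (rule bexp_eq_if_agree) (rule assms(4))
  ultimately show False using assms(5) by simp
qed

lemma bvar_eq_0:
  assumes "finite \<Omega>"
    and "\<And>\<sigma> \<tau>. \<sigma> \<in> \<Omega> \<Longrightarrow> \<tau> \<in> \<Omega> \<Longrightarrow> (\<And>e. e \<in> E - S \<Longrightarrow> \<tau> e = \<sigma> e) \<Longrightarrow> f \<tau> = f \<sigma>"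
  shows "bvar E \<Omega> S f = 0"
proof -
  have "bexp E \<Omega> S f \<sigma> = f \<sigma>" if \<sigma>: "\<sigma> \<in> \<Omega>" for \<sigma>
  proof -
    let ?C = "{\<tau> \<in> \<Omega>. restrict \<tau> (E - S) = restrict \<sigma> (E - S)}"
    have "f \<tau> = f \<sigma>" if "\<tau> \<in> ?C" for \<tau>
      using that \<sigma> by (intro assms(2)) (auto simp only: restrict_eq_iff mem_Collect_eq)
    then have "sum f ?C = real (card ?C) * f \<sigma>" by simp
    moreover have "card ?C > 0" using \<sigma> assms(1) by (auto simp: card_gt_0_iff)
    ultimately show ?thesis unfolding bexp_def cexp_def by simp
  qed
  then show ?thesis by (simp add: bvar_def)
qed

subsection \<open>The marginal on the upper levels\<close>

lemma edge_in_image_iff: "z \<noteq> [] \<Longrightarrow> edge z \<in> edge ` nodes a b k \<longleftrightarrow> z \<in> nodes a b k"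
  using edge_eq_iff[of z] nodes_nonempty[of _ a b k] by (auto simp: image_iff)

lemma nodes_iff_length: "k \<le> k' \<Longrightarrow> z \<in> nodes a b k' \<Longrightarrow> z \<in> nodes a b k \<longleftrightarrow> length z \<le> k"
  by (auto simp: nodes_def rooted_vertices_def)

lemma nodes_mono: "k \<le> k' \<Longrightarrow> nodes a b k \<subseteq> nodes a b k'"
  by (auto simp: nodes_def rooted_vertices_def)

lemma take_in_nodes:
  assumes "z \<in> nodes a b k'" "k \<ge> 1"
  shows "take k z \<in> nodes a b k"
  using assms by (auto simp: nodes_def rooted_vertices_def)

lemma restrict_in_list_edge_colorings:
  assumes "\<tau> \<in> list_edge_colorings E L" "E' \<subseteq> E"
  shows "restrict \<tau> E' \<in> list_edge_colorings E' L"
  using assms unfolding list_edge_colorings_def by (auto simp: PiE_iff subset_iff)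

lemma reg_tree_mono: "k \<le> k' \<Longrightarrow> reg_tree \<Delta> k \<subseteq> reg_tree \<Delta> k'"
  unfolding reg_tree_eq by (intro image_mono nodes_mono)

text \<open>An extension of \<open>\<rho>\<close> becomes one of \<open>\<rho>'\<close> by transposing, below each leaf edge, the colours
  which \<open>\<rho>\<close> and \<open>\<rho>'\<close> give to that edge.\<close>

lemma card_extensions_le:
  fixes \<Delta> q k l :: nat
  defines "E0 \<equiv> reg_tree \<Delta> k" and "E1 \<equiv> reg_tree \<Delta> (k + l)"
  assumes k: "k \<ge> 1"
    and \<rho>: "\<rho> \<in> list_edge_colorings E0 (\<lambda>_. {1..q})" and \<rho>': "\<rho>' \<in> list_edge_colorings E0 (\<lambda>_. {1..q})"
  shows "card {\<tau> \<in> list_edge_colorings E1 (\<lambda>_. {1..q}). restrict \<tau> E0 = \<rho>}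
    \<le> card {\<tau> \<in> list_edge_colorings E1 (\<lambda>_. {1..q}). restrict \<tau> E0 = \<rho>'}"
proof -
  let ?\<Omega> = "list_edge_colorings E1 (\<lambda>_. {1..q})"
  let ?n0 = "nodes \<Delta> (\<Delta> - 1) k" and ?n1 = "nodes \<Delta> (\<Delta> - 1) (k + l)"
  have E0: "E0 = edge ` ?n0" and E1: "E1 = edge ` ?n1"
    by (simp_all add: E0_def E1_def reg_tree_eq)
  have sub: "E0 \<subseteq> E1" unfolding E0_def E1_def by (rule reg_tree_mono) simp
  \<comment> \<open>The leaf edge of the upper tree from which \<open>e\<close> hangs, or
    \<open>e\<close> itself if it lies in the upper tree.\<close>
  define anc where "anc e = edge (take k (the_inv_into ?n1 edge e))" for e
  have anc_edge: "anc (edge z) = edge (take k z)" if "z \<in> ?n1" for z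
    unfolding anc_def by (subst the_inv_into_f_f[OF inj_on_edge that]) simp
  have anc_in: "anc e \<in> E0" if "e \<in> E1" for e
    using that take_in_nodes[OF _ k] anc_edge unfolding E0 E1 by auto
  define t where "t e = Transposition.transpose (\<rho> (anc e)) (\<rho>' (anc e))" for e
  have t_inj: "t e a = t e b \<longleftrightarrow> a = b" for e a b
    unfolding t_def by (metis transpose_involutory)
  define T where "T \<tau> = restrict (\<lambda>e. if e \<in> E0 then \<rho>' e else t e (\<tau> e)) E1" for \<tau>
  have range: "\<rho> e \<in> {1..q}" "\<rho>' e \<in> {1..q}" if "e \<in> E0" for e
    using \<rho> \<rho>' that by (auto simp: list_edge_colorings_def PiE_iff)
  have E0_iff: "edge z \<in> E0 \<longleftrightarrow> length z \<le> k" if "z \<in> ?n1" for z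
    unfolding E0 edge_in_image_iff[OF nodes_nonempty[OF that]] by (rule nodes_iff_length[OF _ that]) simp
  have "T \<tau> \<in> ?\<Omega> \<and> restrict (T \<tau>) E0 = \<rho>'" if \<tau>: "\<tau> \<in> ?\<Omega>" "restrict \<tau> E0 = \<rho>" for \<tau>
  proof
    have \<tau>_E0: "\<tau> e = \<rho> e" if "e \<in> E0" for e using \<tau>(2) that by (metis restrict_apply')
    have "T \<tau> \<in> PiE E1 (\<lambda>_. {1..q})"
    proof (rule PiE_I)
      fix e assume e: "e \<in> E1"
      have "t e c \<in> {1..q}" if "c \<in> {1..q}" for c
        using that range[OF anc_in[OF e]] unfolding t_def Transposition.transpose_def by simp
      moreover have "\<tau> e \<in> {1..q}" using \<tau>(1) e by (simp add: list_edge_colorings_def PiE_iff)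
      ultimately show "T \<tau> e \<in> {1..q}" using e range(2) unfolding T_def by simp
    qed (simp add: T_def)
    moreover have "T \<tau> e \<noteq> T \<tau> e'" if e: "e \<in> E1" "e' \<in> E1" "adjacent e e'" for e e'
    proof -
      have prp: "\<tau> e \<noteq> \<tau> e'" using \<tau>(1) e by (simp add: list_edge_colorings_def)
      obtain y z where y: "y \<in> ?n1" "e = edge y" and z: "z \<in> ?n1" "e' = edge z"
        using e(1,2) unfolding E1 by blast
      have ne: "y \<noteq> []" "z \<noteq> []" using y z nodes_nonempty by blast+
      have adj: "y \<noteq> z" "butlast y = butlast z \<or> butlast y = z \<or> y = butlast z"
        using e(3) unfolding y(2) z(2) adjacent_edge_iff[OF ne] by blast+
      \<comment> \<open>The two parts meet only where \<open>v\<close> is a child of a leaf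
        \<open>u\<close>. The transposition used at \<open>v\<close> maps the old colour of the edge
        above \<open>u\<close> to its new one, so distinct colours stay distinct.\<close>
      have mixed: "T \<tau> (edge u) \<noteq> T \<tau> (edge v)"
        if u: "u \<in> ?n1" "length u \<le> k" and v: "v \<in> ?n1" "length v > k"
          and uv: "adjacent (edge u) (edge v)" for u v
      proof -
        have ne: "u \<noteq> []" "v \<noteq> []" using u v nodes_nonempty by blast+
        have "0 < length u" using ne by simp
        then have "length (butlast u) \<noteq> length (butlast v)" "length (butlast u) \<noteq> length v"
          using u(2) v(2) unfolding length_butlast by linarith+
        then have bl: "u = butlast v" using uv unfolding adjacent_edge_iff[OF ne] by metis
        then have "length v - 1 = k" using u(2) v(2) by simp
        then have tk: "take k v = u" unfolding bl by (simp add: butlast_conv_take)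
        have "\<tau> (edge u) \<noteq> \<tau> (edge v)"
          using \<tau>(1) uv u v unfolding E1 list_edge_colorings_def by blast
        then have "\<tau> (edge v) \<noteq> \<rho> (edge u)" using \<tau>_E0[of "edge u"] E0_iff[OF u(1)] u(2) by simp
        then have "t (edge v) (\<tau> (edge v)) \<noteq> t (edge v) (\<rho> (edge u))" by (simp add: t_inj)
        moreover have "t (edge v) (\<rho> (edge u)) = \<rho>' (edge u)"
          unfolding t_def anc_edge[OF v(1)] tk by simp
        ultimately have "t (edge v) (\<tau> (edge v)) \<noteq> \<rho>' (edge u)" by simp
        moreover have "edge u \<in> E1" "edge v \<in> E1" using u v unfolding E1 by blast+
        ultimately show ?thesis
          using E0_iff[OF u(1)] E0_iff[OF v(1)] u(2) v(2) unfolding T_def by simp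
      qed
      consider "length y \<le> k" "length z \<le> k" | "length y \<le> k" "length z > k"
        | "length y > k" "length z \<le> k" | "length y > k" "length z > k" by linarith
      then show ?thesis
      proof cases
        case 1
        then have "e \<in> E0" "e' \<in> E0" using E0_iff y z by simp_all
        then show ?thesis using \<rho>' e sub unfolding T_def list_edge_colorings_def by simp
      next
        case 2 then show ?thesis using mixed y z e(3) by blast
      next
        case 3
        then have "T \<tau> (edge z) \<noteq> T \<tau> (edge y)"
          using e(3) y z adjacent_commute[of e' e] by (intro mixed) simp_all
        then show ?thesis using y z by simp
      next
        case 4
        \<comment> \<open>Adjacent edges below level \<open>k\<close> hang from the same leaf edge
          and are thus recoloured by the same transposition.\<close>
        have "take k y = take k z"
          using adj(2) 4 by (elim disjE) (metis take_butlast)+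
        then have "t e = t e'" unfolding t_def y(2) z(2) anc_edge[OF y(1)] anc_edge[OF z(1)] by simp
        then have "t e (\<tau> e) \<noteq> t e' (\<tau> e')" using prp by (simp add: t_inj)
        moreover have "e \<notin> E0" "e' \<notin> E0" using 4 E0_iff y z by simp_all
        ultimately show ?thesis using e unfolding T_def by simp
      qed
    qed
    ultimately show "T \<tau> \<in> ?\<Omega>" by (simp add: list_edge_colorings_def)
    show "restrict (T \<tau>) E0 = \<rho>'"
    proof
      fix e show "restrict (T \<tau>) E0 e = \<rho>' e"
        using \<rho>' sub by (cases "e \<in> E0")
          (auto simp: T_def list_edge_colorings_def PiE_def extensional_def)
    qed
  qed
  moreover have "inj_on T {\<tau> \<in> ?\<Omega>. restrict \<tau> E0 = \<rho>}"
  proof (rule inj_onI)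
    fix \<tau> \<upsilon> assume \<tau>: "\<tau> \<in> {\<tau> \<in> ?\<Omega>. restrict \<tau> E0 = \<rho>}" and \<upsilon>: "\<upsilon> \<in> {\<tau> \<in> ?\<Omega>. restrict \<tau> E0 = \<rho>}"
      and eq: "T \<tau> = T \<upsilon>"
    show "\<tau> = \<upsilon>"
    proof
      fix e
      consider "e \<in> E0" | "e \<in> E1" "e \<notin> E0" | "e \<notin> E1" by blast
      then show "\<tau> e = \<upsilon> e"
      proof cases
        case 1 then show ?thesis using \<tau> \<upsilon> by (metis (mono_tags, lifting) mem_Collect_eq restrict_apply')
      next
        case 2
        then have "t e (\<tau> e) = t e (\<upsilon> e)" using fun_cong[OF eq, of e] by (simp add: T_def)
        then show ?thesis by (simp add: t_inj)
      next
        case 3 then show ?thesis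
          using \<tau> \<upsilon> by (simp add: list_edge_colorings_def PiE_def extensional_def)
      qed
    qed
  qed
  moreover have "finite ?\<Omega>"
    unfolding E1_def by (intro finite_list_edge_colorings finite_reg_tree) simp
  ultimately show ?thesis by (intro card_inj_on_le[of T]) auto
qed

text \<open>Averaging over the lower levels turns \<open>f\<close> into a function \<open>g\<close>
  of the upper colouring, whose law is uniform because all fibres of the restriction have equal
  size. That \<open>g\<close> is nonnegative is recorded since the induction hypothesis covers only
  such functions.\<close>

lemma bexp_diff_marginal:
  fixes \<Delta> q k l :: nat
  defines "E0 \<equiv> reg_tree \<Delta> k" and "E1 \<equiv> reg_tree \<Delta> (k + l)"
  defines "\<Omega>0 \<equiv> list_edge_colorings E0 (\<lambda>_. {1..q})" and "\<Omega>1 \<equiv> list_edge_colorings E1 (\<lambda>_. {1..q})"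
  assumes k: "k \<ge> 1" and \<Delta>: "\<Delta> \<ge> 2" "q \<ge> \<Delta>" and f: "\<And>\<tau>. \<tau> \<in> \<Omega>1 \<Longrightarrow> 0 \<le> f \<tau>"
  shows "\<exists>g N. (\<forall>\<rho>\<in>\<Omega>0. 0 \<le> g \<rho>) \<and> N > 0 \<and> (\<forall>S\<subseteq>E0.
    (\<Sum>\<tau>\<in>\<Omega>1. (bexp E1 \<Omega>1 (E1 - E0) f \<tau> - bexp E1 \<Omega>1 ((E1 - E0) \<union> S) f \<tau>)\<^sup>2) = N * bvar E0 \<Omega>0 S g)"
proof -
  define p where "p \<tau> = restrict \<tau> E0" for \<tau> :: "nat list set \<Rightarrow> nat"
  have sub: "E0 \<subseteq> E1" unfolding E0_def E1_def by (rule reg_tree_mono) simp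
  have fin: "finite \<Omega>1" "finite \<Omega>0"
    unfolding \<Omega>1_def \<Omega>0_def E1_def E0_def
    by (intro finite_list_edge_colorings finite_reg_tree; simp)+
  have p: "p ` \<Omega>1 \<subseteq> \<Omega>0"
    unfolding p_def \<Omega>1_def \<Omega>0_def using restrict_in_list_edge_colorings[OF _ sub] by blast
  define \<tau>0 where "\<tau>0 = greedy_reg \<Delta> (k + l)"
  have \<tau>0: "\<tau>0 \<in> \<Omega>1" unfolding \<tau>0_def \<Omega>1_def E1_def by (rule greedy_reg_in[OF \<Delta>])
  define N where "N = card {\<tau> \<in> \<Omega>1. p \<tau> = p \<tau>0}"
  have card: "card {\<tau> \<in> \<Omega>1. p \<tau> = \<rho>} = N" if "\<rho> \<in> \<Omega>0" for \<rho>
  proof -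
    have p0: "p \<tau>0 \<in> \<Omega>0" using p \<tau>0 by blast
    show ?thesis unfolding N_def p_def
      using card_extensions_le[OF k, of \<rho> \<Delta> q "p \<tau>0" l] card_extensions_le[OF k, of "p \<tau>0" \<Delta> q \<rho> l] that p0
      unfolding p_def \<Omega>0_def \<Omega>1_def E0_def E1_def by (intro antisym)
  qed
  have N: "N > 0" unfolding N_def using \<tau>0 fin by (auto simp: card_gt_0_iff)
  \<comment> \<open>The average of \<open>f\<close> over all extensions of \<rho>.\<close>
  define g where "g \<rho> = (\<Sum>\<tau> | \<tau> \<in> \<Omega>1 \<and> p \<tau> = \<rho>. f \<tau>) / real N" for \<rho>
  have E1E0: "E1 - (E1 - E0) = E0" using sub by blast
  have key: "bexp E1 \<Omega>1 ((E1 - E0) \<union> S) f \<tau> = bexp E0 \<Omega>0 S g (p \<tau>)" if "S \<subseteq> E0" for S \<tau>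
  proof -
    have "E1 - ((E1 - E0) \<union> S) = E0 - S" using sub by blast
    moreover have "restrict \<upsilon> (E0 - S) = restrict (p \<upsilon>) (E0 - S)" for \<upsilon> :: "nat list set \<Rightarrow> nat"
      by (auto simp: p_def restrict_def)
    ultimately have "bexp E1 \<Omega>1 ((E1 - E0) \<union> S) f \<tau> = cexp \<Omega>1 (\<lambda>\<upsilon>. restrict (p \<upsilon>) (E0 - S)) f \<tau>"
      unfolding bexp_def by simp
    also have "\<dots> = cexp \<Omega>0 (\<lambda>\<upsilon>. restrict \<upsilon> (E0 - S)) g (p \<tau>)"
      by (rule cexp_comp_fibers[OF fin p card N g_def])
    finally show ?thesis unfolding bexp_def .
  qed
  have key0: "bexp E1 \<Omega>1 (E1 - E0) f \<tau> = g (p \<tau>)" if "\<tau> \<in> \<Omega>1" for \<tau>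
  proof -
    have "p \<tau> \<in> \<Omega>0" using p that by blast
    from card[OF this] show ?thesis
      unfolding bexp_def cexp_def E1E0 g_def p_def by simp
  qed
  show ?thesis
  proof (intro exI[of _ g] exI[of _ "real N"] conjI ballI allI impI)
    show "0 \<le> g \<rho>" if "\<rho> \<in> \<Omega>0" for \<rho>
      unfolding g_def using f by (intro divide_nonneg_nonneg sum_nonneg) auto
    show "real N > 0" using N by simp
    show "(\<Sum>\<tau>\<in>\<Omega>1. (bexp E1 \<Omega>1 (E1 - E0) f \<tau> - bexp E1 \<Omega>1 ((E1 - E0) \<union> S) f \<tau>)\<^sup>2)
        = real N * bvar E0 \<Omega>0 S g" if "S \<subseteq> E0" for S
    proof -
      have "(\<Sum>\<tau>\<in>\<Omega>1. (bexp E1 \<Omega>1 (E1 - E0) f \<tau> - bexp E1 \<Omega>1 ((E1 - E0) \<union> S) f \<tau>)\<^sup>2)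
          = (\<Sum>\<tau>\<in>\<Omega>1. (g (p \<tau>) - bexp E0 \<Omega>0 S g (p \<tau>))\<^sup>2)"
        by (intro sum.cong refl) (simp only: key0 key[OF that])
      also have "\<dots> = real N * bvar E0 \<Omega>0 S g"
        unfolding bvar_def by (rule sum_comp_fibers[OF fin p card, of "\<lambda>\<rho>. (g \<rho> - bexp E0 \<Omega>0 S g \<rho>)\<^sup>2"])
      finally show ?thesis .
    qed
  qed
qed

subsection \<open>Adding levels to the tree\<close>

definition leaves :: "nat \<Rightarrow> nat \<Rightarrow> nat \<Rightarrow> nat list set" where
  "leaves a b k = {x \<in> nodes a b k. length x = k}"

definition adjacent_pairs :: "'v set set \<Rightarrow> 'v set set set" where
  "adjacent_pairs E = {{e, e'} |e e'. e \<in> E \<and> e' \<in> E \<and> adjacent e e'}"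

lemma finite_leaves: "finite (leaves a b k)"
  by (simp add: leaves_def finite_nodes)

lemma finite_adjacent_pairs: "finite E \<Longrightarrow> finite (adjacent_pairs E)"
  by (rule finite_subset[of _ "Pow E"]) (auto simp: adjacent_pairs_def)

lemma adjacent_pairs_mono: "E \<subseteq> E' \<Longrightarrow> adjacent_pairs E \<subseteq> adjacent_pairs E'"
  unfolding adjacent_pairs_def by blast

lemma nodes_split: "k \<ge> 1 \<Longrightarrow> nodes a b k = nodes a b (k - 1) \<union> leaves a b k"
  by (auto simp: leaves_def nodes_def rooted_vertices_def)

lemma sum_nodes_split:
  fixes h :: "nat list \<Rightarrow> real"
  assumes "k \<ge> 1"
  shows "(\<Sum>z\<in>nodes a b k. h z) = (\<Sum>z\<in>nodes a b (k - 1). h z) + (\<Sum>z\<in>leaves a b k. h z)"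
  unfolding nodes_split[OF assms]
  by (rule sum.union_disjoint)
    (use assms in \<open>simp_all only: finite_nodes finite_leaves\<close>,
      auto simp: leaves_def nodes_def rooted_vertices_def)

lemma nodes_add:
  assumes "k \<ge> 1"
  shows "nodes a b (k + j) = nodes a b k \<union> (\<Union>x\<in>leaves a b k. (@) x ` nodes b b j)" (is "_ = ?r")
proof (intro equalityI subsetI)
  fix z assume z: "z \<in> nodes a b (k + j)"
  show "z \<in> ?r"
  proof (cases "length z \<le> k")
    case True
    then show ?thesis using z nodes_iff_length[of k "k + j" z a b] by simp
  next
    case False
    then have x: "take k z \<in> leaves a b k"
      using take_in_nodes[OF z assms] by (simp add: leaves_def)
    then have ne: "take k z \<noteq> []" by (auto simp: leaves_def nodes_def)
    have "take k z @ drop k z \<in> nodes a b (k + j)" using z by simp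
    then have "length z \<le> k + j" "set (drop k z) \<subseteq> {..<b}"
      using False unfolding nodes_append_iff[OF ne] by simp_all
    then have "drop k z \<in> nodes b b j"
      using False unfolding in_nodes_same by simp
    then have "take k z @ drop k z \<in> (@) (take k z) ` nodes b b j" by (rule imageI)
    then show ?thesis using x unfolding append_take_drop_id by blast
  qed
next
  fix z assume "z \<in> ?r"
  then show "z \<in> nodes a b (k + j)"
  proof
    assume "z \<in> nodes a b k" then show ?thesis using nodes_mono[of k "k + j" a b] by auto
  next
    assume "z \<in> (\<Union>x\<in>leaves a b k. (@) x ` nodes b b j)"
    then obtain x y where xy: "x \<in> leaves a b k" "y \<in> nodes b b j" "z = x @ y" by blast
    then have ne: "x \<noteq> []" by (auto simp: leaves_def nodes_def)
    have "x \<in> rooted_vertices a b (k + j)"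
      using xy(1) rooted_vertices_mono[of k "k + j" a b] by (auto simp: leaves_def nodes_def)
    then show ?thesis
      unfolding xy(3) nodes_append_iff[OF ne] using xy by (simp add: leaves_def in_nodes_same)
  qed
qed

lemma sum_nodes_add:
  fixes h :: "nat list \<Rightarrow> real"
  assumes "k \<ge> 1"
  shows "(\<Sum>z\<in>nodes a b (k + j). h z)
    = (\<Sum>z\<in>nodes a b k. h z) + (\<Sum>x\<in>leaves a b k. \<Sum>y\<in>nodes b b j. h (x @ y))"
proof -
  have len: "length z = k" if "z \<in> leaves a b k" for z using that by (simp add: leaves_def)
  have "(\<Sum>z\<in>nodes a b (k + j). h z)
      = (\<Sum>z\<in>nodes a b k. h z) + (\<Sum>z\<in>(\<Union>x\<in>leaves a b k. (@) x ` nodes b b j). h z)"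
    unfolding nodes_add[OF assms]
  proof (rule sum.union_disjoint)
    have "length z \<le> k" if "z \<in> nodes a b k" for z
      using that by (simp add: nodes_def rooted_vertices_def)
    moreover have "length z > k" if "z \<in> (\<Union>x\<in>leaves a b k. (@) x ` nodes b b j)" for z
      using that len nodes_nonempty by fastforce
    ultimately show "nodes a b k \<inter> (\<Union>x\<in>leaves a b k. (@) x ` nodes b b j) = {}"
      by (metis (no_types, lifting) disjoint_iff not_less)
  qed (simp_all add: finite_nodes finite_leaves)
  also have "(\<Sum>z\<in>(\<Union>x\<in>leaves a b k. (@) x ` nodes b b j). h z)
      = (\<Sum>x\<in>leaves a b k. \<Sum>z\<in>(@) x ` nodes b b j. h z)"
  proof (rule sum.UNION_disjoint)
    show "\<forall>x\<in>leaves a b k. \<forall>x'\<in>leaves a b k. x \<noteq> x' \<longrightarrow> (@) x ` nodes b b j \<inter> (@) x' ` nodes b b j = {}"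
      using len by auto
  qed (simp_all add: finite_nodes finite_leaves)
  also have "\<dots> = (\<Sum>x\<in>leaves a b k. \<Sum>y\<in>nodes b b j. h (x @ y))"
    by (rule sum.cong[OF refl], subst sum.reindex) (simp_all add: inj_on_def)
  finally show ?thesis .
qed

text \<open>The asymmetry is deliberate: \<open>y = []\<close> is allowed, so the edge above
  \<open>x\<close> may be included, but \<open>y'\<close> must be nonempty, because the edges above
  \<open>x\<close> and \<open>x'\<close> can be adjacent siblings.\<close>

lemma grafts_separated:
  assumes "x \<noteq> x'" "length x = length x'" "x \<noteq> []" "y' \<noteq> []"
  shows "\<not> adjacent (edge (x @ y)) (edge (x' @ y'))" and "edge (x @ y) \<noteq> edge (x' @ y')"
proof -
  have ne: "x @ y \<noteq> []" "x' @ y' \<noteq> []" using assms by auto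
  have app: "x @ u \<noteq> x' @ v" for u v using assms by simp
  have pre: "butlast x \<noteq> x' @ v" for v
  proof
    assume "butlast x = x' @ v"
    then have "length x - 1 = length x' + length v" by (metis length_append length_butlast)
    moreover have "length x > 0" using assms(3) by simp
    ultimately show False using assms(2) by linarith
  qed
  have bl: "butlast (x' @ y') = x' @ butlast y'" using assms by (simp add: butlast_append)
  have "butlast (x @ y) \<noteq> x' @ v" for v
    using app pre by (cases "y = []") (simp_all add: butlast_append)
  then show "\<not> adjacent (edge (x @ y)) (edge (x' @ y'))"
    unfolding adjacent_edge_iff[OF ne] bl using app by simp
  show "edge (x @ y) \<noteq> edge (x' @ y')" unfolding edge_eq_iff[OF ne] by (rule app)
qed

lemma not_adjacent_if_length:
  assumes "w \<noteq> []" "length z > length w + 1"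
  shows "\<not> adjacent (edge w) (edge z)"
proof -
  have ne: "z \<noteq> []" using assms by auto
  have "length (butlast w) \<noteq> length (butlast z)" "length (butlast w) \<noteq> length z" "length w \<noteq> length (butlast z)"
    using assms by auto
  then show ?thesis unfolding adjacent_edge_iff[OF assms(1) ne] by metis
qed

text \<open>The hypotheses on \<open>mu_star1\<close> and \<open>mu_star\<close> are restated
  without dividing by the number of colourings. \<open>A\<close> stands for the maximum of the
  \<alpha>, of which only the listed bounds matter.\<close>

locale tree_recursion =
  fixes \<Delta> q d l :: nat and \<alpha> :: "nat \<Rightarrow> real" and \<beta> \<gamma> A :: real
  assumes \<Delta>: "\<Delta> \<ge> 2" and q: "q \<ge> \<Delta> + 1" and d: "d = \<Delta> - 1" and l: "l \<ge> 2"
    and \<gamma>: "\<gamma> \<ge> 0" and A: "A \<ge> 0" "\<And>i. i \<le> l \<Longrightarrow> \<alpha> i \<le> A"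
    and AT: "\<And>g. (\<And>\<rho>. \<rho> \<in> list_edge_colorings (star_tree d l) (\<lambda>e. if e = root_edge then {1} else {1..q})
        \<Longrightarrow> 0 \<le> g \<rho>) \<Longrightarrow>
      bvar (star_tree d l) (list_edge_colorings (star_tree d l) (\<lambda>e. if e = root_edge then {1} else {1..q}))
        (star_tree d l) g
      \<le> \<gamma> * (\<Sum>e\<in>star_tree d l. bvar (star_tree d l)
          (list_edge_colorings (star_tree d l) (\<lambda>e. if e = root_edge then {1} else {1..q})) {e} g)"
    and RV: "\<And>g. (\<And>\<rho>. \<rho> \<in> list_edge_colorings (star_tree d l)
          (\<lambda>e. if e = root_edge then {1..q - d} else {1..q}) \<Longrightarrow> 0 \<le> g \<rho>) \<Longrightarrow>
      (\<Sum>\<rho>\<in>list_edge_colorings (star_tree d l) (\<lambda>e. if e = root_edge then {1..q - d} else {1..q}).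
        (bexp (star_tree d l) (list_edge_colorings (star_tree d l)
            (\<lambda>e. if e = root_edge then {1..q - d} else {1..q})) (star_tree d l - {root_edge}) g \<rho>
          - bexp (star_tree d l) (list_edge_colorings (star_tree d l)
            (\<lambda>e. if e = root_edge then {1..q - d} else {1..q})) (star_tree d l) g \<rho>)\<^sup>2)
      \<le> (\<Sum>i=0..l. \<alpha> i * (\<Sum>e\<in>star_level d l i. bvar (star_tree d l) (list_edge_colorings (star_tree d l)
            (\<lambda>e. if e = root_edge then {1..q - d} else {1..q})) {e} g))
        + \<beta> * (\<Sum>e\<in>star_level d l 1. bvar (star_tree d l) (list_edge_colorings (star_tree d l)
            (\<lambda>e. if e = root_edge then {1..q - d} else {1..q})) {e, root_edge} g)"
begin

abbreviation "colorings k \<equiv> list_edge_colorings (reg_tree \<Delta> k) (\<lambda>_. {1..q})"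
abbreviation "V k \<equiv> bvar (reg_tree \<Delta> k) (colorings k)"
abbreviation "P k \<equiv> bexp (reg_tree \<Delta> k) (colorings k)"
abbreviation "vs k \<equiv> nodes \<Delta> d k"
abbreviation "lvs k \<equiv> leaves \<Delta> d k"
abbreviation "below x \<equiv> edge ` (@) x ` nodes d d l"

text \<open>The pairs stay above the leaf level, so that they commute with averaging over the levels
  that are added next.\<close>

definition "leaf_bound k a b c \<longleftrightarrow> (\<forall>f. (\<forall>\<tau>\<in>colorings k. 0 \<le> f \<tau>) \<longrightarrow>
  V k (reg_tree \<Delta> k) f \<le> \<gamma> * (a * (\<Sum>y\<in>vs (k - 1). V k {edge y} f) + b * (\<Sum>x\<in>lvs k. V k {edge x} f)
    + c * (\<Sum>p\<in>adjacent_pairs (reg_tree \<Delta> (k - 1)). V k p f)))"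

lemma tree_eq: "reg_tree \<Delta> k = edge ` vs k"
  by (simp add: reg_tree_eq d)

lemma finite_colorings: "finite (colorings k)"
  by (intro finite_list_edge_colorings finite_reg_tree) simp

lemma grafted: "k \<ge> 1 \<Longrightarrow> x \<in> lvs k \<Longrightarrow> grafted_tree \<Delta> q d k x"
  using \<Delta> q d by unfold_locales (auto simp: leaves_def nodes_def)

lemma lower_part: "k \<ge> 1 \<Longrightarrow> reg_tree \<Delta> (k + l) - reg_tree \<Delta> k = (\<Union>x\<in>lvs k. below x)"
proof -
  assume k: "k \<ge> 1"
  have "edge z \<notin> edge ` vs k" if z: "z \<in> (\<Union>x\<in>lvs k. (@) x ` nodes d d l)" for z
  proof -
    obtain x y where xy: "x \<in> lvs k" "y \<in> nodes d d l" "z = x @ y" using z by blast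
    have y: "y \<noteq> []" using xy nodes_nonempty by blast
    then have "length z > k" using xy by (simp add: leaves_def)
    then have "z \<notin> vs k" by (simp add: nodes_def rooted_vertices_def)
    moreover have "z \<noteq> []" using xy y by simp
    ultimately show ?thesis by (simp add: edge_in_image_iff)
  qed
  then show ?thesis unfolding tree_eq nodes_add[OF k, of \<Delta> d l] image_Un image_UN by blast
qed

text \<open>All levels but the last are bounded crudely by \<open>A\<close>. The last keeps its own
  constant \<open>\<alpha> l\<close>, since it forms the next leaf level and its coefficient is the
  one that is iterated.\<close>

lemma level_sum_le:
  assumes k: "k \<ge> 1" and x: "x \<in> lvs k"
  shows "(\<Sum>i=0..l. \<alpha> i * (\<Sum>e\<in>star_level d l i. V (k + l) {graft x ` e} f))
    \<le> A * V (k + l) {edge x} f + A * (\<Sum>y\<in>nodes d d (l - 1). V (k + l) {edge (x @ y)} f)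
      + \<alpha> l * (\<Sum>y\<in>leaves d d l. V (k + l) {edge (x @ y)} f)"
proof -
  let ?v = "\<lambda>z. V (k + l) {edge z} f"
  let ?L = "\<lambda>i. \<Sum>e\<in>star_level d l i. V (k + l) {graft x ` e} f"
  have lev: "?L i = (\<Sum>y\<in>{y \<in> nodes d d l. length y = i}. ?v (x @ y))" if "i \<ge> 1" for i
    unfolding star_level_eq[OF that]
    by (subst sum.reindex[OF inj_on_subset[OF inj_on_Some_edge]])
      (auto simp: graft_Some_edge nodes_nonempty simp del: image_insert intro!: sum.cong)
  have "{0..l} = insert 0 (insert l {1..l - 1})" using l by auto
  then have "(\<Sum>i=0..l. \<alpha> i * ?L i) = \<alpha> 0 * ?L 0 + (\<alpha> l * ?L l + (\<Sum>i=1..l - 1. \<alpha> i * ?L i))"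
    using l by simp
  moreover have "\<alpha> 0 * ?L 0 \<le> A * ?v x"
    using A(2)[of 0] by (simp add: star_level_0 graft_root mult_right_mono bvar_nonneg)
  moreover have "?L l = (\<Sum>y\<in>leaves d d l. ?v (x @ y))"
    using l by (subst lev) (simp_all add: leaves_def)
  moreover have "(\<Sum>i=1..l - 1. \<alpha> i * ?L i) \<le> A * (\<Sum>y\<in>nodes d d (l - 1). ?v (x @ y))"
  proof -
    have "(\<Sum>i=1..l - 1. \<alpha> i * ?L i) \<le> (\<Sum>i=1..l - 1. A * ?L i)"
      using A(2) by (intro sum_mono mult_right_mono sum_nonneg bvar_nonneg) auto
    also have "\<dots> = A * (\<Sum>i=1..l - 1. \<Sum>y\<in>{y \<in> nodes d d (l - 1). length y = i}. ?v (x @ y))"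
    proof -
      have "?L i = (\<Sum>y\<in>{y \<in> nodes d d (l - 1). length y = i}. ?v (x @ y))" if "i \<in> {1..l - 1}" for i
      proof -
        have "{y \<in> nodes d d l. length y = i} = {y \<in> nodes d d (l - 1). length y = i}"
          using that by (auto simp: in_nodes_same)
        then show ?thesis using that lev by simp
      qed
      then show ?thesis by (simp add: sum_distrib_left)
    qed
    also have "(\<Sum>i=1..l - 1. \<Sum>y\<in>{y \<in> nodes d d (l - 1). length y = i}. ?v (x @ y))
        = (\<Sum>y\<in>nodes d d (l - 1). ?v (x @ y))"
      by (rule sum.group) (auto simp: finite_nodes in_nodes_same Suc_le_eq)
    finally show ?thesis .
  qed
  ultimately show ?thesis by simp
qed

text \<open>Each new pair contains an edge at level \<open>k\<close>, which no old pair does, so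
  nothing is counted twice.\<close>

lemma pair_sum_le:
  assumes k: "k \<ge> 1"
  shows "(\<Sum>p\<in>adjacent_pairs (reg_tree \<Delta> (k - 1)). V (k + l) p f)
      + (\<Sum>x\<in>lvs k. \<Sum>e\<in>star_level d l 1. V (k + l) {graft x ` e, edge x} f)
    \<le> (\<Sum>p\<in>adjacent_pairs (reg_tree \<Delta> (k + l - 1)). V (k + l) p f)"
proof -
  let ?Y = "{y \<in> nodes d d l. length y = 1}"
  let ?F = "\<lambda>(x, y). {edge (x @ y), edge x}"
  have xD: "length x = k" "x \<noteq> []" "x \<in> vs k" if "x \<in> lvs k" for x
    using that nodes_nonempty by (auto simp: leaves_def)
  have "(\<Sum>e\<in>star_level d l 1. V (k + l) {graft x ` e, edge x} f)
      = (\<Sum>y\<in>?Y. V (k + l) {edge (x @ y), edge x} f)" for x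
    unfolding star_level_eq[OF order.refl]
    by (subst sum.reindex[OF inj_on_subset[OF inj_on_Some_edge]])
      (auto simp: graft_Some_edge nodes_nonempty simp del: image_insert intro!: sum.cong)
  then have "(\<Sum>x\<in>lvs k. \<Sum>e\<in>star_level d l 1. V (k + l) {graft x ` e, edge x} f)
      = (\<Sum>p\<in>lvs k \<times> ?Y. V (k + l) (?F p) f)"
    by (simp add: sum.cartesian_product case_prod_unfold)
  also have "\<dots> = (\<Sum>p\<in>?F ` (lvs k \<times> ?Y). V (k + l) p f)"
  proof (rule sum.reindex[symmetric, unfolded comp_def], rule inj_onI)
    fix p p' assume p: "p \<in> lvs k \<times> ?Y" and p': "p' \<in> lvs k \<times> ?Y" and eq: "?F p = ?F p'"
    obtain x y x' y' where xy: "p = (x, y)" "p' = (x', y')" by (cases p, cases p')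
    have D: "x \<in> lvs k" "x' \<in> lvs k" "length y = 1" "length y' = 1" using p p' xy by auto
    have ne: "x \<noteq> []" "x' \<noteq> []" "x @ y \<noteq> []" "x' @ y' \<noteq> []" using D xD by auto
    have "x \<noteq> x' @ y'" using D xD by (metis add_cancel_right_right length_append one_neq_zero)
    then have "edge x \<noteq> edge (x' @ y')" using ne by (simp add: edge_eq_iff)
    then have "edge x = edge x'" "edge (x @ y) = edge (x' @ y')"
      using eq unfolding xy by (auto simp: doubleton_eq_iff)
    then have "x = x'" "x @ y = x' @ y'"
      using edge_eq_iff[OF ne(1,2)] edge_eq_iff[OF ne(3,4)] by blast+
    then show "p = p'" using xy by simp
  qed
  finally have "(\<Sum>p\<in>adjacent_pairs (reg_tree \<Delta> (k - 1)). V (k + l) p f)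
      + (\<Sum>x\<in>lvs k. \<Sum>e\<in>star_level d l 1. V (k + l) {graft x ` e, edge x} f)
      = (\<Sum>p\<in>adjacent_pairs (reg_tree \<Delta> (k - 1)) \<union> ?F ` (lvs k \<times> ?Y). V (k + l) p f)"
  proof (simp only:, intro sum.union_disjoint[symmetric])
    show "finite (adjacent_pairs (reg_tree \<Delta> (k - 1)))"
      by (intro finite_adjacent_pairs finite_reg_tree)
    show "finite (?F ` (lvs k \<times> ?Y))" by (simp add: finite_leaves finite_nodes)
    have "edge x \<notin> reg_tree \<Delta> (k - 1)" if "x \<in> lvs k" for x
    proof -
      have "x \<notin> vs (k - 1)" using xD[OF that] k by (auto simp: nodes_def rooted_vertices_def)
      then show ?thesis using xD[OF that] by (simp add: tree_eq edge_in_image_iff)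
    qed
    moreover have "p \<subseteq> reg_tree \<Delta> (k - 1)" if "p \<in> adjacent_pairs (reg_tree \<Delta> (k - 1))" for p
      using that by (auto simp: adjacent_pairs_def)
    ultimately show "adjacent_pairs (reg_tree \<Delta> (k - 1)) \<inter> ?F ` (lvs k \<times> ?Y) = {}"
      by fastforce
  qed
  also have "\<dots> \<le> (\<Sum>p\<in>adjacent_pairs (reg_tree \<Delta> (k + l - 1)). V (k + l) p f)"
  proof (rule sum_mono2)
    show "finite (adjacent_pairs (reg_tree \<Delta> (k + l - 1)))"
      by (intro finite_adjacent_pairs finite_reg_tree)
    have "adjacent_pairs (reg_tree \<Delta> (k - 1)) \<subseteq> adjacent_pairs (reg_tree \<Delta> (k + l - 1))"
      by (intro adjacent_pairs_mono reg_tree_mono) simp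
    moreover have "?F p \<in> adjacent_pairs (reg_tree \<Delta> (k + l - 1))" if "p \<in> lvs k \<times> ?Y" for p
    proof -
      obtain x y where xy: "p = (x, y)" "x \<in> lvs k" "y \<in> nodes d d l" "length y = 1" using \<open>p \<in> lvs k \<times> ?Y\<close> by auto
      \<comment> \<open>By \<open>l \<ge> 2\<close> the edges at level \<open>k + 1\<close> are
        still above the new leaf level, so the new pairs may enter the sum kept by
        \<open>leaf_bound\<close>.\<close>
      then have y: "y \<in> nodes d d (l - 1)" using l by (simp add: in_nodes_same)
      have "x \<in> vs (k + (l - 1))" "x @ y \<in> vs (k + (l - 1))"
        unfolding nodes_add[OF k, of \<Delta> d "l - 1"] using xy xD[OF xy(2)] y by blast+
      then have "edge (x @ y) \<in> reg_tree \<Delta> (k + l - 1)" "edge x \<in> reg_tree \<Delta> (k + l - 1)"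
        using l unfolding tree_eq by simp_all
      moreover have "adjacent (edge (x @ y)) (edge x)"
      proof -
        obtain c where "y = [c]" using xy(4) by (cases y) auto
        then show ?thesis using xD[OF xy(2)] by (subst adjacent_edge_iff) simp_all
      qed
      ultimately show ?thesis unfolding xy(1) adjacent_pairs_def by blast
    qed
    ultimately show "adjacent_pairs (reg_tree \<Delta> (k - 1)) \<union> ?F ` (lvs k \<times> ?Y)
        \<subseteq> adjacent_pairs (reg_tree \<Delta> (k + l - 1))" by blast
  qed (rule bvar_nonneg)
  finally show ?thesis .
qed

text \<open>Trees below different leaves contain no common or adjacent edges. Their variances
  therefore add up, and tensorizing each tree costs \<gamma> only once.\<close>

lemma var_below_le:
  assumes k: "k \<ge> 1" and f: "\<And>\<tau>. \<tau> \<in> colorings (k + l) \<Longrightarrow> 0 \<le> f \<tau>"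
  shows "V (k + l) (reg_tree \<Delta> (k + l) - reg_tree \<Delta> k) f
    \<le> \<gamma> * (\<Sum>x\<in>lvs k. \<Sum>y\<in>nodes d d l. V (k + l) {edge (x @ y)} f)"
proof -
  have sep: "\<not> adjacent s t" "s \<noteq> t"
    if x: "x \<in> lvs k" "x' \<in> lvs k" "x \<noteq> x'" and st: "s \<in> below x" "t \<in> below x'" for x x' s t
  proof -
    obtain y y' where y: "s = edge (x @ y)" "t = edge (x' @ y')" "y' \<in> nodes d d l" using st by blast
    have "length x = length x'" "x \<noteq> []" using x nodes_nonempty by (auto simp: leaves_def)
    then show "\<not> adjacent s t" "s \<noteq> t"
      using grafts_separated[OF x(3) _ _ nodes_nonempty[OF y(3)], of y] unfolding y(1,2) by blast+
  qed
  have "V (k + l) (reg_tree \<Delta> (k + l) - reg_tree \<Delta> k) f \<le> (\<Sum>x\<in>lvs k. V (k + l) (below x) f)"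
    unfolding lower_part[OF k]
  proof (rule bvar_UN_le[OF refl finite_colorings finite_leaves])
    show "below x \<inter> below x' = {}" if "x \<in> lvs k" "x' \<in> lvs k" "x \<noteq> x'" for x x'
      by (rule equals0I, erule IntE) (use sep(2)[OF that] in blast)
  qed (rule sep(1))
  also have "\<dots> \<le> (\<Sum>x\<in>lvs k. \<gamma> * (\<Sum>y\<in>nodes d d l. V (k + l) {edge (x @ y)} f))"
    by (intro sum_mono grafted_tree.bvar_below_le[OF grafted[OF k]] AT f)
  finally show ?thesis by (simp add: sum_distrib_left)
qed

text \<open>The trees below the other leaves are separated from \<open>x\<close>, its edge and its
  tree. Averaging over them factors out of both projections and disappears by contraction, which
  leaves the local quantity controlled by the root variance inequality.\<close>

lemma leaf_contribution_le:
  assumes k: "k \<ge> 1" and x: "x \<in> lvs k" and f: "\<And>\<tau>. \<tau> \<in> colorings (k + l) \<Longrightarrow> 0 \<le> f \<tau>"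
  defines "B \<equiv> reg_tree \<Delta> (k + l) - reg_tree \<Delta> k"
  shows "(\<Sum>\<tau>\<in>colorings (k + l). (P (k + l) B f \<tau> - P (k + l) (B \<union> {edge x}) f \<tau>)\<^sup>2)
    \<le> (\<Sum>i=0..l. \<alpha> i * (\<Sum>e\<in>star_level d l i. V (k + l) {graft x ` e} f))
      + \<beta> * (\<Sum>e\<in>star_level d l 1. V (k + l) {graft x ` e, edge x} f)"
proof -
  define B' where "B' = (\<Union>x'\<in>lvs k - {x}. below x')"
  have xD: "length x = k" "x \<noteq> []" using x nodes_nonempty by (auto simp: leaves_def)
  have "B = B' \<union> below x" unfolding B_def B'_def lower_part[OF k] using x by blast
  then have B: "B = B' \<union> below x" "B \<union> {edge x} = B' \<union> insert (edge x) (below x)" by auto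
  have sep: "\<not> adjacent s t" "s \<noteq> t" if s: "s \<in> B'" and t: "t \<in> insert (edge x) (below x)" for s t
  proof -
    obtain x' y' where x': "x' \<in> lvs k" "x' \<noteq> x" "y' \<in> nodes d d l" "s = edge (x' @ y')"
      using s unfolding B'_def by blast
    obtain y where y: "t = edge (x @ y)" using t append_Nil2[of x] by (metis imageE insertE)
    have "length x = length x'" using x' xD by (simp add: leaves_def)
    then have "\<not> adjacent t s" "t \<noteq> s"
      using grafts_separated[OF not_sym[OF x'(2)] _ xD(2) nodes_nonempty[OF x'(3)], of y]
      unfolding y x'(4) by blast+
    then show "\<not> adjacent s t" "s \<noteq> t" using adjacent_commute by blast+
  qed
  have P: "P (k + l) (B' \<union> T) f \<tau> = P (k + l) B' (P (k + l) T f) \<tau>"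
    if "T \<subseteq> insert (edge x) (below x)" "\<tau> \<in> colorings (k + l)" for T \<tau>
  proof (rule bexp_Un_nonadjacent[OF refl _ _ that(2)])
    show "B' \<inter> T = {}"
    proof (rule equals0I, erule IntE)
      fix s assume "s \<in> B'" "s \<in> T"
      then show False using sep(2)[of s s] that(1) by blast
    qed
    show "\<not> adjacent s t" if "s \<in> B'" "t \<in> T" for s t
      by (rule sep(1)[OF that(1) subsetD[OF \<open>T \<subseteq> insert (edge x) (below x)\<close> that(2)]])
  qed
  have "(\<Sum>\<tau>\<in>colorings (k + l). (P (k + l) B f \<tau> - P (k + l) (B \<union> {edge x}) f \<tau>)\<^sup>2)
      = (\<Sum>\<tau>\<in>colorings (k + l). (P (k + l) B' (P (k + l) (below x) f) \<tau>
          - P (k + l) B' (P (k + l) (insert (edge x) (below x)) f) \<tau>)\<^sup>2)"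
    unfolding B(2) unfolding B(1)
    using P[OF subset_insertI] P[OF order.refl] by (intro sum.cong refl) simp
  also have "\<dots> \<le> (\<Sum>\<tau>\<in>colorings (k + l). (P (k + l) (below x) f \<tau>
      - P (k + l) (insert (edge x) (below x)) f \<tau>)\<^sup>2)"
    by (rule bexp_contraction[OF finite_colorings])
  also have "\<dots> \<le> (\<Sum>i=0..l. \<alpha> i * (\<Sum>e\<in>star_level d l i. V (k + l) {graft x ` e} f))
      + \<beta> * (\<Sum>e\<in>star_level d l 1. V (k + l) {graft x ` e, edge x} f)"
    by (rule grafted_tree.root_variance_below_le[OF grafted[OF k x]]) (use RV f in blast)+
  finally show ?thesis .
qed

text \<open>The depths of edges of \<open>S\<close> and of \<open>B\<close> differ by at least 2, so
  the two averages commute and the projected function has no larger local variance than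
  \<open>f\<close>.\<close>

lemma upper_contribution_le:
  assumes k: "k \<ge> 1" and S: "S \<subseteq> reg_tree \<Delta> (k - 1)"
  defines "B \<equiv> reg_tree \<Delta> (k + l) - reg_tree \<Delta> k"
  shows "(\<Sum>\<tau>\<in>colorings (k + l). (P (k + l) B f \<tau> - P (k + l) (B \<union> S) f \<tau>)\<^sup>2) \<le> V (k + l) S f"
proof (rule bexp_Un_diff_le_bvar[OF refl finite_colorings])
  show "B \<inter> S = {}" using S reg_tree_mono[of "k - 1" k \<Delta>] unfolding B_def by auto
  show "\<not> adjacent s t" if s: "s \<in> B" and t: "t \<in> S" for s t
  proof -
    obtain w where w: "w \<in> vs (k - 1)" "t = edge w" using t S unfolding tree_eq by blast
    obtain x y where xy: "x \<in> lvs k" "y \<in> nodes d d l" "s = edge (x @ y)"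
      using s unfolding B_def lower_part[OF k] by blast
    have "length w + 1 \<le> k" using w(1) k by (auto simp: nodes_def rooted_vertices_def)
    moreover have "length y > 0" using nodes_nonempty[OF xy(2)] by simp
    moreover have "length x = k" using xy(1) by (simp add: leaves_def)
    ultimately have "length (x @ y) > length w + 1" unfolding length_append by linarith
    then have "\<not> adjacent t s" unfolding w(2) xy(3) by (rule not_adjacent_if_length[OF nodes_nonempty[OF w(1)]])
    then show ?thesis using adjacent_commute by blast
  qed
qed

text \<open>Only bookkeeping is left here. Old leaf edges become interior, the last new level
  becomes the leaf level, and each old leaf edge forms pairs with its children; the hypotheses on
  \<open>a'\<close> and \<open>c'\<close> say that the new coefficients cover these
  contributions.\<close>

lemma leaf_bound_step:
  assumes k: "k \<ge> 1" and IH: "leaf_bound k a b c" and abc: "a \<ge> 0" "b \<ge> 0" "c \<ge> 0"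
    and a': "a \<le> a'" "1 + A * b \<le> a'" and c': "c \<le> c'" "\<beta> * b \<le> c'"
  shows "leaf_bound (k + l) a' (1 + \<alpha> l * b) c'"
  unfolding leaf_bound_def
proof (intro allI impI)
  fix f :: "(nat list set \<Rightarrow> nat) \<Rightarrow> real"
  assume "\<forall>\<tau>\<in>colorings (k + l). 0 \<le> f \<tau>"
  then have f: "\<And>\<tau>. \<tau> \<in> colorings (k + l) \<Longrightarrow> 0 \<le> f \<tau>" by blast
  let ?E = "reg_tree \<Delta> (k + l)"
  define B where "B = ?E - reg_tree \<Delta> k"
  \<comment> \<open>The block variance on \<open>S\<close> of \<open>f\<close> after averaging over
    the lower part. For \<open>S\<close> in the upper tree it is \<open>N\<close> times the
    corresponding variance of \<open>g\<close>, so the induction hypothesis becomes a statement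
    about \<open>D\<close>.\<close>
  define D where "D S = (\<Sum>\<tau>\<in>colorings (k + l). (P (k + l) B f \<tau> - P (k + l) (B \<union> S) f \<tau>)\<^sup>2)" for S
  have "\<Delta> \<le> q" using q by simp
  obtain g N where g: "\<forall>\<rho>\<in>colorings k. 0 \<le> g \<rho>" and N: "N > 0"
    and N_eq: "\<forall>S\<subseteq>reg_tree \<Delta> k. (\<Sum>\<tau>\<in>colorings (k + l).
      (P (k + l) (?E - reg_tree \<Delta> k) f \<tau> - P (k + l) ((?E - reg_tree \<Delta> k) \<union> S) f \<tau>)\<^sup>2) = N * V k S g"
    using bexp_diff_marginal[where f = f and l = l, OF k \<Delta> \<open>\<Delta> \<le> q\<close> f] by blast
  have DN: "D S = N * V k S g" if "S \<subseteq> reg_tree \<Delta> k" for S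
    unfolding D_def B_def using N_eq that by blast
  define v where "v z = V (k + l) {edge z} f" for z
  define SL where "SL = (\<Sum>z\<in>vs (k - 1). v z)"
  define SX where "SX = (\<Sum>x\<in>lvs k. v x)"
  define SM where "SM = (\<Sum>x\<in>lvs k. \<Sum>y\<in>nodes d d (l - 1). v (x @ y))"
  define SF where "SF = (\<Sum>x\<in>lvs k. \<Sum>y\<in>leaves d d l. v (x @ y))"
  define PL where "PL = (\<Sum>p\<in>adjacent_pairs (reg_tree \<Delta> (k - 1)). V (k + l) p f)"
  define PX where "PX = (\<Sum>x\<in>lvs k. \<Sum>e\<in>star_level d l 1. V (k + l) {graft x ` e, edge x} f)"
  define PA where "PA = (\<Sum>p\<in>adjacent_pairs (reg_tree \<Delta> (k + l - 1)). V (k + l) p f)"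
  have nonneg: "SL \<ge> 0" "SX \<ge> 0" "SM \<ge> 0" "SF \<ge> 0" "PL \<ge> 0" "PX \<ge> 0"
    unfolding SL_def SX_def SM_def SF_def PL_def PX_def v_def by (intro sum_nonneg bvar_nonneg)+
  have PA: "PL + PX \<le> PA" unfolding PL_def PX_def PA_def by (rule pair_sum_le[OF k])
  have inner: "(\<Sum>y\<in>nodes d d l. v (x @ y)) = (\<Sum>y\<in>nodes d d (l - 1). v (x @ y)) + (\<Sum>y\<in>leaves d d l. v (x @ y))" for x
    using l by (intro sum_nodes_split) simp
  have all: "(\<Sum>z\<in>vs (k + l - 1). v z) = SL + SX + SM"
  proof -
    have "k + l - 1 = k + (l - 1)" using l by simp
    then show ?thesis
      unfolding SL_def SX_def SM_def by (simp only: sum_nodes_add[OF k] sum_nodes_split[OF k])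
  qed
  have leaf: "(\<Sum>z\<in>lvs (k + l). v z) = SF"
  proof -
    have "(\<Sum>z\<in>vs (k + l). v z) = SL + SX + (SM + SF)"
      unfolding sum_nodes_add[OF k] sum_nodes_split[OF k, of v \<Delta> d] inner sum.distrib SL_def SX_def SM_def SF_def ..
    moreover have "(\<Sum>z\<in>vs (k + l). v z) = (\<Sum>z\<in>vs (k + l - 1). v z) + (\<Sum>z\<in>lvs (k + l). v z)"
      using k by (intro sum_nodes_split) simp
    ultimately show ?thesis using all by simp
  qed
  have "V k (reg_tree \<Delta> k) g \<le> \<gamma> * (a * (\<Sum>y\<in>vs (k - 1). V k {edge y} g) + b * (\<Sum>x\<in>lvs k. V k {edge x} g)
      + c * (\<Sum>p\<in>adjacent_pairs (reg_tree \<Delta> (k - 1)). V k p g))"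
    using IH g unfolding leaf_bound_def by blast
  then have "N * V k (reg_tree \<Delta> k) g \<le> N * (\<gamma> * (a * (\<Sum>y\<in>vs (k - 1). V k {edge y} g)
      + b * (\<Sum>x\<in>lvs k. V k {edge x} g) + c * (\<Sum>p\<in>adjacent_pairs (reg_tree \<Delta> (k - 1)). V k p g)))"
    using N by (intro mult_left_mono) auto
  also have "\<dots> = \<gamma> * (a * (\<Sum>y\<in>vs (k - 1). N * V k {edge y} g)
      + b * (\<Sum>x\<in>lvs k. N * V k {edge x} g) + c * (\<Sum>p\<in>adjacent_pairs (reg_tree \<Delta> (k - 1)). N * V k p g))"
    by (simp add: sum_distrib_left[symmetric] algebra_simps)
  also have "(\<Sum>y\<in>vs (k - 1). N * V k {edge y} g) = (\<Sum>y\<in>vs (k - 1). D {edge y})"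
    using nodes_mono[of "k - 1" k \<Delta> d] by (intro sum.cong refl DN[symmetric]) (auto simp: tree_eq)
  also have "(\<Sum>x\<in>lvs k. N * V k {edge x} g) = (\<Sum>x\<in>lvs k. D {edge x})"
    by (intro sum.cong refl DN[symmetric]) (auto simp: tree_eq leaves_def)
  also have "(\<Sum>p\<in>adjacent_pairs (reg_tree \<Delta> (k - 1)). N * V k p g) = (\<Sum>p\<in>adjacent_pairs (reg_tree \<Delta> (k - 1)). D p)"
    using reg_tree_mono[of "k - 1" k \<Delta>]
    by (intro sum.cong refl DN[symmetric]) (auto simp: adjacent_pairs_def)
  also have "N * V k (reg_tree \<Delta> k) g = D (reg_tree \<Delta> k)" by (rule DN[symmetric]) simp
  finally have "D (reg_tree \<Delta> k) \<le> \<gamma> * (a * (\<Sum>y\<in>vs (k - 1). D {edge y})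
      + b * (\<Sum>x\<in>lvs k. D {edge x}) + c * (\<Sum>p\<in>adjacent_pairs (reg_tree \<Delta> (k - 1)). D p))" .
  also have "\<dots> \<le> \<gamma> * (a * SL + b * (A * SX + A * SM + \<alpha> l * SF + \<beta> * PX) + c * PL)"
  proof (intro mult_left_mono[OF _ \<gamma>] add_mono mult_left_mono[OF _ abc(1)] mult_left_mono[OF _ abc(2)]
        mult_left_mono[OF _ abc(3)])
    show "(\<Sum>y\<in>vs (k - 1). D {edge y}) \<le> SL"
      unfolding SL_def v_def D_def B_def
      by (intro sum_mono upper_contribution_le[OF k]) (simp add: tree_eq)
    show "(\<Sum>p\<in>adjacent_pairs (reg_tree \<Delta> (k - 1)). D p) \<le> PL"
      unfolding PL_def D_def B_def
      by (intro sum_mono upper_contribution_le[OF k]) (auto simp: adjacent_pairs_def)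
    have "(\<Sum>x\<in>lvs k. D {edge x}) \<le> (\<Sum>x\<in>lvs k. A * v x + A * (\<Sum>y\<in>nodes d d (l - 1). v (x @ y))
        + \<alpha> l * (\<Sum>y\<in>leaves d d l. v (x @ y)) + \<beta> * (\<Sum>e\<in>star_level d l 1. V (k + l) {graft x ` e, edge x} f))"
    proof (rule sum_mono)
      fix x assume x: "x \<in> lvs k"
      show "D {edge x} \<le> A * v x + A * (\<Sum>y\<in>nodes d d (l - 1). v (x @ y))
        + \<alpha> l * (\<Sum>y\<in>leaves d d l. v (x @ y)) + \<beta> * (\<Sum>e\<in>star_level d l 1. V (k + l) {graft x ` e, edge x} f)"
        using leaf_contribution_le[where f = f, OF k x f] level_sum_le[OF k x, of f] unfolding D_def B_def v_def by linarith
    qed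
    also have "\<dots> = A * SX + A * SM + \<alpha> l * SF + \<beta> * PX"
      unfolding SX_def SM_def SF_def PX_def by (simp only: sum.distrib sum_distrib_left)
    finally show "(\<Sum>x\<in>lvs k. D {edge x}) \<le> A * SX + A * SM + \<alpha> l * SF + \<beta> * PX" .
  qed
  finally have top: "D (reg_tree \<Delta> k) \<le> \<gamma> * (a * SL + b * (A * SX + A * SM + \<alpha> l * SF + \<beta> * PX) + c * PL)" .
  have "V (k + l) B f \<le> \<gamma> * (\<Sum>x\<in>lvs k. \<Sum>y\<in>nodes d d l. v (x @ y))"
    unfolding B_def v_def by (rule var_below_le[where f = f, OF k f])
  then have bottom: "V (k + l) B f \<le> \<gamma> * (SM + SF)"
    unfolding inner sum.distrib SM_def SF_def .
  have "B \<union> reg_tree \<Delta> k = ?E" using reg_tree_mono[of k "k + l" \<Delta>] unfolding B_def by auto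
  \<comment> \<open>Pythagoras splits the total variance into the part within the lower levels and
    the variance of the projection to the upper ones.\<close>
  then have "V (k + l) ?E f = V (k + l) B f + D (reg_tree \<Delta> k)"
    using bexp_pythagoras[OF finite_colorings, of B ?E ?E "k + l" f] unfolding D_def B_def by simp
  also have "\<dots> \<le> \<gamma> * (SM + SF) + \<gamma> * (a * SL + b * (A * SX + A * SM + \<alpha> l * SF + \<beta> * PX) + c * PL)"
    using top bottom by simp
  \<comment> \<open>New interior edges (\<open>SM\<close>) and new leaf edges (\<open>SF\<close>)
    are charged twice: \<open>1\<close> by tensorization, and \<open>A * b\<close> or
    \<open>\<alpha> l * b\<close> through the leaf edge above them. The old leaf edges
    (\<open>SX\<close>) are charged only by the latter.\<close>
  also have "\<dots> = \<gamma> * (a * SL + (A * b) * SX + (1 + A * b) * SM + (1 + \<alpha> l * b) * SF + c * PL + (\<beta> * b) * PX)"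
    by (simp add: algebra_simps)
  also have "\<dots> \<le> \<gamma> * (a' * (SL + SX + SM) + (1 + \<alpha> l * b) * SF + c' * PA)"
  proof (rule mult_left_mono[OF _ \<gamma>])
    have "a * SL \<le> a' * SL" "(1 + A * b) * SM \<le> a' * SM" "c * PL \<le> c' * PL" "(\<beta> * b) * PX \<le> c' * PX"
      using a' c' nonneg by (intro mult_right_mono; simp)+
    moreover have "(A * b) * SX \<le> a' * SX" using a' nonneg by (intro mult_right_mono) auto
    moreover have "c' * (PL + PX) \<le> c' * PA" using PA c' abc by (intro mult_left_mono) auto
    ultimately show "a * SL + (A * b) * SX + (1 + A * b) * SM + (1 + \<alpha> l * b) * SF + c * PL + (\<beta> * b) * PX
        \<le> a' * (SL + SX + SM) + (1 + \<alpha> l * b) * SF + c' * PA"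
      by (simp add: distrib_left)
  qed
  finally show "V (k + l) ?E f \<le> \<gamma> * (a' * (\<Sum>y\<in>vs (k + l - 1). V (k + l) {edge y} f)
      + (1 + \<alpha> l * b) * (\<Sum>x\<in>lvs (k + l). V (k + l) {edge x} f)
      + c' * (\<Sum>p\<in>adjacent_pairs (reg_tree \<Delta> (k + l - 1)). V (k + l) p f))"
    unfolding all[symmetric] leaf[symmetric] PA_def v_def .
qed

lemma leaf_bound_imp:
  assumes bound: "leaf_bound k a b c" and k: "k \<ge> 1" and M: "a \<le> M" "b \<le> M" "c \<le> M"
    and f: "\<forall>\<tau>\<in>colorings k. 0 \<le> f \<tau>" and "0 \<le> M"
  shows "V k (reg_tree \<Delta> k) f \<le> \<gamma> * M * (\<Sum>B\<in>edge_blocks (reg_tree \<Delta> k). V k B f)"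
proof -
  let ?E = "reg_tree \<Delta> k"
  have blocks: "edge_blocks ?E = (\<lambda>e. {e}) ` ?E \<union> adjacent_pairs ?E"
    unfolding edge_blocks_def adjacent_pairs_def by blast
  have "(\<Sum>B\<in>edge_blocks ?E. V k B f) = (\<Sum>B\<in>(\<lambda>e. {e}) ` ?E. V k B f) + (\<Sum>p\<in>adjacent_pairs ?E. V k p f)"
    unfolding blocks
  proof (rule sum.union_disjoint)
    show "(\<lambda>e. {e}) ` ?E \<inter> adjacent_pairs ?E = {}"
      by (auto simp: adjacent_pairs_def adjacent_def doubleton_eq_iff)
  qed (simp_all add: finite_reg_tree finite_adjacent_pairs)
  also have "(\<Sum>B\<in>(\<lambda>e. {e}) ` ?E. V k B f) = (\<Sum>e\<in>?E. V k {e} f)"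
    by (subst sum.reindex) auto
  also have "\<dots> = (\<Sum>y\<in>vs k. V k {edge y} f)"
    unfolding tree_eq[of k] by (subst sum.reindex[OF inj_on_edge]) simp
  finally have sum: "(\<Sum>B\<in>edge_blocks ?E. V k B f) = (\<Sum>y\<in>vs (k - 1). V k {edge y} f)
      + (\<Sum>x\<in>lvs k. V k {edge x} f) + (\<Sum>p\<in>adjacent_pairs ?E. V k p f)"
    unfolding sum_nodes_split[OF k] .
  have pairs: "(\<Sum>p\<in>adjacent_pairs (reg_tree \<Delta> (k - 1)). V k p f) \<le> (\<Sum>p\<in>adjacent_pairs ?E. V k p f)"
    by (intro sum_mono2 finite_adjacent_pairs finite_reg_tree adjacent_pairs_mono reg_tree_mono bvar_nonneg) simp
  have "V k ?E f \<le> \<gamma> * (a * (\<Sum>y\<in>vs (k - 1). V k {edge y} f) + b * (\<Sum>x\<in>lvs k. V k {edge x} f)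
      + c * (\<Sum>p\<in>adjacent_pairs (reg_tree \<Delta> (k - 1)). V k p f))"
    using bound f unfolding leaf_bound_def by blast
  also have "\<dots> \<le> \<gamma> * (M * (\<Sum>y\<in>vs (k - 1). V k {edge y} f) + M * (\<Sum>x\<in>lvs k. V k {edge x} f)
      + M * (\<Sum>p\<in>adjacent_pairs ?E. V k p f))"
  proof (intro mult_left_mono[OF _ \<gamma>] add_mono)
    have "c * (\<Sum>p\<in>adjacent_pairs (reg_tree \<Delta> (k - 1)). V k p f)
        \<le> M * (\<Sum>p\<in>adjacent_pairs (reg_tree \<Delta> (k - 1)). V k p f)"
      using M by (intro mult_right_mono sum_nonneg bvar_nonneg)
    also have "\<dots> \<le> M * (\<Sum>p\<in>adjacent_pairs ?E. V k p f)"
      using pairs \<open>0 \<le> M\<close> by (rule mult_left_mono)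
    finally show "c * (\<Sum>p\<in>adjacent_pairs (reg_tree \<Delta> (k - 1)). V k p f) \<le> M * (\<Sum>p\<in>adjacent_pairs ?E. V k p f)" .
  qed (use M in \<open>auto intro!: mult_right_mono sum_nonneg bvar_nonneg\<close>)
  finally show ?thesis unfolding sum by (simp add: algebra_simps)
qed

text \<open>Tensorization on regular trees of depth 1 to \<open>l\<close> is the base and each step
  adds \<open>l\<close> levels, so \<open>(k - 1) div l\<close> counts the steps. The leaf
  coefficient obeys \<open>b (Suc m) = 1 + \<alpha> l * b m\<close>, which makes it a geometric
  sum.\<close>

lemma leaf_bound_all:
  assumes \<beta>: "\<beta> \<ge> 1" and \<alpha>: "\<alpha> l \<ge> 0"
    and base: "\<And>j f. 1 \<le> j \<Longrightarrow> j \<le> l \<Longrightarrow> (\<And>\<tau>. \<tau> \<in> colorings j \<Longrightarrow> 0 \<le> f \<tau>) \<Longrightarrow>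
      V j (reg_tree \<Delta> j) f \<le> \<gamma> * (\<Sum>e\<in>reg_tree \<Delta> j. V j {e} f)"
  defines "b \<equiv> \<lambda>m. \<Sum>i=0..m. \<alpha> l ^ i"
  assumes k: "k \<ge> 1"
  shows "leaf_bound k (\<beta> * (A * b ((k - 1) div l) + 1)) (b ((k - 1) div l)) (\<beta> * (A * b ((k - 1) div l) + 1))"
  using k
proof (induction k rule: less_induct)
  case (less k)
  have b_pos: "b m \<ge> 0" for m unfolding b_def using \<alpha> by (intro sum_nonneg) simp
  have b_Suc: "b (Suc m) = 1 + \<alpha> l * b m" for m
    unfolding b_def sum.atLeast0_atMost_Suc_shift by (simp add: sum_distrib_left)
  show ?case
  proof (cases "k \<le> l")
    case True
    then have m: "(k - 1) div l = 0" using l by simp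
    have b0: "b 0 = 1" by (simp add: b_def)
    have c: "\<beta> * (A * 1 + 1) \<ge> 1"
    proof -
      have "1 * 1 \<le> \<beta> * (A * 1 + 1)" using \<beta> A(1) by (intro mult_mono) auto
      then show ?thesis by simp
    qed
    show ?thesis unfolding leaf_bound_def m b0
    proof (intro allI impI)
      fix f :: "(nat list set \<Rightarrow> nat) \<Rightarrow> real" assume f: "\<forall>\<tau>\<in>colorings k. 0 \<le> f \<tau>"
      let ?c = "\<beta> * (A * 1 + 1)"
      have "V k (reg_tree \<Delta> k) f \<le> \<gamma> * (\<Sum>e\<in>reg_tree \<Delta> k. V k {e} f)"
        using base[OF less.prems True] f by blast
      also have "(\<Sum>e\<in>reg_tree \<Delta> k. V k {e} f) = (\<Sum>y\<in>vs k. V k {edge y} f)"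
        unfolding tree_eq[of k] by (subst sum.reindex[OF inj_on_edge]) simp
      also have "\<dots> = 1 * (\<Sum>y\<in>vs (k - 1). V k {edge y} f) + 1 * (\<Sum>x\<in>lvs k. V k {edge x} f)"
        unfolding sum_nodes_split[OF less.prems] by simp
      also have "\<gamma> * \<dots> \<le> \<gamma> * (?c * (\<Sum>y\<in>vs (k - 1). V k {edge y} f) + 1 * (\<Sum>x\<in>lvs k. V k {edge x} f)
          + ?c * (\<Sum>p\<in>adjacent_pairs (reg_tree \<Delta> (k - 1)). V k p f))"
      proof (rule mult_left_mono[OF _ \<gamma>])
        have "1 * (\<Sum>y\<in>vs (k - 1). V k {edge y} f) \<le> ?c * (\<Sum>y\<in>vs (k - 1). V k {edge y} f)"
          using c by (intro mult_right_mono sum_nonneg bvar_nonneg)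
        moreover have "0 \<le> ?c * (\<Sum>p\<in>adjacent_pairs (reg_tree \<Delta> (k - 1)). V k p f)"
          using order_trans[OF zero_le_one c] by (rule mult_nonneg_nonneg) (intro sum_nonneg bvar_nonneg)
        ultimately show "1 * (\<Sum>y\<in>vs (k - 1). V k {edge y} f) + 1 * (\<Sum>x\<in>lvs k. V k {edge x} f)
          \<le> ?c * (\<Sum>y\<in>vs (k - 1). V k {edge y} f) + 1 * (\<Sum>x\<in>lvs k. V k {edge x} f)
          + ?c * (\<Sum>p\<in>adjacent_pairs (reg_tree \<Delta> (k - 1)). V k p f)" by linarith
      qed
      finally show "V k (reg_tree \<Delta> k) f \<le> \<gamma> * (?c * (\<Sum>y\<in>vs (k - 1). V k {edge y} f)
          + 1 * (\<Sum>x\<in>lvs k. V k {edge x} f)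
          + ?c * (\<Sum>p\<in>adjacent_pairs (reg_tree \<Delta> (k - 1)). V k p f))" .
    qed
  next
    case False
    define k' where "k' = k - l"
    have k': "k = k' + l" "1 \<le> k'" "k' < k" using False l unfolding k'_def by auto
    define m where "m = (k' - 1) div l"
    have "k - 1 = (k' - 1) + l" using k' by simp
    then have m: "(k - 1) div l = Suc m" unfolding m_def using l by (simp only: div_add_self2)
    have IH: "leaf_bound k' (\<beta> * (A * b m + 1)) (b m) (\<beta> * (A * b m + 1))"
      unfolding m_def by (rule less.IH[OF k'(3,2)])
    have le: "b m \<le> b (Suc m)" unfolding b_def using \<alpha> by simp
    have "A * b m \<le> A * b (Suc m)" using le A(1) by (rule mult_left_mono)
    then have aa: "\<beta> * (A * b m + 1) \<le> \<beta> * (A * b (Suc m) + 1)" using \<beta> by (intro mult_left_mono) auto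
    have nonneg: "0 \<le> A * b m + 1" using A(1) b_pos[of m] by (simp add: add_nonneg_nonneg)
    have one: "1 + A * b m \<le> \<beta> * (A * b m + 1)"
      using mult_right_mono[OF \<beta> nonneg] by simp
    have "\<alpha> l * b m \<le> A * b m" using A(2)[of l] b_pos by (intro mult_right_mono) auto
    \<comment> \<open>By monotonicity and the recurrence,
      \<open>b m \<le> 1 + \<alpha> l * b m\<close>. Hence the pair coefficient
      \<open>\<beta> * b m\<close> is covered by the bound for single edges.\<close>
    then have "b m \<le> A * b m + 1" using le b_Suc[of m] by linarith
    then have bb: "\<beta> * b m \<le> \<beta> * (A * b m + 1)" using \<beta> by (intro mult_left_mono) auto
    have a: "0 \<le> \<beta> * (A * b m + 1)" using \<beta> nonneg by (intro mult_nonneg_nonneg) auto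
    have "leaf_bound (k' + l) (\<beta> * (A * b (Suc m) + 1)) (1 + \<alpha> l * b m) (\<beta> * (A * b (Suc m) + 1))"
      by (rule leaf_bound_step[OF k'(2) IH a b_pos a aa order_trans[OF one aa] aa order_trans[OF bb aa]])
    then show ?thesis unfolding m unfolding k'(1) b_Suc[of m] .
  qed
qed

end

subsection \<open>Signs of the constants\<close>

lemma tensorization_constant_nonneg:
  assumes \<Delta>: "\<Delta> \<ge> 2" and q: "q \<ge> \<Delta> + 1"
    and tens: "\<And>f. (\<forall>\<sigma>\<in>list_edge_colorings (reg_tree \<Delta> 1) (\<lambda>_. {1..q}). 0 \<le> f \<sigma>) \<Longrightarrow>
      bvar (reg_tree \<Delta> 1) (list_edge_colorings (reg_tree \<Delta> 1) (\<lambda>_. {1..q})) (reg_tree \<Delta> 1) f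
      \<le> \<gamma> * (\<Sum>e\<in>reg_tree \<Delta> 1. bvar (reg_tree \<Delta> 1) (list_edge_colorings (reg_tree \<Delta> 1) (\<lambda>_. {1..q})) {e} f)"
  shows "\<gamma> \<ge> 0"
proof -
  let ?E = "reg_tree \<Delta> 1" and ?\<sigma> = "greedy_reg \<Delta> 1"
  let ?\<Omega> = "list_edge_colorings ?E (\<lambda>_. {1..q})"
  let ?e = "edge [0]"
  let ?f = "\<lambda>\<tau>. if \<tau> ?e = \<Delta> + 1 then 1 else 0 :: real"
  have e: "?e \<in> ?E" using \<Delta> by (auto simp: reg_tree_eq nodes_def rooted_vertices_def)
  have fin: "finite ?\<Omega>" by (intro finite_list_edge_colorings finite_reg_tree) simp
  have \<sigma>: "?\<sigma> \<in> ?\<Omega>" using \<Delta> q by (intro greedy_reg_in) auto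
  have free: "?\<sigma> e' \<noteq> \<Delta> + 1" if "e' \<in> ?E" for e'
  proof -
    have "Max (weight ` e') mod \<Delta> < \<Delta>" using \<Delta> by simp
    then show ?thesis using that unfolding greedy_reg_def by simp
  qed
  have \<tau>: "?\<sigma>(?e := \<Delta> + 1) \<in> ?\<Omega>"
    using \<sigma> e q free by (intro list_edge_colorings_recolor) auto
  have "0 < bvar ?E ?\<Omega> ?E ?f"
    by (rule bvar_pos[OF fin \<sigma> \<tau>]) (use free[OF e] in auto)
  also have "\<dots> \<le> \<gamma> * (\<Sum>e\<in>?E. bvar ?E ?\<Omega> {e} ?f)" by (rule tens) simp
  finally have "0 < \<gamma> * (\<Sum>e\<in>?E. bvar ?E ?\<Omega> {e} ?f)" .
  moreover have "0 \<le> (\<Sum>e\<in>?E. bvar ?E ?\<Omega> {e} ?f)" by (intro sum_nonneg bvar_nonneg)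
  ultimately show ?thesis by (simp add: zero_less_mult_iff)
qed

text \<open>Testing the root variance inequality on a function of the colour of a single leaf edge
  annihilates every term on the right except the one of \<open>\<alpha> l\<close>.\<close>

lemma leaf_constant_nonneg:
  fixes d q l :: nat and \<alpha> :: "nat \<Rightarrow> real" and \<beta> :: real
  defines "\<Omega> \<equiv> list_edge_colorings (star_tree d l) (\<lambda>e. if e = root_edge then {1..q - d} else {1..q})"
  assumes d: "d \<ge> 1" and q: "q \<ge> d + 2" and l: "l \<ge> 2"
    and RV: "\<And>g. (\<And>\<rho>. \<rho> \<in> \<Omega> \<Longrightarrow> 0 \<le> g \<rho>) \<Longrightarrow>
      (\<Sum>\<rho>\<in>\<Omega>. (bexp (star_tree d l) \<Omega> (star_tree d l - {root_edge}) g \<rho>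
        - bexp (star_tree d l) \<Omega> (star_tree d l) g \<rho>)\<^sup>2)
      \<le> (\<Sum>i=0..l. \<alpha> i * (\<Sum>e\<in>star_level d l i. bvar (star_tree d l) \<Omega> {e} g))
        + \<beta> * (\<Sum>e\<in>star_level d l 1. bvar (star_tree d l) \<Omega> {e, root_edge} g)"
  shows "\<alpha> l \<ge> 0"
proof -
  let ?E = "star_tree d l" and ?\<sigma> = "greedy_star d l"
  \<comment> \<open>The leftmost leaf. Its edge belongs to level \<open>l\<close> alone, and
    \<open>l \<ge> 2\<close> keeps it out of level 1 and hence out of every pair with the root
    edge.\<close>
  define y where "y = replicate l (0::nat)"
  define s where "s = Some ` edge y"
  \<comment> \<open>The explicit colouring uses only colours up to \<open>d + 1\<close>, and
    \<open>q \<ge> d + 2\<close> makes \<open>d + 2\<close> available.\<close>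
  define f where "f \<tau> = (if \<tau> s = d + 2 then 1 else 0 :: real)" for \<tau> :: "nat list option set \<Rightarrow> nat"
  have y: "y \<in> nodes d d l" "length y = l" using d l by (auto simp: y_def in_nodes_same)
  have s: "s \<in> ?E" "s \<noteq> root_edge"
    using y Some_edge_neq_root by (auto simp: s_def star_tree_eq simp del: image_insert)
  have fin: "finite \<Omega>" unfolding \<Omega>_def by (rule finite_list_edge_colorings[OF finite_star_tree]) simp
  have \<sigma>: "?\<sigma> \<in> \<Omega>" unfolding \<Omega>_def using q by (intro greedy_star_in) auto
  have free: "?\<sigma> e \<noteq> d + 2" if "e \<in> ?E" for e
  proof -
    have "Max (case_option 0 weight ` e) mod (d + 1) < d + 1" by simp
    then have "1 + Max (case_option 0 weight ` e) mod (d + 1) \<noteq> d + 2" by linarith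
    then show ?thesis using that unfolding greedy_star_def by simp
  qed
  have \<tau>: "?\<sigma>(s := d + 2) \<in> \<Omega>"
    unfolding \<Omega>_def using \<sigma> s q free by (intro list_edge_colorings_recolor) (auto simp: \<Omega>_def)
  have pos: "0 < bvar ?E \<Omega> {s} f"
    by (rule bvar_pos[OF fin \<sigma> \<tau>]) (use free[OF s(1)] in \<open>auto simp: f_def\<close>)
  have zero: "bvar ?E \<Omega> S f = 0" if "s \<notin> S" for S
    by (rule bvar_eq_0[OF fin]) (use that s(1) in \<open>simp add: f_def\<close>)
  have s_level: "s \<in> star_level d l i \<longleftrightarrow> i = l" for i
  proof (cases "i = 0")
    case True then show ?thesis using s(2) l by (simp add: star_level_0)
  next
    case False
    then have "star_level d l i = (\<lambda>y. Some ` edge y) ` {y \<in> nodes d d l. length y = i}"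
      by (intro star_level_eq) simp
    moreover have "s \<in> (\<lambda>y. Some ` edge y) ` {y \<in> nodes d d l. length y = i} \<longleftrightarrow> y \<in> {y \<in> nodes d d l. length y = i}"
      unfolding s_def by (rule inj_on_image_mem_iff[OF inj_on_Some_edge y(1)]) auto
    ultimately show ?thesis using y by auto
  qed
  have "0 \<le> (\<Sum>\<rho>\<in>\<Omega>. (bexp ?E \<Omega> (?E - {root_edge}) f \<rho> - bexp ?E \<Omega> ?E f \<rho>)\<^sup>2)"
    by (intro sum_nonneg) simp
  also have "\<dots> \<le> (\<Sum>i=0..l. \<alpha> i * (\<Sum>e\<in>star_level d l i. bvar ?E \<Omega> {e} f))
        + \<beta> * (\<Sum>e\<in>star_level d l 1. bvar ?E \<Omega> {e, root_edge} f)"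
    by (rule RV) (simp add: f_def)
  also have "(\<Sum>e\<in>star_level d l 1. bvar ?E \<Omega> {e, root_edge} f) = 0"
  proof (rule sum.neutral, rule ballI)
    fix e assume "e \<in> star_level d l 1"
    then have "s \<noteq> e" using s_level[of 1] l by auto
    then show "bvar ?E \<Omega> {e, root_edge} f = 0" using s(2) by (intro zero) simp
  qed
  also have "(\<Sum>i=0..l. \<alpha> i * (\<Sum>e\<in>star_level d l i. bvar ?E \<Omega> {e} f))
      = (\<Sum>i=0..l. if i = l then \<alpha> l * (\<Sum>e\<in>star_level d l l. bvar ?E \<Omega> {e} f) else 0)"
  proof (rule sum.cong[OF refl])
    fix i
    have "(\<Sum>e\<in>star_level d l i. bvar ?E \<Omega> {e} f) = 0" if "i \<noteq> l"
    proof (rule sum.neutral, rule ballI)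
      fix e assume "e \<in> star_level d l i"
      then have "s \<noteq> e" using s_level[of i] that by auto
      then show "bvar ?E \<Omega> {e} f = 0" by (intro zero) simp
    qed
    then show "\<alpha> i * (\<Sum>e\<in>star_level d l i. bvar ?E \<Omega> {e} f)
        = (if i = l then \<alpha> l * (\<Sum>e\<in>star_level d l l. bvar ?E \<Omega> {e} f) else 0)" by auto
  qed
  finally have "0 \<le> \<alpha> l * (\<Sum>e\<in>star_level d l l. bvar ?E \<Omega> {e} f)" by simp
  moreover have "0 < (\<Sum>e\<in>star_level d l l. bvar ?E \<Omega> {e} f)"
  proof (rule sum_pos2[of _ s])
    show "finite (star_level d l l)"
      by (rule finite_subset[OF _ finite_star_tree[of d l]]) (auto simp: star_level_def star_tree_eq)
    show "s \<in> star_level d l l" by (simp add: s_level)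
  qed (use pos bvar_nonneg in auto)
  ultimately show ?thesis by (simp add: zero_le_mult_iff)
qed

text \<open>The coefficients \<open>1 + A * b\<close> of single edges come without a factor \<beta>.
  The assumption \<open>\<beta> \<ge> 1\<close> allows the one bound with \<beta> in front to serve
  both for single edges and for pairs.\<close>

theorem theorem3p13:
  fixes \<Delta> q d l :: nat and \<alpha> :: "nat \<Rightarrow> real" and \<beta> \<gamma> :: real
  assumes "\<Delta> \<ge> 2" and "q \<ge> \<Delta> + 1" and "d = \<Delta> - 1" and "l \<ge> 2"
    and "\<beta> \<ge> 1"
    and root_variance: "\<And>f :: (nat list option set \<Rightarrow> nat) \<Rightarrow> real.
      (\<forall>\<sigma>\<in>set_pmf (mu_star d q l). 0 \<le> f \<sigma>) \<Longrightarrow>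
      measure_pmf.variance (mu_star d q l)
        (block_exp (star_tree d l) (mu_star d q l) (star_tree d l - {root_edge}) f)
      \<le> (\<Sum>i=0..l. \<alpha> i * (\<Sum>e\<in>star_level d l i.
            measure_pmf.expectation (mu_star d q l)
              (block_var (star_tree d l) (mu_star d q l) {e} f)))
        + \<beta> * (\<Sum>e\<in>star_level d l 1.
            measure_pmf.expectation (mu_star d q l)
              (block_var (star_tree d l) (mu_star d q l) {e, root_edge} f))"
    and tensorization: "\<And>j. 1 \<le> j \<Longrightarrow> j \<le> l \<Longrightarrow>
      approx_tensorization (reg_tree \<Delta> j) (mu \<Delta> q j) \<gamma> \<and>
      approx_tensorization (star_tree d j) (mu_star1 d q j) \<gamma>"
  shows "\<forall>k\<ge>1. \<exists>C'.
    block_factorization (reg_tree \<Delta> k) (mu \<Delta> q k) C' \<and>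
    (\<forall>B\<subseteq>reg_tree \<Delta> k.
      (B \<in> edge_blocks (reg_tree \<Delta> k) \<longrightarrow>
        C' B \<le> \<beta> * \<gamma> * ((MAX j\<in>{0..l}. \<alpha> j) * (\<Sum>i=0..k div l. \<alpha> l ^ i) + max 1 (\<alpha> 0))) \<and>
      (B \<notin> edge_blocks (reg_tree \<Delta> k) \<longrightarrow> C' B = 0))"
proof -
  let ?\<Omega>1 = "list_edge_colorings (star_tree d l) (\<lambda>e. if e = root_edge then {1} else {1..q})"
  let ?\<Omega>s = "list_edge_colorings (star_tree d l) (\<lambda>e. if e = root_edge then {1..q - d} else {1..q})"
  let ?\<Omega> = "\<lambda>k. list_edge_colorings (reg_tree \<Delta> k) (\<lambda>_. {1..q})"
  let ?E = "star_tree d l"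
  define A where "A = (MAX j\<in>{0..l}. \<alpha> j)"
  have qd: "q \<ge> d + 2" "d \<ge> 1" using assms(1-3) by auto
  have fin1: "finite ?\<Omega>1" and fins: "finite ?\<Omega>s"
    by (rule finite_list_edge_colorings[OF finite_star_tree]; simp)+
  have ne1: "?\<Omega>1 \<noteq> {}" using greedy_star_in[of "{1}" d q l] qd by auto
  have "1 \<in> {1..q - d}" using qd by simp
  then have nes: "?\<Omega>s \<noteq> {}" using greedy_star_in[of "{1..q - d}" d q l] qd by auto
  have fin: "finite (?\<Omega> k)" for k by (intro finite_list_edge_colorings finite_reg_tree) simp
  have ne: "?\<Omega> k \<noteq> {}" for k using greedy_reg_in[of \<Delta> q k] assms(1,2) by auto
  have tens: "bvar (reg_tree \<Delta> j) (?\<Omega> j) (reg_tree \<Delta> j) f \<le> \<gamma> * (\<Sum>e\<in>reg_tree \<Delta> j. bvar (reg_tree \<Delta> j) (?\<Omega> j) {e} f)"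
    if "1 \<le> j" "j \<le> l" "\<forall>\<sigma>\<in>?\<Omega> j. 0 \<le> f \<sigma>" for j f
    using tensorization[OF that(1,2)] that(3) unfolding mu_def approx_tensorization_uniform[OF fin ne] by blast
  have AT: "bvar ?E ?\<Omega>1 ?E g \<le> \<gamma> * (\<Sum>e\<in>?E. bvar ?E ?\<Omega>1 {e} g)"
    if "\<And>\<rho>. \<rho> \<in> ?\<Omega>1 \<Longrightarrow> 0 \<le> g \<rho>" for g
  proof -
    have "approx_tensorization ?E (mu_star1 d q l) \<gamma>" using tensorization[of l] assms(4) by simp
    then show ?thesis
      using that unfolding mu_star1_def approx_tensorization_uniform[OF fin1 ne1] by blast
  qed
  have RV: "(\<Sum>\<rho>\<in>?\<Omega>s. (bexp ?E ?\<Omega>s (?E - {root_edge}) g \<rho> - bexp ?E ?\<Omega>s ?E g \<rho>)\<^sup>2)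
      \<le> (\<Sum>i=0..l. \<alpha> i * (\<Sum>e\<in>star_level d l i. bvar ?E ?\<Omega>s {e} g))
        + \<beta> * (\<Sum>e\<in>star_level d l 1. bvar ?E ?\<Omega>s {e, root_edge} g)"
    if g: "\<And>\<rho>. \<rho> \<in> ?\<Omega>s \<Longrightarrow> 0 \<le> g \<rho>" for g
  proof -
    have "0 < real (card ?\<Omega>s)" using fins nes by (simp add: card_gt_0_iff)
    moreover have "(\<Sum>\<rho>\<in>?\<Omega>s. (bexp ?E ?\<Omega>s (?E - {root_edge}) g \<rho> - bexp ?E ?\<Omega>s ?E g \<rho>)\<^sup>2) / card ?\<Omega>s
      \<le> ((\<Sum>i=0..l. \<alpha> i * (\<Sum>e\<in>star_level d l i. bvar ?E ?\<Omega>s {e} g))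
        + \<beta> * (\<Sum>e\<in>star_level d l 1. bvar ?E ?\<Omega>s {e, root_edge} g)) / card ?\<Omega>s"
      using root_variance[of g] g
      unfolding mu_star_def variance_block_exp_uniform[OF fins nes] expectation_block_var_uniform[OF fins nes]
        sum_divide_distrib[symmetric] times_divide_eq_right add_divide_distrib set_pmf_of_set[OF nes fins]
      by blast
    ultimately show ?thesis by (simp only: divide_le_cancel)
  qed
  have \<gamma>: "\<gamma> \<ge> 0"
    using tens[of 1] assms(4) by (intro tensorization_constant_nonneg[OF assms(1,2)]) auto
  have \<alpha>: "\<alpha> l \<ge> 0" by (rule leaf_constant_nonneg[OF qd(2,1) assms(4) RV])
  have A_ge: "\<alpha> i \<le> A" if "i \<le> l" for i using that unfolding A_def by (intro Max_ge) auto
  then have A0: "A \<ge> 0" using \<alpha> by (meson order_refl order_trans)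
  interpret tree_recursion \<Delta> q d l \<alpha> \<beta> \<gamma> A
  proof unfold_locales
    fix g :: "(nat list option set \<Rightarrow> nat) \<Rightarrow> real" assume "\<And>\<rho>. \<rho> \<in> ?\<Omega>1 \<Longrightarrow> 0 \<le> g \<rho>"
    then show "bvar ?E ?\<Omega>1 ?E g \<le> \<gamma> * (\<Sum>e\<in>?E. bvar ?E ?\<Omega>1 {e} g)" by (rule AT)
  next
    fix g :: "(nat list option set \<Rightarrow> nat) \<Rightarrow> real" assume "\<And>\<rho>. \<rho> \<in> ?\<Omega>s \<Longrightarrow> 0 \<le> g \<rho>"
    then show "(\<Sum>\<rho>\<in>?\<Omega>s. (bexp ?E ?\<Omega>s (?E - {root_edge}) g \<rho> - bexp ?E ?\<Omega>s ?E g \<rho>)\<^sup>2)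
      \<le> (\<Sum>i=0..l. \<alpha> i * (\<Sum>e\<in>star_level d l i. bvar ?E ?\<Omega>s {e} g))
        + \<beta> * (\<Sum>e\<in>star_level d l 1. bvar ?E ?\<Omega>s {e, root_edge} g)" by (rule RV)
  qed (fact assms(1-4) \<gamma> A_ge A0)+
  show ?thesis
  proof (intro allI impI)
    fix k :: nat assume k: "k \<ge> 1"
    let ?T = "reg_tree \<Delta> k"
    define b where "b m = (\<Sum>i=0..m. \<alpha> l ^ i)" for m
    \<comment> \<open>Weakens the constant of the recursion to the stated form:
      \<open>max 1 (\<alpha> 0)\<close> dominates the \<open>1\<close> from tensorization, and
      \<open>k div l\<close> dominates \<open>(k - 1) div l\<close>, with extra terms nonnegative
      because \<open>\<alpha> l \<ge> 0\<close>.\<close>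
    define M where "M = \<beta> * (A * b (k div l) + max 1 (\<alpha> 0))"
    define C where "C B = (if B \<in> edge_blocks ?T then \<gamma> * M else 0)" for B
    have bound: "leaf_bound k (\<beta> * (A * b ((k - 1) div l) + 1)) (b ((k - 1) div l)) (\<beta> * (A * b ((k - 1) div l) + 1))"
      unfolding b_def using tens by (intro leaf_bound_all[OF assms(5) \<alpha> _ k]) blast
    have b_pos: "b m \<ge> 0" for m unfolding b_def using \<alpha> by (intro sum_nonneg) simp
    have "b ((k - 1) div l) \<le> b (k div l)"
      unfolding b_def using \<alpha> div_le_mono[of "k - 1" k l] by (intro sum_mono2) auto
    then have "A * b ((k - 1) div l) \<le> A * b (k div l)" using A0 by (rule mult_left_mono)
    then have "A * b ((k - 1) div l) + 1 \<le> A * b (k div l) + max 1 (\<alpha> 0)" by (rule add_mono) simp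
    then have aM: "\<beta> * (A * b ((k - 1) div l) + 1) \<le> M"
      unfolding M_def using assms(5) by (intro mult_left_mono) auto
    \<comment> \<open>Again the recurrence for \<open>b\<close> and
      \<open>\<alpha> l \<le> A\<close>; this puts the leaf coefficient, which has no factor
      \<open>A\<close>, under the common bound.\<close>
    have le: "b m \<le> A * b m + 1" for m
    proof (cases m)
      case 0
      then show ?thesis using A0 by (simp add: b_def)
    next
      case (Suc n)
      have "b m = 1 + \<alpha> l * b n"
        unfolding b_def Suc sum.atLeast0_atMost_Suc_shift by (simp add: sum_distrib_left)
      also have "\<dots> \<le> 1 + A * b m"
      proof -
        have "b n \<le> b m" unfolding b_def Suc using \<alpha> by simp
        then have "\<alpha> l * b n \<le> A * b m" using A_ge[of l] A0 b_pos[of n] by (intro mult_mono) auto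
        then show ?thesis by simp
      qed
      finally show ?thesis by simp
    qed
    have nn: "0 \<le> A * b ((k - 1) div l) + 1" using le[of "(k - 1) div l"] b_pos[of "(k - 1) div l"] by linarith
    have "A * b ((k - 1) div l) + 1 \<le> \<beta> * (A * b ((k - 1) div l) + 1)"
      using mult_right_mono[OF assms(5) nn] by simp
    then have bM: "b ((k - 1) div l) \<le> M" using le[of "(k - 1) div l"] aM by linarith
    have M0: "0 \<le> M" using bM b_pos[of "(k - 1) div l"] by linarith
    have "block_factorization ?T (mu \<Delta> q k) C"
      unfolding mu_def block_factorization_uniform[OF fin ne]
    proof (intro allI impI)
      fix f :: "(nat list set \<Rightarrow> nat) \<Rightarrow> real" assume "\<forall>\<sigma>\<in>?\<Omega> k. 0 \<le> f \<sigma>"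
      from leaf_bound_imp[OF bound k aM bM aM this M0]
      have "V k ?T f \<le> \<gamma> * M * (\<Sum>B\<in>edge_blocks ?T. V k B f)" .
      also have "\<dots> = (\<Sum>B\<in>edge_blocks ?T. C B * V k B f)"
        by (simp add: C_def sum_distrib_left)
      also have "\<dots> = (\<Sum>B\<in>Pow ?T. C B * V k B f)"
        by (rule sum.mono_neutral_left) (auto simp: finite_reg_tree C_def edge_blocks_def)
      finally show "V k ?T f \<le> (\<Sum>B\<in>Pow ?T. C B * V k B f)" .
    qed
    moreover have "C B \<le> \<beta> * \<gamma> * ((MAX j\<in>{0..l}. \<alpha> j) * (\<Sum>i=0..k div l. \<alpha> l ^ i) + max 1 (\<alpha> 0))"
      if "B \<in> edge_blocks ?T" for B
      using that unfolding C_def M_def A_def b_def by (simp add: algebra_simps)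
    ultimately show "\<exists>C'. block_factorization ?T (mu \<Delta> q k) C' \<and> (\<forall>B\<subseteq>?T.
        (B \<in> edge_blocks ?T \<longrightarrow>
          C' B \<le> \<beta> * \<gamma> * ((MAX j\<in>{0..l}. \<alpha> j) * (\<Sum>i=0..k div l. \<alpha> l ^ i) + max 1 (\<alpha> 0))) \<and>
        (B \<notin> edge_blocks ?T \<longrightarrow> C' B = 0))"
      by (intro exI[of _ C]) (simp add: C_def)
  qed
qed

end
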